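(* Let $\Omega\subset\mathbb{R}^n$ be a domain and let $F:\Omega\to\mathbb{R}^m$ be a smooth map whose graph $\Sigma=\{(x,F(x)):x\in\Omega\}$ is a minimal submanifold of $\mathbb{R}^{n+m}$. Suppose that $r=\sup_{x\in\Omega}\operatorname{rank}(\mathrm{d}F|_x)\ge 2$. If at every point of $\Omega$ the singular values $\lambda_1\ge\lambda_2\ge\cdots$ of $\mathrm{d}F$ satisfy $$\lambda_j\lambda_k\le\frac{1}{(r-1)^2}\qquad\text{for all }1\le j<k\le r,$$ then the $n$-form $\Theta(F)$ on $\Omega\times\mathbb{R}^m$ is a calibration, and $\Sigma$ is calibrated by $\Theta(F)$.
   Context: Minimal means that the mean curvature vector vanishes identically. Singular values are the eigenvalues of $\sqrt{(\mathrm{d}F)^*\mathrm{d}F}$, listed in decreasing order. Comass and calibrations. The comass of an $n$-form at a point is the supremum of its values on all oriented unit $n$-planes (i.e. on all orthonormal $n$-tuples). A calibration is a closed form whose comass is at most one at every point. An oriented submanifold $\Sigma$ is calibrated by a calibration $\Theta$ if $\Theta|_\Sigma=\operatorname{vol}_\Sigma$. Definition of $\Theta(F)$ for a smooth map $F:\Omega\subset\mathbb{R}^n\to\mathbb{R}^m$. Fix the standard orientation of $\mathbb{R}^n$; orient the graph $\Sigma$ so that the projection $\pi_1:\Sigma\to\Omega$ preserves orientation, and let $\operatorname{vol}_\Sigma$ be the induced volume form. For $p\in\Sigma$ put $D=\mathrm{d}F|_{\pi_1(p)}:\mathbb{R}^n\to\mathbb{R}^m$, $G=\mathbf{I}_n+D^*D$,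 $H=\mathbf{I}_m+DD^*$. Define isometric isomorphisms $L_p:\mathbb{R}^n\to T_p\Sigma$, $L_p(v)=(G^{-1/2}v,\,DG^{-1/2}v)$, and $L_p^\perp:\mathbb{R}^m\to N_p\Sigma$, $L_p^\perp(w)=(-D^*H^{-1/2}w,\,H^{-1/2}w)$, onto the tangent and normal spaces, and set $J_p=L_p^\perp\circ D\circ L_p^{-1}:T_p\Sigma\to N_p\Sigma$. For $\xi\in\Lambda^k(\mathbb{R}^n\times\mathbb{R}^m)^*$ at $p$ put $\Psi(\xi)=\sum_{i=1}^n (J_p(e_i))^\flat\wedge\iota_{e_i}\xi$, where $e_1,\dots,e_n$ is any orthonormal basis of $T_p\Sigma$ (the result is independent of the basis), $\iota$ is interior multiplication, and $\flat$ is the metric dual. View $\operatorname{vol}_\Sigma$ at $p$ as the $n$-form on $\mathbb{R}^{n+m}$ that vanishes when contracted with normal vectors, and set $\Psi^\ell(F)=\Psi^{\ell}(\operatorname{vol}_\Sigma)$ ($\ell$-fold iterate). This is defined along $\Sigma$ and is extended to an $n$-form on $\Omega\times\mathbb{R}^m$ by parallel transport along the $\mathbb{R}^m$ factor, i.e. its value at $(x,y)$ is its value at $(x,F(x))$. Finally $$\Theta(F)=\Psi^0(F)-\sum_{\ell\ge1}(-1)^\ell\,\frac{\ell-1}{\ell!}\,\Psi^\ell(F).$$ *)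

theory Defs
  imports "HOL-Analysis.Analysis"
begin

section \<open>Smooth maps\<close>

text \<open>Meant for open \<open>U\<close>. Iterating directional derivatives of Frechet differentiable maps
  avoids a tower of spaces of linear maps; in finite dimension this is the usual \<open>C\<^sup>k\<close>.\<close>

primrec Ck_on :: "nat \<Rightarrow> ('a::euclidean_space \<Rightarrow> 'b::euclidean_space) \<Rightarrow> 'a set \<Rightarrow> bool" where
  "Ck_on 0 f U \<longleftrightarrow> continuous_on U f"
| "Ck_on (Suc k) f U \<longleftrightarrow> (\<forall>x\<in>U. f differentiable (at x)) \<and>
     (\<forall>v. Ck_on k (\<lambda>x. frechet_derivative f (at x) v) U)"

definition smooth_on :: "('a::euclidean_space \<Rightarrow> 'b::euclidean_space) \<Rightarrow> 'a set \<Rightarrow> bool" where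
  "smooth_on f U \<longleftrightarrow> (\<forall>k. Ck_on k f U)"

section \<open>Square roots of operators and singular values\<close>

definition pos_semidef :: "('a::euclidean_space \<Rightarrow> 'a) \<Rightarrow> bool" where
  "pos_semidef A \<longleftrightarrow> linear A \<and> adjoint A = A \<and> (\<forall>v. 0 \<le> A v \<bullet> v)"

definition op_sqrt :: "('a::euclidean_space \<Rightarrow> 'a) \<Rightarrow> 'a \<Rightarrow> 'a" where
  "op_sqrt A = (THE B. pos_semidef B \<and> B \<circ> B = A)"

text \<open>Eigenvalues of \<open>op_sqrt (adjoint D \<circ> D)\<close>, repeated according to multiplicity
  (the eigenspace of a non-eigenvalue has dimension \<open>0\<close>).\<close>

definition singular_values :: "('a::euclidean_space \<Rightarrow> 'b::euclidean_space) \<Rightarrow> real list" where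
  "singular_values D = (THE s. sorted_wrt (\<ge>) s \<and>
     (\<forall>c. count_list s c = dim {v. op_sqrt (adjoint D \<circ> D) v = c *\<^sub>R v}))"

text \<open>Indexed from \<open>1\<close>, for \<open>j \<le> DIM('a)\<close>.\<close>

definition singular_value :: "('a::euclidean_space \<Rightarrow> 'b::euclidean_space) \<Rightarrow> nat \<Rightarrow> real" where
  "singular_value D j = singular_values D ! (j - 1)"

section \<open>Exterior algebra and differential forms\<close>

text \<open>A \<open>k\<close>-form on a vector space is a real function on lists of vectors; only its values on
  lists of length \<open>k\<close> are meaningful.\<close>

type_synonym 'v form = "'v list \<Rightarrow> real"

definition alternating_form :: "nat \<Rightarrow> 'v::real_vector form \<Rightarrow> bool" where
  "alternating_form k \<xi> \<longleftrightarrow> (\<forall>vs. length vs = k \<longrightarrow>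
     (\<forall>i<k. linear (\<lambda>v. \<xi> (vs[i := v]))) \<and>
     (\<forall>i<k. \<forall>j<k. i \<noteq> j \<longrightarrow> vs ! i = vs ! j \<longrightarrow> \<xi> vs = 0))"

definition delete_nth :: "nat \<Rightarrow> 'v list \<Rightarrow> 'v list" where
  "delete_nth i vs = take i vs @ drop (Suc i) vs"

definition flat :: "'v::real_inner \<Rightarrow> 'v \<Rightarrow> real" where
  "flat v = (\<lambda>w. v \<bullet> w)"

definition interior_mult :: "'v \<Rightarrow> 'v form \<Rightarrow> 'v form" where
  "interior_mult v \<xi> = (\<lambda>vs. \<xi> (v # vs))"

text \<open>Wedge product of a covector with a form, normalised such that the wedge of covectors
  \<open>\<alpha>\<^sub>1, \<dots>, \<alpha>\<^sub>k\<close> takes \<open>v\<^sub>1, \<dots>, v\<^sub>k\<close> to the determinant of \<open>(\<alpha>\<^sub>i v\<^sub>j)\<close>.\<close>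

definition covector_wedge :: "('v \<Rightarrow> real) \<Rightarrow> 'v form \<Rightarrow> 'v form" where
  "covector_wedge \<alpha> \<xi> = (\<lambda>vs. \<Sum>i<length vs. (-1) ^ i * \<alpha> (vs ! i) * \<xi> (delete_nth i vs))"

definition smooth_form_on :: "nat \<Rightarrow> 'v::euclidean_space set \<Rightarrow> ('v \<Rightarrow> 'v form) \<Rightarrow> bool" where
  "smooth_form_on k U \<omega> \<longleftrightarrow> (\<forall>p\<in>U. alternating_form k (\<omega> p)) \<and>
     (\<forall>vs. length vs = k \<longrightarrow> smooth_on (\<lambda>p. \<omega> p vs) U)"

text \<open>The vectors in the list are treated as constant vector fields, so no bracket terms occur.\<close>

definition exterior_derivative :: "('v::euclidean_space \<Rightarrow> 'v form) \<Rightarrow> 'v \<Rightarrow> 'v form" where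
  "exterior_derivative \<omega> p = (\<lambda>vs. \<Sum>i<length vs.
     (-1) ^ i * frechet_derivative (\<lambda>q. \<omega> q (delete_nth i vs)) (at p) (vs ! i))"

definition closed_form_on :: "nat \<Rightarrow> 'v::euclidean_space set \<Rightarrow> ('v \<Rightarrow> 'v form) \<Rightarrow> bool" where
  "closed_form_on k U \<omega> \<longleftrightarrow> smooth_form_on k U \<omega> \<and>
     (\<forall>p\<in>U. \<forall>vs. length vs = Suc k \<longrightarrow> exterior_derivative \<omega> p vs = 0)"

definition orthonormal_list :: "'v::real_inner list \<Rightarrow> bool" where
  "orthonormal_list es \<longleftrightarrow>
     (\<forall>i<length es. \<forall>j<length es. es ! i \<bullet> es ! j = (if i = j then 1 else 0))"

definition comass :: "nat \<Rightarrow> 'v::euclidean_space form \<Rightarrow> real" where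
  "comass k \<xi> = Sup {\<xi> es | es. length es = k \<and> orthonormal_list es}"

definition calibration :: "nat \<Rightarrow> 'v::euclidean_space set \<Rightarrow> ('v \<Rightarrow> 'v form) \<Rightarrow> bool" where
  "calibration k U \<omega> \<longleftrightarrow> closed_form_on k U \<omega> \<and> (\<forall>p\<in>U. comass k (\<omega> p) \<le> 1)"

section \<open>Geometry of the graph\<close>

text \<open>The coordinates of \<open>real ^ 'n\<close> are ordered by the linear order of \<open>'n\<close>; this fixes the
  standard orientation. \<open>idx\<close> numbers them from \<open>0\<close>.\<close>

definition idx :: "'n::{finite,linorder} \<Rightarrow> nat" where
  "idx i = card {j. j < i}"

text \<open>The same types as \<open>real ^ 'n\<close>, without its implicit sort constraint.\<close>

type_synonym 'n rvec = "(real, 'n) vec"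
type_synonym ('n, 'm) ambient = "'n rvec \<times> 'm rvec"

definition graph_map :: "('n rvec \<Rightarrow> 'm rvec) \<Rightarrow> 'n rvec \<Rightarrow> ('n::finite, 'm::finite) ambient"
  where "graph_map F x = (x, F x)"

text \<open>The point \<open>(x, F x)\<close> of the graph is represented by \<open>x\<close> throughout.\<close>

definition tangent_space ::
  "('n rvec \<Rightarrow> 'm rvec) \<Rightarrow> 'n rvec \<Rightarrow> ('n::finite, 'm::finite) ambient set" where
  "tangent_space F x = range (frechet_derivative (graph_map F) (at x))"

text \<open>Positivity of the determinant says that the projection to \<open>'n rvec\<close> preserves orientation.\<close>

definition oriented_onb ::
  "('n rvec \<Rightarrow> 'm rvec) \<Rightarrow> 'n rvec \<Rightarrow>
    ('n::{finite,linorder}, 'm::finite) ambient list \<Rightarrow> bool" where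
  "oriented_onb F x es \<longleftrightarrow> length es = CARD('n) \<and> orthonormal_list es \<and>
     span (set es) = tangent_space F x \<and> 0 < det (\<chi> i j. fst (es ! idx j) $ i)"

text \<open>Everything below is independent of the choice of this basis.\<close>

definition tangent_onb ::
  "('n rvec \<Rightarrow> 'm rvec) \<Rightarrow> 'n rvec \<Rightarrow> ('n::{finite,linorder}, 'm::finite) ambient list"
  where "tangent_onb F x = (SOME es. oriented_onb F x es)"

text \<open>The wedge of the covectors dual to an oriented orthonormal basis of the tangent space:
  the Riemannian volume form, extended by \<open>0\<close> on normal vectors.\<close>

definition graph_vol ::
  "('n rvec \<Rightarrow> 'm rvec) \<Rightarrow> 'n rvec \<Rightarrow> ('n::{finite,linorder}, 'm::finite) ambient form"
  where "graph_vol F x =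
     (\<lambda>vs. det (\<chi> (i::'n) (j::'n). (tangent_onb F x ! idx i) \<bullet> (vs ! idx j)))"

definition normal_part :: "'v::euclidean_space set \<Rightarrow> 'v \<Rightarrow> 'v" where
  "normal_part T v = (THE w. w \<in> orthogonal_comp T \<and> v - w \<in> T)"

text \<open>Second fundamental form of an immersion \<open>X\<close>, pulled back to the parameter domain.\<close>

definition second_fundamental_form ::
  "('a::euclidean_space \<Rightarrow> 'v::euclidean_space) \<Rightarrow> 'a \<Rightarrow> 'a \<Rightarrow> 'a \<Rightarrow> 'v" where
  "second_fundamental_form X x u v =
     normal_part (range (frechet_derivative X (at x)))
       (frechet_derivative (\<lambda>y. frechet_derivative X (at y) v) (at x) u)"

text \<open>Trace over an orthonormal basis of the tangent space; the tangent vector \<open>e\<close> is the image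
  of \<open>fst e\<close> under the derivative of \<open>graph_map F\<close>.\<close>

definition mean_curvature ::
  "('n rvec \<Rightarrow> 'm rvec) \<Rightarrow> 'n rvec \<Rightarrow> ('n::{finite,linorder}, 'm::finite) ambient" where
  "mean_curvature F x =
     (\<Sum>e\<leftarrow>tangent_onb F x. second_fundamental_form (graph_map F) x (fst e) (fst e))"

definition minimal_graph :: "'n rvec set \<Rightarrow> ('n::{finite,linorder} rvec \<Rightarrow> 'm::finite rvec) \<Rightarrow> bool"
  where "minimal_graph \<Omega> F \<longleftrightarrow> (\<forall>x\<in>\<Omega>. mean_curvature F x = 0)"

definition calibrates_graph ::
  "(('n::{finite,linorder}, 'm::finite) ambient \<Rightarrow> ('n, 'm) ambient form) \<Rightarrow>
    'n rvec set \<Rightarrow> ('n rvec \<Rightarrow> 'm rvec) \<Rightarrow> bool" where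
  "calibrates_graph \<omega> \<Omega> F \<longleftrightarrow> (\<forall>x\<in>\<Omega>. \<forall>vs. length vs = CARD('n) \<and> set vs \<subseteq> tangent_space F x \<longrightarrow>
     \<omega> (graph_map F x) vs = graph_vol F x vs)"

section \<open>The form \<open>\<Theta>(F)\<close>\<close>

definition G_op :: "('a::euclidean_space \<Rightarrow> 'b::euclidean_space) \<Rightarrow> 'a \<Rightarrow> 'a" where
  "G_op D v = v + adjoint D (D v)"

definition H_op :: "('a::euclidean_space \<Rightarrow> 'b::euclidean_space) \<Rightarrow> 'b \<Rightarrow> 'b" where
  "H_op D w = w + D (adjoint D w)"

definition inv_sqrt :: "('a::euclidean_space \<Rightarrow> 'a) \<Rightarrow> 'a \<Rightarrow> 'a" where
  "inv_sqrt A = inv (op_sqrt A)"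

definition L_tan :: "('a::euclidean_space \<Rightarrow> 'b::euclidean_space) \<Rightarrow> 'a \<Rightarrow> 'a \<times> 'b" where
  "L_tan D v = (inv_sqrt (G_op D) v, D (inv_sqrt (G_op D) v))"

definition L_nor :: "('a::euclidean_space \<Rightarrow> 'b::euclidean_space) \<Rightarrow> 'b \<Rightarrow> 'a \<times> 'b" where
  "L_nor D w = (- adjoint D (inv_sqrt (H_op D) w), inv_sqrt (H_op D) w)"

text \<open>Only meaningful on the tangent space, which is the range of \<open>L_tan D\<close>.\<close>

definition J_op :: "('a::euclidean_space \<Rightarrow> 'b::euclidean_space) \<Rightarrow> 'a \<times> 'b \<Rightarrow> 'a \<times> 'b" where
  "J_op D = L_nor D \<circ> D \<circ> inv (L_tan D)"

definition Psi ::
  "('n rvec \<Rightarrow> 'm rvec) \<Rightarrow> 'n rvec \<Rightarrow>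
    ('n::{finite,linorder}, 'm::finite) ambient form \<Rightarrow> ('n, 'm) ambient form" where
  "Psi F x \<xi> = (\<lambda>vs. \<Sum>e\<leftarrow>tangent_onb F x.
     covector_wedge (flat (J_op (frechet_derivative F (at x)) e)) (interior_mult e \<xi>) vs)"

definition Psi_pow ::
  "nat \<Rightarrow> ('n rvec \<Rightarrow> 'm rvec) \<Rightarrow>
    ('n::{finite,linorder}, 'm::finite) ambient \<Rightarrow> ('n, 'm) ambient form" where
  "Psi_pow l F p = (Psi F (fst p) ^^ l) (graph_vol F (fst p))"

text \<open>On lists of length \<open>CARD('n)\<close> all terms with \<open>l > CARD('n)\<close> vanish.\<close>

definition Theta ::
  "('n rvec \<Rightarrow> 'm rvec) \<Rightarrow>
    ('n::{finite,linorder}, 'm::finite) ambient \<Rightarrow> ('n, 'm) ambient form" where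
  "Theta F p = (\<lambda>vs. Psi_pow 0 F p vs -
     (\<Sum>\<^sub>\<infinity>l\<in>{1..}. (-1) ^ l * ((real l - 1) / fact l) * Psi_pow l F p vs))"

end

(* Psi is a derivation of the exterior algebra whose underlying endomorphism squares to zero, so
   t |-> exp(t Psi) vol is the determinant polynomial det (e_i . v_j + t J e_i . v_j), and Theta(F)
   is its value plus its derivative at t = -1.  There e_i - J e_i = (G x_i, 0), and Theta(F) becomes
   the Poincare-Cartan form  h dx^1 ... dx^n + sum_k dx^1 ... (pi_k . dy at slot k) ... dx^n  of the
   area integrand, with coefficients depending on x only.  Hence it is closed iff pi is divergence
   free, which is the minimal surface system.

   The comass bound says that the area integrand at any P dominates its first order Taylor
   polynomial at D = dF.  Diagonalising I + D^T D and I + P^T P simultaneously, by a basis z_j with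
   |z_j|^2 + |D z_j|^2 = 1, and estimating <D z_j, P z_j> by Cauchy-Schwarz reduces it to
     (1 - sum a_j^2 + sum a_j b_j)^2 <= prod (1 - a_j^2 + b_j^2)   if   sum a_j^2 <= 1,
   and sum a_j^2 = sum lambda_j^2 / (1 + lambda_j^2) <= 1 follows from the singular value bound. *)

theory Submission
  imports Defs
begin

text \<open>The singular value hypothesis controls the sum of |D z_j|^2 in a frame of singular
  vectors of \<open>D\<close>, but the comass estimate needs it in the frame that diagonalises a
  competitor \<open>P\<close>. For the matrix Z with columns z_j, Z Z^T is the inverse of the graph
  metric, so the sum is n minus the trace of that inverse in every adapted frame. The product
  inequality is not inductive as it stands, because its left side is no longer shaped like a factor.
  Under the constraint on the a_j, two factors dominate one factor of the same shape; the square is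
  extracted only when a single factor is left. Planes that are not graphs enter as limits: the value
  of the form and the Gram determinant are polynomial in the spanning vectors, and a singular
  horizontal part X is perturbed to X + t. The divergence of pi splits into the area density W times
  g^{kl} d_k d_l F, and the d_j F with coefficients d_k (W g^{kj}). The former is zero because it is
  a vertical vector that minimality forces to be tangent, the latter because the coordinate
  functions of a minimal graph are harmonic.\<close>

section \<open>Self-adjoint operators\<close>

text \<open>The first-order condition at a maximum: for small \<open>t\<close> of the sign of
  \<open>b\<close> the linear term would beat the quadratic one. It stands in for differentiating a
  Rayleigh quotient.\<close>

lemma zero_if_linear_le_quadratic:
  fixes b e :: real
  assumes "\<And>t. 2 * t * b \<le> t\<^sup>2 * e"
  shows "b = 0"
proof (rule ccontr)
  assume "b \<noteq> 0"
  define s where "s = 1 / (\<bar>e\<bar> + 1)"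
  have s: "s > 0" "s * e < 2"
    by (auto simp: s_def divide_simps)
  have "2 * (s * b) * b \<le> (s * b)\<^sup>2 * e" by (rule assms)
  hence "(s * b\<^sup>2) * 2 \<le> (s * b\<^sup>2) * (s * e)" by (simp add: power2_eq_square algebra_simps)
  moreover have "s * b\<^sup>2 > 0" using s \<open>b \<noteq> 0\<close> by simp
  ultimately have "2 \<le> s * e" by (simp add: mult_le_cancel_left_pos)
  thus False using s by simp
qed

text \<open>A maximiser \<open>v\<close> of \<open>A v \<bullet> v\<close> on the unit sphere of
  \<open>S\<close> is an eigenvector. The residual \<open>w = A v - c v\<close> lies in
  \<open>S\<close> and is orthogonal to \<open>v\<close>, so moving \<open>v\<close> towards
  \<open>w\<close> is an admissible variation, and stationarity gives
  \<open>A v \<bullet> w = 0\<close>, which is |w|^2 = 0.\<close>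

lemma selfadjoint_eigenvector:
  fixes A :: "'a::euclidean_space \<Rightarrow> 'a"
  assumes A: "linear A" and sa: "\<And>x y. A x \<bullet> y = x \<bullet> A y"
    and S: "subspace S" "S \<noteq> {0}" and inv: "\<And>x. x \<in> S \<Longrightarrow> A x \<in> S"
  shows "\<exists>v c. v \<in> S \<and> norm v = 1 \<and> A v = c *\<^sub>R v"
proof -
  let ?K = "S \<inter> sphere 0 1"
  obtain u where u: "u \<in> S" "u \<noteq> 0" using S subspace_0 by blast
  have "(1 / norm u) *\<^sub>R u \<in> ?K" using u S by (auto simp: subspace_scale)
  hence ne: "?K \<noteq> {}" by blast
  have "compact ?K" using S closed_subspace by (intro closed_Int_compact) auto
  moreover have "continuous_on ?K (\<lambda>v. A v \<bullet> v)"
    using A by (intro continuous_on_inner linear_continuous_on continuous_on_id)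
      (simp add: linear_conv_bounded_linear)
  ultimately obtain v where v: "v \<in> ?K" "\<And>w. w \<in> ?K \<Longrightarrow> A w \<bullet> w \<le> A v \<bullet> v"
    using continuous_attains_sup[of ?K "\<lambda>v. A v \<bullet> v"] ne by blast
  define c where "c = A v \<bullet> v"
  have vS: "v \<in> S" "v \<bullet> v = 1" using v(1) by (auto simp: norm_eq_1)
  have le: "A w \<bullet> w \<le> c * (w \<bullet> w)" if "w \<in> S" for w
  proof (cases "w = 0")
    case False
    have "(1 / norm w) *\<^sub>R w \<in> ?K" using that False S by (auto simp: subspace_scale)
    from v(2)[OF this] have "(A w \<bullet> w) / (norm w)\<^sup>2 \<le> c"
      by (simp add: c_def linear_scale[OF A] power2_eq_square)
    thus ?thesis using False by (simp add: divide_simps power2_norm_eq_inner)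
  qed (simp add: linear_0[OF A])
  define w where "w = A v - c *\<^sub>R v"
  have wS: "w \<in> S" unfolding w_def using S vS inv by (simp add: subspace_diff subspace_scale)
  have wv: "w \<bullet> v = 0" by (simp add: w_def inner_diff_left c_def vS)
  have "2 * t * (A v \<bullet> w) \<le> t\<^sup>2 * (c * (w \<bullet> w) - A w \<bullet> w)" for t
  proof -
    have "v + t *\<^sub>R w \<in> S" using S vS wS by (simp add: subspace_add subspace_scale)
    from le[OF this] have "A v \<bullet> v + t * (A w \<bullet> v) + t * (A v \<bullet> w + t * (A w \<bullet> w))
        \<le> c * (v \<bullet> v + t * (w \<bullet> v) + t * (v \<bullet> w + t * (w \<bullet> w)))"
      by (simp add: linear_add[OF A] linear_scale[OF A] inner_add_left inner_add_right)
    moreover have "A w \<bullet> v = A v \<bullet> w" using sa[of w v] by (metis inner_commute)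
    moreover have "v \<bullet> w = 0" using wv by (simp add: inner_commute)
    ultimately have "c + t * (A v \<bullet> w) + t * (A v \<bullet> w + t * (A w \<bullet> w)) \<le> c * (1 + t * (t * (w \<bullet> w)))"
      using wv vS(2) by (simp add: c_def)
    thus ?thesis by (simp add: power2_eq_square algebra_simps)
  qed
  hence "A v \<bullet> w = 0" by (rule zero_if_linear_le_quadratic)
  moreover have "A v = w + c *\<^sub>R v" by (simp add: w_def)
  ultimately have "w \<bullet> w = 0" using wv by (simp add: inner_add_left inner_commute[of v])
  hence "A v = c *\<^sub>R v" by (simp add: w_def)
  thus ?thesis using v(1) by auto
qed

text \<open>Stated for invariant subspaces so that induction on the dimension works: the orthogonal
  complement in \<open>S\<close> of one eigenvector is again invariant because \<open>A\<close> is
  self-adjoint.\<close>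

lemma selfadjoint_eigenbasis_subspace:
  fixes A :: "'a::euclidean_space \<Rightarrow> 'a"
  assumes A: "linear A" and sa: "\<And>x y. A x \<bullet> y = x \<bullet> A y"
  shows "subspace S \<Longrightarrow> (\<And>x. x \<in> S \<Longrightarrow> A x \<in> S) \<Longrightarrow>
    \<exists>B. pairwise orthogonal B \<and> (\<forall>b\<in>B. norm b = 1) \<and> span B = S \<and> (\<forall>b\<in>B. \<exists>c. A b = c *\<^sub>R b)"
proof (induction "dim S" arbitrary: S rule: less_induct)
  case less
  show ?case
  proof (cases "S = {0}")
    case True
    thus ?thesis by (intro exI[of _ "{}"]) auto
  next
    case False
    from selfadjoint_eigenvector[OF A sa less(2) False less(3)]
    obtain v c where v: "v \<in> S" "norm v = 1" "A v = c *\<^sub>R v" by blast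
    have vv: "v \<bullet> v = 1" using v by (simp add: norm_eq_1)
    define T where "T = {w \<in> S. w \<bullet> v = 0}"
    have T: "subspace T" using less(2)
      by (auto simp: subspace_def T_def inner_add_left)
    have "v \<notin> T" using vv by (simp add: T_def)
    hence "T \<subset> S" using v unfolding T_def by blast
    hence "dim T < dim S" using T less(2) by (metis dim_psubset span_eq_iff)
    moreover have "A x \<in> T" if "x \<in> T" for x
      using that less(3) sa[of x v] v by (auto simp: T_def)
    ultimately obtain B where B: "pairwise orthogonal B" "\<forall>b\<in>B. norm b = 1" "span B = T"
        "\<forall>b\<in>B. \<exists>c. A b = c *\<^sub>R b"
      using less(1)[of T] T by blast
    have BT: "b \<in> T" if "b \<in> B" for b using that B(3) span_base by blast
    have 1: "pairwise orthogonal (insert v B)"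
      using B(1) BT by (auto simp: pairwise_insert orthogonal_def T_def inner_commute)
    have "insert v B \<subseteq> S" using BT v by (auto simp: T_def)
    hence "span (insert v B) \<subseteq> S" using less(2) by (simp add: span_minimal)
    moreover have "x \<in> span (insert v B)" if "x \<in> S" for x
    proof -
      have "x - (x \<bullet> v) *\<^sub>R v \<in> T"
        using that v vv less(2) by (simp add: T_def inner_diff_left subspace_diff subspace_scale)
      thus ?thesis using B(3) by (auto simp: span_breakdown_eq)
    qed
    ultimately have "span (insert v B) = S" by blast
    thus ?thesis using 1 B v by (intro exI[of _ "insert v B"]) auto
  qed
qed

lemma selfadjoint_eigenbasis:
  fixes A :: "'a::euclidean_space \<Rightarrow> 'a"
  assumes A: "linear A" and sa: "\<And>x y. A x \<bullet> y = x \<bullet> A y"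
  obtains B \<kappa> where "finite B" "card B = DIM('a)" "span B = UNIV"
    "\<And>b b'. b \<in> B \<Longrightarrow> b' \<in> B \<Longrightarrow> b \<bullet> b' = (if b = b' then 1 else 0)"
    "\<And>b. b \<in> B \<Longrightarrow> A b = \<kappa> b *\<^sub>R b"
proof -
  obtain B where B: "pairwise orthogonal B" "\<forall>b\<in>B. norm b = 1" "span B = UNIV"
      "\<forall>b\<in>B. \<exists>c. A b = c *\<^sub>R b"
    using selfadjoint_eigenbasis_subspace[OF A sa, of UNIV] by auto
  have "0 \<notin> B" using B(2) by auto
  hence ind: "independent B" using B(1) pairwise_orthogonal_independent by blast
  obtain \<kappa> where "\<And>b. b \<in> B \<Longrightarrow> A b = \<kappa> b *\<^sub>R b" using B(4) by metis
  moreover have "card B = DIM('a)" using ind B(3) by (metis dim_UNIV dim_eq_card_independent dim_span)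
  moreover have "b \<bullet> b' = (if b = b' then 1 else 0)" if "b \<in> B" "b' \<in> B" for b b'
    using that B(1,2) by (auto simp: pairwise_def orthogonal_def norm_eq_1)
  ultimately show thesis using that ind independent_imp_finite B(3) by blast
qed

text \<open>The eigenvectors are indexed by the coordinate type itself, so that a frame can be read
  as a square matrix and its determinant taken.\<close>

lemma selfadjoint_eigenframe:
  fixes A :: "real ^ 'n \<Rightarrow> real ^ 'n"
  assumes A: "linear A" and sa: "\<And>x y. A x \<bullet> y = x \<bullet> A y"
  obtains f :: "'n \<Rightarrow> real ^ 'n" and \<kappa> :: "'n \<Rightarrow> real" where "\<And>i j. f i \<bullet> f j = (if i = j then 1 else 0)"
    "\<And>i. A (f i) = \<kappa> i *\<^sub>R f i" "span (range f) = UNIV"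
proof -
  obtain B \<kappa> where B: "finite B" "card B = DIM(real ^ 'n)" "span B = UNIV"
    "\<And>b b'. b \<in> B \<Longrightarrow> b' \<in> B \<Longrightarrow> b \<bullet> b' = (if b = b' then 1 else 0)"
    "\<And>b. b \<in> B \<Longrightarrow> A b = \<kappa> b *\<^sub>R b"
    using selfadjoint_eigenbasis[OF A sa] by metis
  have "card B = card (UNIV :: 'n set)" using B by simp
  then obtain f where f: "bij_betw f (UNIV :: 'n set) B"
    using B(1) finite_same_card_bij[of "UNIV :: 'n set" B] by auto
  have fB: "f i \<in> B" for i using f by (auto simp: bij_betw_def)
  have inj: "f i = f j \<longleftrightarrow> i = j" for i j using f by (auto simp: bij_betw_def inj_def)
  show thesis
    using that[of f "\<kappa> \<circ> f"] B fB inj f by (simp add: bij_betw_def)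
qed

section \<open>Square roots of operators\<close>

lemma selfadjoint_iff_adjoint:
  fixes A :: "'a::euclidean_space \<Rightarrow> 'a"
  assumes "linear A"
  shows "adjoint A = A \<longleftrightarrow> (\<forall>x y. A x \<bullet> y = x \<bullet> A y)"
  using assms adjoint_unique adjoint_works by metis

text \<open>The vector \<open>w = B b - sqrt \<kappa> b\<close> satisfies
  \<open>B w = - sqrt \<kappa> w\<close>, which positivity allows only for \<open>w = 0\<close>. For
  \<open>\<kappa> = 0\<close> the sign says nothing, and |w|^2 is computed directly. This pins down
  every root on the eigenvectors of the operator, hence the root itself.\<close>

lemma pos_semidef_root_eigen:
  assumes B: "pos_semidef B" and eig: "B (B b) = \<kappa> *\<^sub>R b" and "0 \<le> \<kappa>"
  shows "B b = sqrt \<kappa> *\<^sub>R b"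
proof -
  have lin: "linear B" and sa: "B x \<bullet> y = x \<bullet> B y" for x y
    using B selfadjoint_iff_adjoint by (auto simp: pos_semidef_def)
  define w where "w = B b - sqrt \<kappa> *\<^sub>R b"
  have "w = 0"
  proof (cases "\<kappa> = 0")
    case True
    have "w \<bullet> w = B (B b) \<bullet> b" using True by (simp add: w_def sa)
    thus ?thesis using eig True by simp
  next
    case False
    have "B w = - sqrt \<kappa> *\<^sub>R w"
      using \<open>0 \<le> \<kappa>\<close> by (simp add: w_def linear_diff[OF lin] linear_scale[OF lin] eig scaleR_diff_right)
    moreover have "0 \<le> B w \<bullet> w" using B by (simp add: pos_semidef_def)
    ultimately have "sqrt \<kappa> * (w \<bullet> w) \<le> 0" by simp
    moreover have "sqrt \<kappa> > 0" using False \<open>0 \<le> \<kappa>\<close> by simp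
    ultimately have "w \<bullet> w \<le> 0" by (simp add: mult_le_0_iff)
    thus ?thesis by (metis inner_eq_zero_iff inner_ge_zero order_antisym)
  qed
  thus ?thesis by (simp add: w_def)
qed

lemma pos_semidef_root_unique:
  assumes "pos_semidef A" "pos_semidef B" "B \<circ> B = A" "pos_semidef C" "C \<circ> C = A"
  shows "B = C"
proof -
  have lin: "linear A" and sa: "A x \<bullet> y = x \<bullet> A y" and pos: "0 \<le> A v \<bullet> v" for x y v
    using assms(1) selfadjoint_iff_adjoint by (auto simp: pos_semidef_def)
  obtain S \<kappa> where S: "span S = UNIV" "\<And>b b'. b \<in> S \<Longrightarrow> b' \<in> S \<Longrightarrow> b \<bullet> b' = (if b = b' then 1 else 0)"
    "\<And>b. b \<in> S \<Longrightarrow> A b = \<kappa> b *\<^sub>R b"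
    using selfadjoint_eigenbasis[OF lin sa] by metis
  have "B b = C b" if "b \<in> S" for b
  proof -
    have "0 \<le> \<kappa> b" using pos[of b] S(2,3) that by simp
    thus ?thesis
      using pos_semidef_root_eigen[OF assms(2), of b "\<kappa> b"] pos_semidef_root_eigen[OF assms(4), of b "\<kappa> b"]
        assms(3,5) S(3)[OF that] by (metis comp_apply)
  qed
  thus ?thesis using linear_eq_on_span[of B C S] assms(2,4) S(1) by (auto simp: pos_semidef_def)
qed

text \<open>Existence comes from taking roots of the eigenvalues in an eigenbasis; together with
  uniqueness it makes the description by \<open>THE\<close> in \<open>op_sqrt\<close>
  denote.\<close>

lemma op_sqrt:
  assumes "pos_semidef A"
  shows "pos_semidef (op_sqrt A)" "op_sqrt A (op_sqrt A v) = A v"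
proof -
  have lin: "linear A" and sa: "A x \<bullet> y = x \<bullet> A y" and pos: "0 \<le> A v \<bullet> v" for x y v
    using assms(1) selfadjoint_iff_adjoint by (auto simp: pos_semidef_def)
  obtain S \<kappa> where S: "finite S" "span S = UNIV"
    "\<And>b b'. b \<in> S \<Longrightarrow> b' \<in> S \<Longrightarrow> b \<bullet> b' = (if b = b' then 1 else 0)"
    "\<And>b. b \<in> S \<Longrightarrow> A b = \<kappa> b *\<^sub>R b"
    using selfadjoint_eigenbasis[OF lin sa] by metis
  have k: "0 \<le> \<kappa> b" if "b \<in> S" for b using pos[of b] S(3,4) that by simp
  define R where "R v = (\<Sum>b\<in>S. (sqrt (\<kappa> b) * (b \<bullet> v)) *\<^sub>R b)" for v
  have linR: "linear R" unfolding R_def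
    by (intro linearI) (simp_all add: inner_add_right algebra_simps sum.distrib scaleR_sum_right)
  have Rb: "R b = sqrt (\<kappa> b) *\<^sub>R b" if "b \<in> S" for b
  proof -
    have "R b = (\<Sum>b'\<in>S. if b' = b then sqrt (\<kappa> b) *\<^sub>R b else 0)"
      unfolding R_def using that S(3) by (intro sum.cong) auto
    thus ?thesis using that S(1) by simp
  qed
  have "R \<circ> R = A"
  proof (rule ext)
    fix x
    have "(R \<circ> R) x = A x"
      by (rule linear_eq_on_span[OF linear_compose[OF linR linR] lin, of S])
        (use S k Rb in \<open>auto simp: linear_scale[OF linR] power2_eq_square[symmetric]\<close>)
    thus "(R \<circ> R) x = A x" .
  qed
  moreover have "pos_semidef R" unfolding pos_semidef_def
  proof (intro conjI allI)
    have "R x \<bullet> y = x \<bullet> R y" for x y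
      by (simp add: R_def inner_sum_left inner_sum_right inner_commute[of x] mult_ac)
    thus "adjoint R = R" unfolding selfadjoint_iff_adjoint[OF linR] by blast
    show "0 \<le> R v \<bullet> v" for v
      unfolding R_def inner_sum_left using k by (intro sum_nonneg) (simp add: mult.assoc)
  qed (rule linR)
  ultimately have "\<exists>!B. pos_semidef B \<and> B \<circ> B = A"
    using pos_semidef_root_unique[OF assms] by blast
  from theI'[OF this, folded op_sqrt_def]
  show "pos_semidef (op_sqrt A)" "op_sqrt A (op_sqrt A v) = A v"
    by (auto simp: fun_eq_iff)
qed

lemma op_sqrt_eigen:
  assumes "pos_semidef A" "A b = \<kappa> *\<^sub>R b" "0 \<le> \<kappa>"
  shows "op_sqrt A b = sqrt \<kappa> *\<^sub>R b"
  using op_sqrt[OF assms(1)] assms(2,3) by (intro pos_semidef_root_eigen) auto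

lemma linear_op_sqrt: "pos_semidef A \<Longrightarrow> linear (op_sqrt A)"
  using op_sqrt(1) pos_semidef_def by blast

lemma pos_semidef_adjoint_comp:
  fixes D :: "'a::euclidean_space \<Rightarrow> 'b::euclidean_space"
  assumes "linear D"
  shows "pos_semidef (adjoint D \<circ> D)"
proof -
  have l: "linear (adjoint D \<circ> D)" using assms adjoint_linear linear_compose by blast
  show ?thesis unfolding pos_semidef_def selfadjoint_iff_adjoint[OF l] using l assms
    by (auto simp: adjoint_clauses)
qed

lemma linear_G_op: "linear D \<Longrightarrow> linear (G_op D)"
  using linear_compose_add[OF linear_ident linear_compose[of D "adjoint D"]] adjoint_linear[of D]
  by (simp add: G_op_def[abs_def] o_def)

lemma linear_H_op: "linear D \<Longrightarrow> linear (H_op D)"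
  using linear_compose_add[OF linear_ident linear_compose[of "adjoint D" D]] adjoint_linear[of D]
  by (simp add: H_op_def[abs_def] o_def)

lemma inner_G_op: "linear D \<Longrightarrow> G_op D x \<bullet> y = x \<bullet> y + D x \<bullet> D y"
  by (simp add: G_op_def inner_add_left adjoint_clauses)

lemma inner_H_op: "linear D \<Longrightarrow> H_op D x \<bullet> y = x \<bullet> y + adjoint D x \<bullet> adjoint D y"
  by (simp add: H_op_def inner_add_left adjoint_clauses)

lemma pos_semidef_G_op: "linear D \<Longrightarrow> pos_semidef (G_op D)"
  by (simp add: pos_semidef_def selfadjoint_iff_adjoint linear_G_op inner_G_op inner_commute[of _ "G_op D _"])
    (simp add: inner_commute)

lemma pos_semidef_H_op: "linear D \<Longrightarrow> pos_semidef (H_op D)"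
  by (simp add: pos_semidef_def selfadjoint_iff_adjoint linear_H_op inner_H_op inner_commute[of _ "H_op D _"])
    (simp add: inner_commute)

lemma bij_op_sqrt:
  assumes A: "pos_semidef A" and pos: "\<And>v. v \<noteq> 0 \<Longrightarrow> 0 < A v \<bullet> v"
  shows "bij (op_sqrt A)"
proof -
  have lin: "linear (op_sqrt A)" using A by (rule linear_op_sqrt)
  have "v = 0" if "op_sqrt A v = 0" for v
    using op_sqrt(2)[OF A, of v] that pos[of v] linear_0[OF lin] by auto
  hence "inj (op_sqrt A)" using linear_injective_0[OF lin] by blast
  thus ?thesis using lin linear_injective_imp_surjective by (auto simp: bij_def)
qed

text \<open>\<open>D\<close> carries an eigenvector of \<open>adjoint D \<circ> D\<close> to a
  vector on which \<open>D \<circ> adjoint D\<close> acts by the same eigenvalue, so both roots act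
  by \<open>sqrt (1 + \<kappa>)\<close> on corresponding vectors of an eigenbasis.\<close>

lemma op_sqrt_intertwine:
  fixes D :: "'a::euclidean_space \<Rightarrow> 'b::euclidean_space"
  assumes D: "linear D"
  shows "op_sqrt (H_op D) (D x) = D (op_sqrt (G_op D) x)"
proof -
  let ?A = "adjoint D \<circ> D"
  have A: "pos_semidef ?A" using D by (rule pos_semidef_adjoint_comp)
  have lin: "linear ?A" and pos: "0 \<le> ?A v \<bullet> v" for v
    using A by (auto simp: pos_semidef_def)
  have sa: "?A x \<bullet> y = x \<bullet> ?A y" for x y
    using A selfadjoint_iff_adjoint[OF lin] unfolding pos_semidef_def by blast
  obtain S \<kappa> where S: "finite S" "span S = UNIV"
    "\<And>b b'. b \<in> S \<Longrightarrow> b' \<in> S \<Longrightarrow> b \<bullet> b' = (if b = b' then 1 else 0)"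
    "\<And>b. b \<in> S \<Longrightarrow> ?A b = \<kappa> b *\<^sub>R b"
    using selfadjoint_eigenbasis[OF lin sa] by metis
  have l1: "linear (\<lambda>x. op_sqrt (H_op D) (D x))"
    using linear_compose[OF D linear_op_sqrt[OF pos_semidef_H_op[OF D]]] by (simp add: o_def)
  have l2: "linear (\<lambda>x. D (op_sqrt (G_op D) x))"
    using linear_compose[OF linear_op_sqrt[OF pos_semidef_G_op[OF D]] D] by (simp add: o_def)
  show ?thesis
  proof (rule linear_eq_on_span[OF l1 l2, of S])
    fix b assume b: "b \<in> S"
    have k: "0 \<le> \<kappa> b" using pos[of b] S(3,4) b by simp
    have "G_op D b = (1 + \<kappa> b) *\<^sub>R b" "H_op D (D b) = (1 + \<kappa> b) *\<^sub>R D b"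
      using S(4)[OF b] by (simp_all add: G_op_def H_op_def linear_scale[OF D] scaleR_add_left)
    hence "op_sqrt (G_op D) b = sqrt (1 + \<kappa> b) *\<^sub>R b" "op_sqrt (H_op D) (D b) = sqrt (1 + \<kappa> b) *\<^sub>R D b"
      using k by (auto intro!: op_sqrt_eigen pos_semidef_G_op pos_semidef_H_op D)
    thus "op_sqrt (H_op D) (D b) = D (op_sqrt (G_op D) b)" by (simp add: linear_scale[OF D])
  qed (use S in auto)
qed

text \<open>All square roots cancel. \<open>L_tan D\<close> maps \<open>op_sqrt (G_op D) x\<close>
  to \<open>(x, D x)\<close>, and the intertwining relation moves this root past \<open>D\<close>,
  where it meets its inverse in \<open>L_nor D\<close>. Along the graph, \<open>J\<close> is thus
  polynomial in \<open>D\<close> and its adjoint.\<close>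

lemma J_op_tangent:
  fixes D :: "'a::euclidean_space \<Rightarrow> 'b::euclidean_space"
  assumes D: "linear D"
  shows "J_op D (x, D x) = (- adjoint D (D x), D x)"
proof -
  let ?G = "op_sqrt (G_op D)" and ?H = "op_sqrt (H_op D)"
  have "0 < G_op D v \<bullet> v" if "v \<noteq> 0" for v
    using that by (simp add: inner_G_op[OF D] add_pos_nonneg)
  hence bG: "bij ?G" using bij_op_sqrt pos_semidef_G_op[OF D] by blast
  have "0 < H_op D v \<bullet> v" if "v \<noteq> 0" for v
    using that by (simp add: inner_H_op[OF D] add_pos_nonneg)
  hence bH: "bij ?H" using bij_op_sqrt pos_semidef_H_op[OF D] by blast
  have "inj (L_tan D)"
    using bij_imp_bij_inv[OF bG] by (auto simp: L_tan_def inj_def inv_sqrt_def bij_def)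
  moreover have "L_tan D (?G x) = (x, D x)"
    using bG by (simp add: L_tan_def inv_sqrt_def bij_def)
  ultimately have 1: "inv (L_tan D) (x, D x) = ?G x" by (metis inv_f_f)
  have "inv_sqrt (H_op D) (D (?G x)) = D x"
    unfolding inv_sqrt_def op_sqrt_intertwine[OF D, symmetric] using bH by (simp add: bij_def)
  thus ?thesis by (simp add: J_op_def 1 L_nor_def)
qed

section \<open>Frames adapted to the graph metric\<close>

text \<open>The first fundamental form of the graph of \<open>D\<close>, in the coordinates of the
  base.\<close>

definition gmat :: "(real ^ 'n \<Rightarrow> real ^ 'm) \<Rightarrow> real ^ 'n ^ 'n" where
  "gmat D = matrix (G_op D)"

text \<open>The lifts \<open>(z i, D (z i))\<close> are an orthonormal basis of the tangent space of
  the graph; a frame records the horizontal parts, which determine them.\<close>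

definition adapted_frame :: "(real ^ 'n \<Rightarrow> real ^ 'm) \<Rightarrow> ('n \<Rightarrow> real ^ 'n) \<Rightarrow> bool" where
  "adapted_frame D z \<longleftrightarrow> (\<forall>i j. z i \<bullet> z j + D (z i) \<bullet> D (z j) = (if i = j then 1 else 0))"

lemma gmat_mult: "linear D \<Longrightarrow> gmat D *v x = G_op D x"
  unfolding gmat_def using linear_G_op[of D] by (metis matrix_vector_mul(2))

lemma transpose_frame_mult:
  "transpose (\<chi> k j. z j $ k) ** (A ** (\<chi> k j. (z :: 'n \<Rightarrow> real ^ 'n) j $ k)) = (\<chi> i j. z i \<bullet> (A *v z j))"
  by (simp add: vec_eq_iff matrix_matrix_mult_def transpose_def inner_vec_def matrix_vector_mult_def)

lemma adapted_frame_matrix: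
  assumes "linear D" "adapted_frame D z"
  shows "transpose (\<chi> k j. z j $ k) ** (gmat D ** (\<chi> k j. z j $ k)) = mat 1"
proof -
  have "z i \<bullet> G_op D (z j) = (if i = j then 1 else 0)" for i j
    using assms(2) inner_G_op[OF assms(1), of "z j" "z i"]
    by (auto simp: adapted_frame_def inner_commute)
  thus ?thesis using assms(1) by (simp add: transpose_frame_mult gmat_mult mat_def)
qed

lemma matrix_inv_unique:
  fixes A :: "real ^ 'n ^ 'n"
  assumes "A ** B = mat 1"
  shows "matrix_inv A = B"
proof -
  have BA: "B ** A = mat 1" using assms matrix_left_right_inverse by blast
  hence "A ** matrix_inv A = mat 1 \<and> matrix_inv A ** A = mat 1"
    unfolding matrix_inv_def using assms by (intro someI_ex[where P="\<lambda>A'. A ** A' = mat 1 \<and> A' ** A = mat 1"]) blast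
  thus ?thesis using BA by (metis matrix_mul_assoc matrix_mul_lid matrix_mul_rid)
qed

text \<open>With Z the matrix of columns \<open>z j\<close> and g the matrix \<open>gmat D\<close>,
  the frame condition reads Z^T g Z = 1. A left inverse is a right inverse, so g Z Z^T = 1, and Z
  Z^T is the same for all adapted frames.\<close>

lemma adapted_frame_inverse:
  fixes z :: "'n \<Rightarrow> real ^ 'n"
  assumes "linear D" "adapted_frame D z"
  shows "(\<Sum>j\<in>UNIV. z j $ k * z j $ l) = matrix_inv (gmat D) $ k $ l"
    and "gmat D ** matrix_inv (gmat D) = mat 1"
    and "(det (\<chi> k j. z j $ k))\<^sup>2 * det (gmat D) = 1"
proof -
  let ?Z = "(\<chi> k j. z j $ k) :: real ^ 'n ^ 'n"
  have 1: "transpose ?Z ** (gmat D ** ?Z) = mat 1" by (rule adapted_frame_matrix[OF assms])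
  hence "(gmat D ** ?Z) ** transpose ?Z = mat 1" using matrix_left_right_inverse by blast
  hence 2: "gmat D ** (?Z ** transpose ?Z) = mat 1" by (simp add: matrix_mul_assoc)
  hence 3: "matrix_inv (gmat D) = ?Z ** transpose ?Z" by (rule matrix_inv_unique)
  show "(\<Sum>j\<in>UNIV. z j $ k * z j $ l) = matrix_inv (gmat D) $ k $ l"
    unfolding 3 by (simp add: matrix_matrix_mult_def transpose_def)
  show "gmat D ** matrix_inv (gmat D) = mat 1" using 2 3 by simp
  show "(det ?Z)\<^sup>2 * det (gmat D) = 1"
    using arg_cong[OF 1, of det] by (simp add: det_mul power2_eq_square mult_ac)
qed

lemma orthonormal_frame_expansion:
  fixes f :: "'n \<Rightarrow> real ^ 'n"
  assumes "\<And>i j. f i \<bullet> f j = (if i = j then 1 else 0)" "span (range f) = UNIV"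
  shows "(\<Sum>i\<in>UNIV. (f i \<bullet> v) *\<^sub>R f i) = v"
proof -
  let ?w = "v - (\<Sum>i\<in>UNIV. (f i \<bullet> v) *\<^sub>R f i)"
  have "?w \<bullet> f j = 0" for j
    by (simp add: inner_diff_left inner_sum_left assms(1) inner_commute[of v] if_distrib cong: if_cong)
  hence "orthogonal ?w x" if "x \<in> range f" for x using that by (auto simp: orthogonal_def)
  moreover have "?w \<in> span (range f)" using assms(2) by simp
  ultimately have "orthogonal ?w ?w" by (rule orthogonal_to_span[rotated])
  thus ?thesis by (simp add: orthogonal_def)
qed

section \<open>Singular values\<close>

text \<open>An eigenvector has no component along frame vectors with another eigenvalue, so the
  frame vectors with eigenvalue \<open>c\<close> span its eigenspace. This links the dimensions in
  \<open>singular_values\<close> to a count over a frame.\<close>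

lemma eigenspace_dim:
  fixes f :: "'n \<Rightarrow> real ^ 'n"
  assumes f: "\<And>i j. f i \<bullet> f j = (if i = j then 1 else 0)" "span (range f) = UNIV"
    and A: "linear A" "\<And>x y. A x \<bullet> y = x \<bullet> A y" "\<And>i. A (f i) = \<mu> i *\<^sub>R f i"
  shows "dim {v. A v = c *\<^sub>R v} = card {i. \<mu> i = c}"
proof -
  let ?I = "{i. \<mu> i = c}"
  have inj: "inj f"
  proof (rule injI)
    fix i j assume "f i = f j"
    thus "i = j" using f(1)[of i j] f(1)[of j j] by (simp split: if_splits)
  qed
  have "0 \<notin> f ` ?I"
  proof
    assume "0 \<in> f ` ?I"
    then obtain i where "f i = 0" by force
    thus False using f(1)[of i i] by simp
  qed
  moreover have "pairwise orthogonal (f ` ?I)"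
    using f(1) by (auto simp: pairwise_def orthogonal_def)
  ultimately have ind: "independent (f ` ?I)" using pairwise_orthogonal_independent by blast
  have "{v. A v = c *\<^sub>R v} = span (f ` ?I)"
  proof (intro equalityI subsetI)
    fix v assume "v \<in> {v. A v = c *\<^sub>R v}"
    hence v: "A v = c *\<^sub>R v" by simp
    have z: "f i \<bullet> v = 0" if "\<mu> i \<noteq> c" for i
    proof -
      have "c * (f i \<bullet> v) = \<mu> i * (f i \<bullet> v)" using A(2)[of "f i" v] A(3)[of i] v by auto
      thus ?thesis using that by auto
    qed
    have "v = (\<Sum>i\<in>UNIV. (f i \<bullet> v) *\<^sub>R f i)" using orthonormal_frame_expansion[OF f] by simp
    also have "\<dots> = (\<Sum>i\<in>?I. (f i \<bullet> v) *\<^sub>R f i)"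
      using z by (intro sum.mono_neutral_right) auto
    also have "\<dots> \<in> span (f ` ?I)" by (intro span_sum span_scale span_base) auto
    finally show "v \<in> span (f ` ?I)" .
  next
    fix v assume "v \<in> span (f ` ?I)"
    moreover have "subspace {v. A v = c *\<^sub>R v}"
      using A(1) by (simp add: subspace_def linear_0 linear_add linear_scale scaleR_add_right mult.commute)
    moreover have "f ` ?I \<subseteq> {v. A v = c *\<^sub>R v}" using A(3) by auto
    ultimately show "v \<in> {v. A v = c *\<^sub>R v}" using span_minimal by blast
  qed
  hence "dim {v. A v = c *\<^sub>R v} = card (f ` ?I)" using ind by (simp add: dim_eq_card_independent)
  thus ?thesis using inj by (simp add: card_image inj_on_subset)
qed

lemma singular_values_unique:
  assumes "sorted_wrt (\<ge>) s"
    and "\<And>c. count_list s c = dim {v. op_sqrt (adjoint D \<circ> D) v = c *\<^sub>R v}"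
  shows "singular_values D = s"
  unfolding singular_values_def
proof (rule the_equality)
  fix t :: "real list"
  assume t: "sorted_wrt (\<ge>) t \<and> (\<forall>c. count_list t c = dim {v. op_sqrt (adjoint D \<circ> D) v = c *\<^sub>R v})"
  have "mset (rev t) = mset (rev s)" using t assms(2) by (auto intro!: multiset_eqI simp: count_mset)
  moreover have "sorted (rev t)" "sorted (rev s)" using t assms(1) by (simp_all add: sorted_wrt_rev)
  ultimately have "rev t = rev s" by (metis properties_for_sort sorted_sort_id)
  thus "t = s" by simp
qed (use assms in blast)

text \<open>Sortedness and the multiset of entries pin down the list without enumerating the frame
  in decreasing order.\<close>

lemma singular_values_eigenframe:
  fixes f :: "'n::finite \<Rightarrow> real ^ 'n" and D :: "real ^ 'n \<Rightarrow> real ^ 'm"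
  assumes D: "linear D"
    and f: "\<And>i j. f i \<bullet> f j = (if i = j then 1 else 0)" "span (range f) = UNIV"
    and eig: "\<And>i. adjoint D (D (f i)) = \<kappa> i *\<^sub>R f i" and pos: "\<And>i. 0 \<le> \<kappa> i"
  shows "sorted_wrt (\<ge>) (singular_values D)"
    and "mset (singular_values D) = image_mset (\<lambda>i. sqrt (\<kappa> i)) (mset_set UNIV)"
proof -
  let ?A = "adjoint D \<circ> D"
  have A: "pos_semidef ?A" using D by (rule pos_semidef_adjoint_comp)
  let ?m = "image_mset (\<lambda>i. sqrt (\<kappa> i)) (mset_set (UNIV :: 'n set))"
  define s where "s = rev (sorted_list_of_multiset ?m)"
  have ms: "mset s = ?m" by (simp add: s_def)
  have lS: "linear (op_sqrt ?A)" using A by (rule linear_op_sqrt)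
  have "op_sqrt ?A (f i) = sqrt (\<kappa> i) *\<^sub>R f i" for i
    using A eig pos by (intro op_sqrt_eigen) auto
  moreover have "op_sqrt ?A x \<bullet> y = x \<bullet> op_sqrt ?A y" for x y
    using op_sqrt(1)[OF A] selfadjoint_iff_adjoint[OF lS] unfolding pos_semidef_def by blast
  ultimately have "dim {v. op_sqrt ?A v = c *\<^sub>R v} = card {i. sqrt (\<kappa> i) = c}" for c
    using f by (intro eigenspace_dim[OF _ _ lS]) auto
  moreover have "count_list s c = card {i. sqrt (\<kappa> i) = c}" for c
  proof -
    have "count_list s c = count ?m c" by (simp add: ms[symmetric] count_mset)
    also have "\<dots> = card {i. sqrt (\<kappa> i) = c}"
      by (simp add: count_image_mset' sum.If_cases Collect_conj_eq[symmetric] eq_commute)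
    finally show ?thesis .
  qed
  ultimately have "singular_values D = s"
    by (intro singular_values_unique) (simp_all add: s_def sorted_wrt_rev)
  thus "sorted_wrt (\<ge>) (singular_values D)" "mset (singular_values D) = ?m"
    using ms by (simp_all add: s_def sorted_wrt_rev)
qed

text \<open>Here \<open>k\<close> stands for r - 1 and index 0 for the largest value; put t = (l
  0)^2. Since x / (1 + x) increases, for t <= 1/k each of the k + 1 terms is at most 1 / (k + 1).
  For t > 1/k the products bound the other squares by 1 / (k^4 t), and the first term t / (1 + t)
  leaves room 1 / (1 + t) for the remaining k terms.\<close>

lemma sum_le_one_if_products_small:
  fixes l :: "nat \<Rightarrow> real" and k :: nat
  assumes "1 \<le> k" and pos: "\<And>j. j \<le> k \<Longrightarrow> 0 \<le> l j" and mono: "\<And>j. j \<le> k \<Longrightarrow> l j \<le> l 0"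
    and prod: "\<And>j. 1 \<le> j \<Longrightarrow> j \<le> k \<Longrightarrow> l 0 * l j \<le> 1 / (real k)\<^sup>2"
  shows "(\<Sum>j\<le>k. (l j)\<^sup>2 / (1 + (l j)\<^sup>2)) \<le> 1"
proof -
  have frac: "a / (1 + a) \<le> b / (1 + b)" if "0 \<le> a" "a \<le> b" for a b :: real
    using that by (simp add: divide_simps) (simp add: algebra_simps)
  define t where "t = (l 0)\<^sup>2"
  have k: "real k \<ge> 1" using assms(1) by simp
  show ?thesis
  proof (cases "t \<le> 1 / real k")
    case True
    have "(l j)\<^sup>2 / (1 + (l j)\<^sup>2) \<le> 1 / (real k + 1)" if "j \<le> k" for j
    proof -
      have "(l j)\<^sup>2 \<le> t" unfolding t_def using pos[OF that] mono[OF that] by (rule power_mono[rotated])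
      hence "(l j)\<^sup>2 / (1 + (l j)\<^sup>2) \<le> (1 / real k) / (1 + 1 / real k)"
        using True by (intro frac) auto
      thus ?thesis using k by (simp add: field_simps)
    qed
    hence "(\<Sum>j\<le>k. (l j)\<^sup>2 / (1 + (l j)\<^sup>2)) \<le> (\<Sum>j\<le>k. 1 / (real k + 1))"
      by (intro sum_mono) auto
    thus ?thesis using k by (simp add: add.commute)
  next
    case False
    hence t: "t > 1 / real k" by simp
    hence t0: "t > 0" using k by (smt (verit) zero_less_divide_1_iff)
    have le: "(l j)\<^sup>2 / (1 + (l j)\<^sup>2) \<le> 1 / (real k ^ 4 * t + 1)" if "1 \<le> j" "j \<le> k" for j
    proof -
      have "(l 0 * l j)\<^sup>2 \<le> (1 / (real k)\<^sup>2)\<^sup>2"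
        using prod[OF that] pos that by (intro power_mono) auto
      hence "t * (l j)\<^sup>2 \<le> 1 / real k ^ 4" by (simp add: t_def power_mult_distrib power_divide)
      hence "(l j)\<^sup>2 \<le> 1 / (real k ^ 4 * t)" using t0 k by (simp add: field_simps)
      hence "(l j)\<^sup>2 / (1 + (l j)\<^sup>2) \<le> (1 / (real k ^ 4 * t)) / (1 + 1 / (real k ^ 4 * t))"
        by (intro frac) auto
      thus ?thesis using t0 k by (simp add: field_simps)
    qed
    have "(\<Sum>j\<le>k. (l j)\<^sup>2 / (1 + (l j)\<^sup>2)) = t / (1 + t) + (\<Sum>j<k. (l (Suc j))\<^sup>2 / (1 + (l (Suc j))\<^sup>2))"
      by (simp add: t_def sum.atMost_shift)
    also have "\<dots> \<le> t / (1 + t) + (\<Sum>j<k. 1 / (real k ^ 4 * t + 1))"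
      using le by (intro add_left_mono sum_mono) auto
    also have "\<dots> = t / (1 + t) + real k / (real k ^ 4 * t + 1)" by simp
    also have "\<dots> \<le> 1"
    proof -
      \<comment> \<open>Cleared of denominators, this says that k / (k^4 t + 1) is at most 1 / (1 +
        t). It rearranges to k - 1 <= (k^4 - k) t, and t > 1/k makes the right side at least k^3 -
        1.\<close>
      have "real k * (1 + t) \<le> real k ^ 4 * t + 1"
      proof -
        have "real k - 1 \<le> real k ^ 3 - 1" using k by (simp add: self_le_power)
        also have "\<dots> = (real k ^ 4 - real k) * (1 / real k)" using k by (simp add: field_simps power_numeral_reduce)
        also have "\<dots> \<le> (real k ^ 4 - real k) * t"
          using t k by (intro mult_left_mono) (simp_all add: self_le_power)
        finally show ?thesis by (simp add: algebra_simps)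
      qed
      moreover have "real k ^ 4 * t + 1 > 0" using t0 k by (simp add: add_pos_pos)
      ultimately show ?thesis using t0 by (simp add: divide_simps) (simp add: algebra_simps)
    qed
    finally show ?thesis .
  qed
qed

text \<open>By the frame condition |D z_j|^2 = 1 - |z_j|^2, and the |z_j|^2 add up to the trace of Z
  Z^T. The right side does not mention the frame, which lets a bound found in one frame be used in
  another.\<close>

lemma adapted_frame_energy:
  fixes D :: "real ^ 'n::finite \<Rightarrow> real ^ 'm"
  assumes D: "linear D" and z: "adapted_frame D z"
  shows "(\<Sum>j\<in>UNIV. D (z j) \<bullet> D (z j)) = real CARD('n) - (\<Sum>k\<in>UNIV. matrix_inv (gmat D) $ k $ k)"
proof -
  have "D (z j) \<bullet> D (z j) = 1 - (\<Sum>k\<in>UNIV. z j $ k * z j $ k)" for j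
    using z unfolding adapted_frame_def inner_vec_def[of "z _"] by (smt (verit, best) inner_real_def sum.cong)
  hence "(\<Sum>j\<in>UNIV. D (z j) \<bullet> D (z j)) = real CARD('n) - (\<Sum>j\<in>UNIV. \<Sum>k\<in>UNIV. z j $ k * z j $ k)"
    by (simp add: sum_subtractf)
  also have "(\<Sum>j\<in>UNIV. \<Sum>k\<in>UNIV. z j $ k * z j $ k) = (\<Sum>k\<in>UNIV. \<Sum>j\<in>UNIV. z j $ k * z j $ k)"
    by (rule sum.swap)
  finally show ?thesis using adapted_frame_inverse(1)[OF assms] by simp
qed

text \<open>The \<open>f i\<close> are right singular vectors of \<open>D\<close> with squared
  singular values \<open>\<kappa> i\<close>; division by \<open>sqrt (1 + \<kappa> i)\<close> makes
  their lifts to the graph orthonormal.\<close>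

lemma adapted_eigenframe:
  fixes D :: "real ^ 'n::finite \<Rightarrow> real ^ 'm"
  assumes D: "linear D"
  obtains f :: "'n \<Rightarrow> real ^ 'n" and \<kappa> where "\<And>i j. f i \<bullet> f j = (if i = j then 1 else 0)" "span (range f) = UNIV"
    "\<And>i. adjoint D (D (f i)) = \<kappa> i *\<^sub>R f i" "\<And>i. 0 \<le> \<kappa> i"
    "\<And>i j. D (f i) \<bullet> D (f j) = (if i = j then \<kappa> i else 0)"
    "adapted_frame D (\<lambda>i. (1 / sqrt (1 + \<kappa> i)) *\<^sub>R f i)"
proof -
  have A: "pos_semidef (adjoint D \<circ> D)" using D by (rule pos_semidef_adjoint_comp)
  hence lin: "linear (adjoint D \<circ> D)" by (auto simp: pos_semidef_def)
  have sa: "(adjoint D \<circ> D) x \<bullet> y = x \<bullet> (adjoint D \<circ> D) y" for x y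
    using A selfadjoint_iff_adjoint[OF lin] unfolding pos_semidef_def by blast
  obtain f :: "'n \<Rightarrow> real ^ 'n" and \<kappa> where f: "\<And>i j. f i \<bullet> f j = (if i = j then 1 else 0)"
    "\<And>i. (adjoint D \<circ> D) (f i) = \<kappa> i *\<^sub>R f i" "span (range f) = UNIV"
    using selfadjoint_eigenframe[OF lin sa] by blast
  have DD: "D (f i) \<bullet> D (f j) = (if i = j then \<kappa> i else 0)" for i j
    using f(2)[of i] f(1)[of i j] adjoint_clauses(2)[OF D, of "D (f i)" "f j"] by auto
  have k: "0 \<le> \<kappa> i" for i using DD[of i i] by (metis inner_ge_zero)
  have "adapted_frame D (\<lambda>i. (1 / sqrt (1 + \<kappa> i)) *\<^sub>R f i)"
    unfolding adapted_frame_def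
  proof (intro allI)
    fix i j
    have "1 / (1 + \<kappa> i) + \<kappa> i / (1 + \<kappa> i) = 1" using k[of i] by (simp add: field_simps)
    thus "(1 / sqrt (1 + \<kappa> i)) *\<^sub>R f i \<bullet> (1 / sqrt (1 + \<kappa> j)) *\<^sub>R f j +
        D ((1 / sqrt (1 + \<kappa> i)) *\<^sub>R f i) \<bullet> D ((1 / sqrt (1 + \<kappa> j)) *\<^sub>R f j) = (if i = j then 1 else 0)"
      using k[of i] k[of j] by (auto simp: linear_scale[OF D] DD f(1))
  qed
  thus thesis using that[of f \<kappa>] f DD k by simp
qed

text \<open>In the frame of singular vectors the sum is that of s^2 / (1 + s^2) over all singular
  values s. Those after the first \<open>r\<close> vanish by the rank bound, and the first
  \<open>r\<close> are controlled by the products.\<close>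

lemma adapted_frame_energy_le_one:
  fixes D :: "real ^ 'n::finite \<Rightarrow> real ^ 'm"
  assumes D: "linear D" and z: "adapted_frame D z"
    and r: "2 \<le> r" "r \<le> CARD('n)" "rank (matrix D) \<le> r"
    and sv: "\<And>j k. 1 \<le> j \<Longrightarrow> j < k \<Longrightarrow> k \<le> r \<Longrightarrow>
      singular_value D j * singular_value D k \<le> 1 / (real r - 1)\<^sup>2"
  shows "(\<Sum>j\<in>UNIV. D (z j) \<bullet> D (z j)) \<le> 1"
proof -
  obtain f :: "'n \<Rightarrow> real ^ 'n" and \<kappa> where f: "\<And>i j. f i \<bullet> f j = (if i = j then 1 else 0)" "span (range f) = UNIV"
    and eig: "\<And>i. adjoint D (D (f i)) = \<kappa> i *\<^sub>R f i" and pos: "\<And>i. 0 \<le> \<kappa> i"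
    and DD: "\<And>i j. D (f i) \<bullet> D (f j) = (if i = j then \<kappa> i else 0)"
    and ad: "adapted_frame D (\<lambda>i. (1 / sqrt (1 + \<kappa> i)) *\<^sub>R f i)"
    using adapted_eigenframe[OF D] by blast
  define s where "s = singular_values D"
  have srt: "sorted_wrt (\<ge>) s" and ms: "mset s = image_mset (\<lambda>i. sqrt (\<kappa> i)) (mset_set UNIV)"
    unfolding s_def using singular_values_eigenframe[OF D f eig pos] by auto
  have len: "length s = CARD('n)" using arg_cong[OF ms, of size] by simp
  have "set s = (\<lambda>i. sqrt (\<kappa> i)) ` UNIV" using arg_cong[OF ms, of set_mset] by simp
  hence s0: "0 \<le> s ! j" if "j < CARD('n)" for j
    using that len pos nth_mem[of j s] by auto
  have mono: "s ! j \<le> s ! i" if "i \<le> j" "j < CARD('n)" for i j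
    using that srt len by (cases "i = j") (auto simp: sorted_wrt_iff_nth_less)
  have "(\<Sum>j\<in>UNIV. D (z j) \<bullet> D (z j)) = (\<Sum>i\<in>UNIV. D ((1 / sqrt (1 + \<kappa> i)) *\<^sub>R f i) \<bullet> D ((1 / sqrt (1 + \<kappa> i)) *\<^sub>R f i))"
    using adapted_frame_energy[OF D z] adapted_frame_energy[OF D ad] by simp
  also have "\<dots> = (\<Sum>i\<in>UNIV. (sqrt (\<kappa> i))\<^sup>2 / (1 + (sqrt (\<kappa> i))\<^sup>2))"
    using pos by (intro sum.cong) (auto simp: linear_scale[OF D] DD)
  also have "\<dots> = sum_mset (image_mset (\<lambda>x. x\<^sup>2 / (1 + x\<^sup>2)) (mset s))"
    unfolding ms by (simp add: image_mset.compositionality o_def sum_unfold_sum_mset)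
  also have "\<dots> = (\<Sum>j<CARD('n). (s ! j)\<^sup>2 / (1 + (s ! j)\<^sup>2))"
    by (simp add: sum_mset_sum_list sum_list_sum_nth len atLeast0LessThan flip: mset_map)
  also have "\<dots> = (\<Sum>j<r. (s ! j)\<^sup>2 / (1 + (s ! j)\<^sup>2))"
  proof (rule sum.mono_neutral_right)
    \<comment> \<open>If the entry at the 0-based position \<open>j \<ge> r\<close> were nonzero,
      the \<open>j + 1\<close> largest singular values would be positive. The images under
      \<open>D\<close> of the corresponding \<open>f i\<close> are nonzero and orthogonal, so the
      rank would exceed \<open>r\<close>.\<close>
    have "s ! j = 0" if "r \<le> j" "j < CARD('n)" for j
    proof (rule ccontr)
      assume "s ! j \<noteq> 0"
      hence "0 < s ! j" using s0 that by fastforce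
      have "{..j} \<subseteq> {i. i < length s \<and> 0 < s ! i}"
        using that len \<open>0 < s ! j\<close> mono by fastforce
      hence "Suc j \<le> card {i. i < length s \<and> 0 < s ! i}"
        using card_mono[of "{i. i < length s \<and> 0 < s ! i}" "{..j}"] by simp
      also have "\<dots> = size (filter_mset (\<lambda>x. 0 < x) (mset s))"
        by (simp add: length_filter_conv_card flip: mset_filter)
      also have "\<dots> = card {i. 0 < \<kappa> i}" by (simp add: ms filter_mset_image_mset)
      also have "\<dots> = card ((\<lambda>i. D (f i)) ` {i. 0 < \<kappa> i})"
      proof (rule card_image[symmetric], rule inj_onI)
        fix i i' assume "i \<in> {i. 0 < \<kappa> i}" "D (f i) = D (f i')"
        thus "i = i'" using DD[of i i'] DD[of i i] by (simp split: if_splits)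
      qed
      also have "\<dots> \<le> dim (range D)"
      proof (rule independent_card_le_dim)
        have "D (f i) \<noteq> 0" if "0 < \<kappa> i" for i using DD[of i i] that by auto
        hence "0 \<notin> (\<lambda>i. D (f i)) ` {i. 0 < \<kappa> i}" by (auto simp: image_iff)
        moreover have "pairwise orthogonal ((\<lambda>i. D (f i)) ` {i. 0 < \<kappa> i})"
          using DD by (auto simp: pairwise_def orthogonal_def)
        ultimately show "independent ((\<lambda>i. D (f i)) ` {i. 0 < \<kappa> i})"
          using pairwise_orthogonal_independent by blast
      qed auto
      also have "\<dots> = rank (matrix D)" by (simp add: rank_dim_range D)
      finally show False using r that by simp
    qed
    thus "\<forall>i\<in>{..<CARD('n)} - {..<r}. (s ! i)\<^sup>2 / (1 + (s ! i)\<^sup>2) = 0" by simp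
  qed (use r in auto)
  also have "{..<r} = {..r - 1}" using r by auto
  also have "(\<Sum>j\<le>r-1. (s ! j)\<^sup>2 / (1 + (s ! j)\<^sup>2)) \<le> 1"
  proof (rule sum_le_one_if_products_small)
    fix j assume "1 \<le> j" "j \<le> r - 1"
    \<comment> \<open>\<open>singular_value\<close> counts from 1 and the list \<open>s\<close> from
      0, hence the pair 1 and \<open>Suc j\<close>.\<close>
    thus "s ! 0 * s ! j \<le> 1 / (real (r - 1))\<^sup>2"
      using sv[of 1 "Suc j"] r by (auto simp: singular_value_def s_def[symmetric] of_nat_diff)
  qed (use r s0 mono in auto)
  finally show ?thesis .
qed

section \<open>Alternating forms\<close>

lemma alternating_form_linear:
  "alternating_form k \<xi> \<Longrightarrow> length vs = k \<Longrightarrow> i < k \<Longrightarrow> linear (\<lambda>v. \<xi> (vs[i := v]))"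
  by (simp add: alternating_form_def)

lemma alternating_form_eq:
  "alternating_form k \<xi> \<Longrightarrow> length vs = k \<Longrightarrow> i < k \<Longrightarrow> j < k \<Longrightarrow> i \<noteq> j \<Longrightarrow> vs ! i = vs ! j \<Longrightarrow> \<xi> vs = 0"
  unfolding alternating_form_def by blast

text \<open>Polarization: the form vanishes with \<open>a + b\<close> in both places, and two of the
  four terms of the expansion vanish as well.\<close>

lemma alternating_form_swap_adjacent:
  assumes \<xi>: "alternating_form k \<xi>" and k: "length xs + length ys + 2 = k"
  shows "\<xi> (xs @ a # b # ys) = - \<xi> (xs @ b # a # ys)"
proof -
  let ?i = "length xs"
  let ?f = "\<lambda>x y. \<xi> (xs @ x # y # ys)"
  have l1: "linear (\<lambda>v. ?f v y)" for y
    using alternating_form_linear[OF \<xi>, of "xs @ a # y # ys" ?i] k by simp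
  have l2: "linear (\<lambda>v. ?f x v)" for x
    using alternating_form_linear[OF \<xi>, of "xs @ x # b # ys" "Suc ?i"] k by (simp add: list_update_append)
  have z: "?f x x = 0" for x
    using alternating_form_eq[OF \<xi>, of "xs @ x # x # ys" ?i "Suc ?i"] k by (simp add: nth_append)
  have "?f (a + b) (a + b) = ?f a a + ?f a b + (?f b a + ?f b b)"
    using linear_add[OF l1, of a b "a + b"] linear_add[OF l2, of a a b] linear_add[OF l2, of b a b] by simp
  thus ?thesis using z by simp
qed

lemma alternating_form_move:
  assumes \<xi>: "alternating_form k \<xi>"
  shows "length xs + length ys + 1 = k \<Longrightarrow> \<xi> (w # xs @ ys) = (-1) ^ length xs * \<xi> (xs @ w # ys)"
proof (induction xs arbitrary: ys rule: rev_induct)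
  case (snoc x xs)
  have "\<xi> (w # (xs @ [x]) @ ys) = (-1) ^ length xs * \<xi> (xs @ w # x # ys)"
    using snoc.IH[of "x # ys"] snoc.prems by simp
  also have "\<dots> = (-1) ^ length (xs @ [x]) * \<xi> ((xs @ [x]) @ w # ys)"
    using alternating_form_swap_adjacent[OF \<xi>, of xs ys w x] snoc.prems by simp
  finally show ?case .
qed simp

lemma alternating_form_delete_nth:
  assumes "alternating_form k \<xi>" "length vs = k" "i < k"
  shows "\<xi> (w # delete_nth i vs) = (-1) ^ i * \<xi> (vs[i := w])"
  using alternating_form_move[OF assms(1), of "take i vs" "drop (Suc i) vs" w] assms
  by (simp add: delete_nth_def upd_conv_take_nth_drop)

text \<open>The sign \<open>(-1) ^ i\<close> of the wedge cancels the sign from moving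
  \<open>e\<close> into slot \<open>i\<close>, so \<open>Psi\<close> changes one slot at a time. The
  vector inserted there is the transpose of \<open>J\<close> applied to \<open>vs ! i\<close>:
  \<open>Psi\<close> is the derivation induced by that endomorphism.\<close>

lemma Psi_derivation:
  fixes \<xi> :: "('n::{finite,linorder}, 'm::finite) ambient form"
  assumes \<xi>: "alternating_form k \<xi>" and len: "length vs = k"
  shows "Psi F x \<xi> vs = (\<Sum>i<k. \<xi> (vs[i :=
    \<Sum>e\<leftarrow>tangent_onb F x. (J_op (frechet_derivative F (at x)) e \<bullet> vs ! i) *\<^sub>R e]))"
proof -
  let ?J = "J_op (frechet_derivative F (at x))"
  have "Psi F x \<xi> vs = (\<Sum>e\<leftarrow>tangent_onb F x. \<Sum>i<k. (?J e \<bullet> vs ! i) * \<xi> (vs[i := e]))"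
    unfolding Psi_def covector_wedge_def flat_def interior_mult_def len
    by (intro arg_cong[where f=sum_list] map_cong refl sum.cong)
      (simp add: alternating_form_delete_nth[OF \<xi> len] flip: power_add mult_2)
  also have "\<dots> = (\<Sum>i<k. \<Sum>e\<leftarrow>tangent_onb F x. (?J e \<bullet> vs ! i) * \<xi> (vs[i := e]))"
  proof -
    have "(\<Sum>e\<leftarrow>es. \<Sum>i<k. h e i) = (\<Sum>i<k. \<Sum>e\<leftarrow>es. h e i)" for es and h :: "_ \<Rightarrow> _ \<Rightarrow> real"
      by (induction es) (simp_all add: sum.distrib)
    thus ?thesis .
  qed
  also have "\<dots> = (\<Sum>i<k. \<xi> (vs[i := \<Sum>e\<leftarrow>tangent_onb F x. (?J e \<bullet> vs ! i) *\<^sub>R e]))"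
  proof (rule sum.cong)
    fix i assume "i \<in> {..<k}"
    hence lin: "linear (\<lambda>v. \<xi> (vs[i := v]))" using alternating_form_linear[OF \<xi> len] by simp
    have "(\<Sum>e\<leftarrow>es. c e * \<xi> (vs[i := e])) = \<xi> (vs[i := \<Sum>e\<leftarrow>es. c e *\<^sub>R e])" for es c
      by (induction es) (simp_all add: linear_0[OF lin] linear_add[OF lin] linear_scale[OF lin])
    thus "(\<Sum>e\<leftarrow>tangent_onb F x. (?J e \<bullet> vs ! i) * \<xi> (vs[i := e])) =
        \<xi> (vs[i := \<Sum>e\<leftarrow>tangent_onb F x. (?J e \<bullet> vs ! i) *\<^sub>R e])" .
  qed simp
  finally show ?thesis .
qed

section \<open>Determinant forms\<close>

lemma idx_less: "idx (i :: 'n::{finite,linorder}) < CARD('n)"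
  unfolding idx_def by (intro psubset_card_mono) auto

lemma idx_inject: "idx (i :: 'n::{finite,linorder}) = idx j \<longleftrightarrow> i = j"
proof -
  have "idx i < idx j" if "i < j" for i j :: 'n
    unfolding idx_def using that by (intro psubset_card_mono) auto
  thus ?thesis by (metis less_irrefl linorder_neqE)
qed

lemma bij_betw_idx: "bij_betw idx (UNIV :: 'n::{finite,linorder} set) {..<CARD('n)}"
proof -
  have "inj (idx :: 'n \<Rightarrow> nat)" by (auto simp: inj_def idx_inject)
  moreover have "range (idx :: 'n \<Rightarrow> nat) = {..<CARD('n)}"
    using calculation by (intro card_subset_eq) (auto simp: idx_less card_image)
  ultimately show ?thesis by (simp add: bij_betw_def)
qed

lemma sum_idx: "(\<Sum>j::'n::{finite,linorder}\<in>UNIV. g (idx j)) = (\<Sum>k<CARD('n). g k)"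
  by (rule sum.reindex_bij_betw[OF bij_betw_idx])

lemma ex_idx: "k < CARD('n) \<Longrightarrow> \<exists>j::'n::{finite,linorder}. idx j = k"
  using bij_betw_idx[where 'n='n] by (metis bij_betw_def imageE lessThan_iff)

lemma ex_list_idx: "\<exists>vs. length vs = CARD('n) \<and> (\<forall>j::'n::{finite,linorder}. vs ! idx j = f j)"
proof -
  let ?vs = "map (\<lambda>k. f (inv idx k)) [0..<CARD('n)]"
  have "?vs ! idx j = f j" for j :: 'n
    using idx_less[of j] bij_betw_idx[where 'n='n] by (simp add: bij_betw_def)
  thus ?thesis by (intro exI[of _ ?vs]) auto
qed

text \<open>The wedge of the covectors \<open>\<beta> i\<close>. The values lie in a commutative
  ring because covectors with polynomial values in \<open>t\<close> occur below.\<close>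

definition det_form :: "('n::{finite,linorder} \<Rightarrow> 'v \<Rightarrow> 'a::comm_ring_1) \<Rightarrow> 'v list \<Rightarrow> 'a" where
  "det_form \<beta> vs = det (\<chi> (i::'n) (j::'n). \<beta> i (vs ! idx j))"

lemma det_form_cong: "(\<And>i v. v \<in> set vs \<Longrightarrow> \<beta> i v = \<gamma> i v) \<Longrightarrow> length vs = CARD('n) \<Longrightarrow>
    det_form (\<beta> :: 'n::{finite,linorder} \<Rightarrow> _) vs = det_form \<gamma> vs"
  unfolding det_form_def by (simp add: idx_less)

lemma det_form_update:
  fixes \<beta> :: "'n::{finite,linorder} \<Rightarrow> 'v \<Rightarrow> 'a::comm_ring_1"
  assumes "length vs = CARD('n)"
  shows "det_form \<beta> (vs[idx k := v]) = det (\<chi> j. if j = k then \<chi> i. \<beta> i v else \<chi> i. \<beta> i (vs ! idx j))"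
proof -
  have "det_form \<beta> (vs[idx k := v]) = det (transpose (\<chi> j. if j = k then \<chi> i. \<beta> i v else \<chi> i. \<beta> i (vs ! idx j)))"
    unfolding det_form_def using assms
    by (intro arg_cong[where f=det]) (auto simp: vec_eq_iff transpose_def nth_list_update idx_inject idx_less)
  thus ?thesis by simp
qed

lemma det_form_add:
  fixes \<beta> :: "'n::{finite,linorder} \<Rightarrow> 'v \<Rightarrow> 'a::comm_ring_1"
  assumes "length vs = CARD('n)" "k < CARD('n)" "\<And>i. \<beta> i w = \<beta> i u + \<beta> i v"
  shows "det_form \<beta> (vs[k := w]) = det_form \<beta> (vs[k := u]) + det_form \<beta> (vs[k := v])"
proof -
  obtain j :: 'n where j: "k = idx j" using ex_idx[OF assms(2)] by blast
  have "(\<chi> i. \<beta> i w) = (\<chi> i. \<beta> i u) + (\<chi> i. \<beta> i v)" using assms(3) by (simp add: vec_eq_iff)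
  thus ?thesis unfolding j det_form_update[OF assms(1)] by (simp only: det_row_add)
qed

lemma det_form_scale:
  fixes \<beta> :: "'n::{finite,linorder} \<Rightarrow> 'v \<Rightarrow> 'a::comm_ring_1"
  assumes "length vs = CARD('n)" "k < CARD('n)" "\<And>i. \<beta> i w = c * \<beta> i u"
  shows "det_form \<beta> (vs[k := w]) = c * det_form \<beta> (vs[k := u])"
proof -
  obtain j :: 'n where j: "k = idx j" using ex_idx[OF assms(2)] by blast
  have "(\<chi> i. \<beta> i w) = c *s (\<chi> i. \<beta> i u)" using assms(3) by (simp add: vec_eq_iff)
  thus ?thesis unfolding j det_form_update[OF assms(1)] by (simp only: det_row_mul)
qed

lemma det_form_eq:
  fixes \<beta> :: "'n::{finite,linorder} \<Rightarrow> 'v \<Rightarrow> 'a::comm_ring_1"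
  assumes "i < CARD('n)" "j < CARD('n)" "i \<noteq> j" "vs ! i = vs ! j"
  shows "det_form \<beta> vs = 0"
proof -
  obtain i' j' :: 'n where "i = idx i'" "j = idx j'" using ex_idx assms(1,2) by metis
  thus ?thesis unfolding det_form_def
    using assms by (intro det_identical_columns[of i' j']) (auto simp: column_def vec_eq_iff)
qed

lemma alternating_det_form:
  fixes \<beta> :: "'n::{finite,linorder} \<Rightarrow> 'v::real_vector \<Rightarrow> real"
  assumes "\<And>i. linear (\<beta> i)"
  shows "alternating_form CARD('n) (det_form \<beta>)"
  unfolding alternating_form_def
proof (intro allI impI conjI)
  fix vs :: "'v list" and i assume "length vs = CARD('n)" "i < CARD('n)"
  thus "linear (\<lambda>v. det_form \<beta> (vs[i := v]))"
    by (intro linearI)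
      (auto intro!: det_form_add det_form_scale simp: linear_add[OF assms] linear_scale[OF assms])
qed (rule det_form_eq)

lemma det_form_row_add:
  "det_form (\<beta>(k := \<lambda>w. a w + b w)) vs = det_form (\<beta>(k := a)) vs + det_form (\<beta>(k := b)) vs"
proof -
  have *: "(\<chi> i j. (\<beta>(k := c)) i (vs ! idx j)) = (\<chi> i. if i = k then \<chi> j. c (vs ! idx j) else \<chi> j. \<beta> i (vs ! idx j))" for c
    by (auto simp: vec_eq_iff)
  show ?thesis unfolding det_form_def * det_row_add[symmetric]
    by (intro arg_cong[where f=det]) (auto simp: vec_eq_iff)
qed

lemma det_form_row_scale:
  "det_form (\<beta>(k := \<lambda>w. c * b w)) vs = c * det_form (\<beta>(k := b)) vs"
proof -
  have *: "(\<chi> i j. (\<beta>(k := c)) i (vs ! idx j)) = (\<chi> i. if i = k then \<chi> j. c (vs ! idx j) else \<chi> j. \<beta> i (vs ! idx j))" for c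
    by (auto simp: vec_eq_iff)
  show ?thesis unfolding det_form_def * det_row_mul[symmetric]
    by (intro arg_cong[where f=det]) (auto simp: vec_eq_iff)
qed

lemma det_form_row_sum:
  "finite S \<Longrightarrow> det_form (\<beta>(k := \<lambda>w. \<Sum>s\<in>S. c s * b s w)) vs = (\<Sum>s\<in>S. c s * det_form (\<beta>(k := b s)) vs)"
proof (induction S rule: finite_induct)
  case empty
  have "det_form (\<beta>(k := \<lambda>w. 0)) vs = 0" using det_form_row_scale[of \<beta> k 0 "\<lambda>_. 0" vs] by simp
  thus ?case by (simp only: sum.empty)
next
  case (insert s S)
  show ?case unfolding sum.insert[OF insert(1,2)] det_form_row_add det_form_row_scale insert.IH ..
qed

lemma det_form_row_eq: "i \<noteq> j \<Longrightarrow> \<beta> i = \<beta> j \<Longrightarrow> det_form \<beta> vs = 0"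
  unfolding det_form_def by (intro det_identical_rows[of i j]) (auto simp: row_def vec_eq_iff)

lemma det_form_rows_mult:
  fixes M :: "(('a::comm_ring_1, 'n::{finite,linorder}) vec, 'n) vec"
  shows "det_form (\<lambda>i w. \<Sum>k\<in>UNIV. M $ i $ k * \<beta> k w) vs = det M * det_form \<beta> vs"
  unfolding det_form_def det_mul[symmetric]
  by (intro arg_cong[where f=det]) (simp add: vec_eq_iff matrix_matrix_mult_def)

section \<open>Polynomial matrices\<close>

lemma pderiv_sum: "pderiv (sum f A) = (\<Sum>x\<in>A. pderiv (f x))"
  using higher_pderiv_sum[of 1] by simp

lemma pderiv_of_int_mult: "pderiv (of_int c * p) = of_int c * pderiv (p :: real poly)"
  by (simp add: of_int_poly pderiv_smult)

lemma pderiv_det_rows: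
  fixes A :: "real poly ^ 'n ^ 'n"
  shows "pderiv (det A) = (\<Sum>k\<in>UNIV. det (\<chi> i j. if i = k then pderiv (A $ i $ j) else A $ i $ j))"
proof -
  have "pderiv (det A) = (\<Sum>p | p permutes (UNIV :: 'n set). \<Sum>k\<in>UNIV. of_int (sign p) *
      (\<Prod>i\<in>UNIV. if i = k then pderiv (A $ i $ p i) else A $ i $ p i))"
  proof -
    have "(\<Prod>i\<in>UNIV - {k}. A $ i $ p i) * pderiv (A $ k $ p k) =
        (\<Prod>i\<in>UNIV. if i = k then pderiv (A $ i $ p i) else A $ i $ p i)" for p k
      by (subst prod.remove[of UNIV k]) (auto intro!: prod.cong)
    thus ?thesis
      by (simp add: det_def pderiv_sum pderiv_of_int_mult pderiv_prod sum_distrib_left)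
  qed
  thus ?thesis by (subst (asm) sum.swap) (simp add: det_def if_distrib[where f="\<lambda>v. v $ _"] cong: if_cong)
qed

lemma poly_det: "poly (det A) c = det (\<chi> i j. poly (A $ i $ j) c)" for A :: "real poly ^ 'n ^ 'n"
  by (simp add: det_def poly_sum poly_prod)

lemma poly_det_form: "poly (det_form \<beta> vs) c = det_form (\<lambda>i w. poly (\<beta> i w) c) vs" for c :: real
  by (simp add: det_form_def poly_det)

lemma pderiv_det_form_rows:
  fixes \<beta> :: "'n::{finite,linorder} \<Rightarrow> 'v \<Rightarrow> real poly"
  shows "pderiv (det_form \<beta> vs) = (\<Sum>k\<in>UNIV. det_form (\<beta>(k := \<lambda>w. pderiv (\<beta> k w))) vs)"
  unfolding det_form_def pderiv_det_rows
  by (intro sum.cong arg_cong[where f=det]) (auto simp: vec_eq_iff)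

text \<open>A determinant can also be differentiated by columns, that is, by arguments. When
  \<open>A\<close> realises the derivative on each covector, this substitutes \<open>A\<close> in
  one argument at a time, which is the shape of \<open>Psi_derivation\<close>.\<close>

lemma pderiv_det_form_columns:
  fixes \<beta> :: "'n::{finite,linorder} \<Rightarrow> 'v \<Rightarrow> real poly"
  assumes "length vs = CARD('n)" and d: "\<And>i v. \<beta> i (A v) = pderiv (\<beta> i v)"
  shows "pderiv (det_form \<beta> vs) = (\<Sum>k<CARD('n). det_form \<beta> (vs[k := A (vs ! k)]))"
proof -
  have "det_form \<beta> vs = det (transpose (\<chi> i j. \<beta> i (vs ! idx j)))"
    unfolding det_form_def by simp
  also have "pderiv \<dots> = (\<Sum>k::'n\<in>UNIV. det_form \<beta> (vs[idx k := A (vs ! idx k)]))"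
    unfolding pderiv_det_rows
    by (intro sum.cong refl, subst det_form_update[OF assms(1)])
      (auto intro!: arg_cong[where f=det] simp: vec_eq_iff transpose_def d)
  finally show ?thesis
    using sum_idx[where 'n='n and g="\<lambda>k. det_form \<beta> (vs[k := A (vs ! k)])"] by simp
qed

section \<open>The form \<open>\<Theta>(F)\<close> in coordinates\<close>

lemma linear_axis_expansion:
  fixes D :: "real ^ 'n \<Rightarrow> 'b::real_vector"
  assumes "linear D"
  shows "D v = (\<Sum>k\<in>UNIV. v $ k *\<^sub>R D (axis k 1))"
proof -
  have "v = (\<Sum>k\<in>UNIV. v $ k *\<^sub>R axis k 1)"
    by (simp add: vec_eq_iff axis_def if_distrib cong: if_cong)
  hence "D v = D (\<Sum>k\<in>UNIV. v $ k *\<^sub>R axis k 1)" by simp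
  thus ?thesis by (simp add: linear_sum[OF assms] linear_scale[OF assms])
qed

lemma adapted_frame_expansion:
  fixes z :: "'n \<Rightarrow> real ^ 'n"
  assumes D: "linear D" and z: "adapted_frame D z"
  shows "v = (\<Sum>j\<in>UNIV. (z j \<bullet> G_op D v) *\<^sub>R z j)"
proof -
  let ?C = "matrix_inv (gmat D)"
  have "?C ** gmat D = mat 1"
    using adapted_frame_inverse(2)[OF assms] matrix_left_right_inverse by blast
  hence "v = ?C *v (gmat D *v v)" by (simp add: matrix_vector_mul_assoc)
  also have "\<dots> = ?C *v G_op D v" by (simp add: gmat_mult[OF D])
  also have "\<dots> = (\<Sum>j\<in>UNIV. (z j \<bullet> G_op D v) *\<^sub>R z j)"
  proof -
    have "(?C *v w) $ k = (\<Sum>j\<in>UNIV. (z j \<bullet> w) * z j $ k)" for w k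
    proof -
      have "(?C *v w) $ k = (\<Sum>l\<in>UNIV. \<Sum>j\<in>UNIV. z j $ k * z j $ l * w $ l)"
        by (simp add: matrix_vector_mult_def adapted_frame_inverse(1)[OF assms, symmetric] sum_distrib_right)
      also have "\<dots> = (\<Sum>j\<in>UNIV. \<Sum>l\<in>UNIV. z j $ k * z j $ l * w $ l)" by (rule sum.swap)
      finally show ?thesis by (simp add: inner_vec_def sum_distrib_left mult_ac)
    qed
    thus ?thesis by (simp add: vec_eq_iff)
  qed
  finally show ?thesis .
qed

section \<open>Orthonormal tangent bases as adapted frames\<close>

lemma frechet_derivative_graph_map:
  assumes "F differentiable (at x)"
  shows "frechet_derivative (graph_map F) (at x) = (\<lambda>v. (v, frechet_derivative F (at x) v))"
proof -
  have "(graph_map F has_derivative (\<lambda>v. (v, frechet_derivative F (at x) v))) (at x)"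
    unfolding graph_map_def[abs_def]
    using assms by (intro has_derivative_Pair has_derivative_ident frechet_derivative_works[THEN iffD1])
  thus ?thesis by (rule frechet_derivative_at[symmetric])
qed

lemma tangent_space_eq:
  "F differentiable (at x) \<Longrightarrow> tangent_space F x = range (\<lambda>v. (v, frechet_derivative F (at x) v))"
  by (simp add: tangent_space_def frechet_derivative_graph_map)

text \<open>Existence gives the choice in \<open>tangent_onb\<close> its properties. An adapted
  frame lifts to an orthonormal basis, and reversing one vector corrects the orientation where
  necessary.\<close>

lemma oriented_onb_exists:
  fixes F :: "('n::{finite,linorder}) rvec \<Rightarrow> real ^ 'm::finite"
  assumes dif: "F differentiable (at x)"
  shows "\<exists>es. oriented_onb F x es"
proof -
  define D where "D = frechet_derivative F (at x)"
  have D: "linear D" unfolding D_def using dif by (rule linear_frechet_derivative)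
  obtain z0 :: "'n \<Rightarrow> 'n rvec" where z0: "adapted_frame D z0" by (rule adapted_eigenframe[OF D]) (rule that)
  \<comment> \<open>An unspecified but fixed index: any vector may be the one that is
    reversed.\<close>
  define k0 :: 'n where "k0 = undefined"
  define z where "z = (if det (\<chi> k j. z0 j $ k) > 0 then z0 else z0(k0 := - z0 k0))"
  have z: "adapted_frame D z"
  proof -
    have z0: "z0 i \<bullet> z0 j + D (z0 i) \<bullet> D (z0 j) = (if i = j then 1 else 0)" for i j
      using z0 by (simp add: adapted_frame_def)
    have "- (z0 i \<bullet> z0 j) - D (z0 i) \<bullet> D (z0 j) = 0" if "i \<noteq> j" for i j
      using z0[of i j] that by simp
    thus ?thesis using z0 by (auto simp: z_def adapted_frame_def linear_neg[OF D])
  qed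
  have "det (\<chi> k j. (z0(k0 := - z0 k0)) j $ k) = - det (\<chi> k j. z0 j $ k)"
  proof -
    have "(\<chi> k j. (z0(k0 := - z0 k0)) j $ k) = transpose (\<chi> j. if j = k0 then (-1) *s z0 j else z0 j)"
      by (auto simp: vec_eq_iff transpose_def)
    moreover have "(\<chi> k j. z0 j $ k) = transpose (\<chi> j. if j = k0 then z0 j else z0 j)"
      by (auto simp: vec_eq_iff transpose_def)
    ultimately show ?thesis by (simp only: det_transpose det_row_mul mult_minus1)
  qed
  moreover have "det (\<chi> k j. z0 j $ k) \<noteq> 0" using adapted_frame_inverse(3)[OF D z0] by auto
  ultimately have pos: "0 < det (\<chi> k j. z j $ k)" by (simp add: z_def del: fun_upd_apply)
  obtain es where es: "length es = CARD('n)" "\<And>j::'n. es ! idx j = (z j, D (z j))"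
    using ex_list_idx[of "\<lambda>j. (z j, D (z j))"] by blast
  have set: "set es = (\<lambda>v. (v, D v)) ` range z"
  proof -
    have "set es = (!) es ` {..<CARD('n)}" using es(1) by (auto simp: set_conv_nth)
    also have "\<dots> = (!) es ` range (idx :: 'n \<Rightarrow> nat)"
      using bij_betw_idx[where 'n='n] by (simp add: bij_betw_def)
    finally show ?thesis using es(2) by (simp add: image_image)
  qed
  have orth: "orthonormal_list es"
    unfolding orthonormal_list_def es(1)
  proof (intro allI impI)
    fix i j assume "i < CARD('n)" "j < CARD('n)"
    then obtain i' j' :: 'n where ij: "i = idx i'" "j = idx j'" using ex_idx by metis
    show "es ! i \<bullet> es ! j = (if i = j then 1 else 0)"
      using z unfolding ij es(2) by (simp add: adapted_frame_def idx_inject)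
  qed
  have "v \<in> span (range z)" for v
    by (subst adapted_frame_expansion[OF D z]) (intro span_sum span_scale span_base, simp)
  hence "span (range z) = UNIV" by blast
  moreover have "linear (\<lambda>v. (v, D v))"
    by (intro linearI) (simp_all add: linear_add[OF D] linear_scale[OF D])
  ultimately have "span (set es) = tangent_space F x"
    unfolding set tangent_space_eq[OF dif] D_def[symmetric] by (simp add: linear_span_image)
  thus ?thesis unfolding oriented_onb_def using es orth pos by auto
qed

lemma tangent_onb_frame:
  fixes F :: "('n::{finite,linorder}) rvec \<Rightarrow> real ^ 'm::finite"
  assumes dif: "F differentiable (at x)"
  obtains z :: "'n \<Rightarrow> 'n rvec" where "adapted_frame (frechet_derivative F (at x)) z"
    "length (tangent_onb F x) = CARD('n)"
    "\<And>j. tangent_onb F x ! idx j = (z j, frechet_derivative F (at x) (z j))"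
    "0 < det (\<chi> k j. z j $ k)"
proof -
  have o: "oriented_onb F x (tangent_onb F x)"
    unfolding tangent_onb_def using oriented_onb_exists[OF dif] by (rule someI_ex)
  hence len: "length (tangent_onb F x) = CARD('n)" by (simp add: oriented_onb_def)
  define z :: "'n \<Rightarrow> 'n rvec" where "z j = fst (tangent_onb F x ! idx j)" for j
  have e: "tangent_onb F x ! idx j = (z j, frechet_derivative F (at x) (z j))" for j :: 'n
  proof -
    have "tangent_onb F x ! idx j \<in> tangent_space F x"
      using o len idx_less[of j] span_base[of "tangent_onb F x ! idx j" "set (tangent_onb F x)"]
      by (auto simp: oriented_onb_def)
    thus ?thesis by (auto simp: tangent_space_eq[OF dif] z_def)
  qed
  have "adapted_frame (frechet_derivative F (at x)) z"
    unfolding adapted_frame_def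
  proof (intro allI)
    fix i j :: 'n
    have "tangent_onb F x ! idx i \<bullet> tangent_onb F x ! idx j = (if i = j then 1 else 0)"
      using o len by (simp add: oriented_onb_def orthonormal_list_def idx_less idx_inject)
    thus "z i \<bullet> z j + frechet_derivative F (at x) (z i) \<bullet> frechet_derivative F (at x) (z j) = (if i = j then 1 else 0)"
      by (simp add: e)
  qed
  moreover have "0 < det (\<chi> k j. z j $ k)" using o by (simp add: oriented_onb_def z_def)
  ultimately show thesis by (intro that[OF _ len e])
qed

lemma sum_list_tangent_onb:
  fixes F :: "('n::{finite,linorder}) rvec \<Rightarrow> real ^ 'm::finite"
  assumes "length (tangent_onb F x) = CARD('n)"
  shows "(\<Sum>e\<leftarrow>tangent_onb F x. g e) = (\<Sum>j::'n\<in>UNIV. g (tangent_onb F x ! idx j))"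
  using sum_idx[where 'n='n and g="\<lambda>k. g (tangent_onb F x ! k)"]
  by (simp add: sum_list_sum_nth assms atLeast0LessThan)

lemma alternating_form_cong:
  assumes "alternating_form k \<xi>" "\<And>vs. length vs = k \<Longrightarrow> \<eta> vs = \<xi> vs"
  shows "alternating_form k \<eta>"
  using assms unfolding alternating_form_def by simp

text \<open>\<open>det_form (vol_poly D z)\<close> is \<open>exp (t \<Psi>) vol\<close> as a polynomial in \<open>t\<close>.\<close>

definition vol_poly :: "(real ^ 'n \<Rightarrow> real ^ 'm) \<Rightarrow> ('n \<Rightarrow> real ^ 'n) \<Rightarrow> 'n \<Rightarrow>
    (real ^ 'n) \<times> (real ^ 'm) \<Rightarrow> real poly" where
  "vol_poly D z i w = [:(z i, D (z i)) \<bullet> w, (- adjoint D (D (z i)), D (z i)) \<bullet> w:]"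

text \<open>Differentiation and evaluation are linear, so they preserve alternation of a
  polynomial-valued form. The induction for \<open>Psi_pow\<close> needs this to apply
  \<open>Psi_derivation\<close> to the previous power.\<close>

lemma alternating_higher_pderiv:
  fixes z :: "'n::{finite,linorder} \<Rightarrow> 'n rvec" and D :: "'n rvec \<Rightarrow> real ^ 'm"
  shows "alternating_form CARD('n) (\<lambda>vs. poly ((pderiv ^^ l) (det_form (vol_poly D z) vs)) 0)"
  unfolding alternating_form_def
proof (intro allI impI conjI)
  fix vs :: "((real, 'n) vec \<times> (real, 'm) vec) list" and i
  assume vs: "length vs = CARD('n)" "i < CARD('n)"
  show "linear (\<lambda>v. poly ((pderiv ^^ l) (det_form (vol_poly D z) (vs[i := v]))) 0)"
  proof (rule linearI)
    fix u v c
    have "det_form (vol_poly D z) (vs[i := u + v]) =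
        det_form (vol_poly D z) (vs[i := u]) + det_form (vol_poly D z) (vs[i := v])"
      by (rule det_form_add[OF vs]) (simp add: vol_poly_def inner_add_right)
    thus "poly ((pderiv ^^ l) (det_form (vol_poly D z) (vs[i := u + v]))) 0 =
        poly ((pderiv ^^ l) (det_form (vol_poly D z) (vs[i := u]))) 0 +
        poly ((pderiv ^^ l) (det_form (vol_poly D z) (vs[i := v]))) 0"
      by (simp add: higher_pderiv_add)
    have "det_form (vol_poly D z) (vs[i := c *\<^sub>R u]) = [:c:] * det_form (vol_poly D z) (vs[i := u])"
      by (rule det_form_scale[OF vs]) (simp add: vol_poly_def)
    thus "poly ((pderiv ^^ l) (det_form (vol_poly D z) (vs[i := c *\<^sub>R u]))) 0 =
        c *\<^sub>R poly ((pderiv ^^ l) (det_form (vol_poly D z) (vs[i := u]))) 0"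
      by (simp add: higher_pderiv_smult)
  qed
next
  fix vs :: "((real, 'n) vec \<times> (real, 'm) vec) list" and i j
  assume "length vs = CARD('n)" "i < CARD('n)" "j < CARD('n)" "i \<noteq> j" "vs ! i = vs ! j"
  hence "det_form (vol_poly D z) vs = 0" by (intro det_form_eq[of i j])
  thus "poly ((pderiv ^^ l) (det_form (vol_poly D z) vs)) 0 = 0" by (simp add: higher_pderiv_0)
qed

text \<open>\<open>A\<close> is the transpose of \<open>J\<close> in the tangent basis. Because
  \<open>J\<close> takes tangent vectors to normal ones, evaluating \<open>vol_poly\<close> at
  \<open>A v\<close> moves the slope into the constant term and leaves slope 0, which is the
  derivative of a linear polynomial. Hence each application of \<open>Psi\<close> differentiates the
  determinant once in \<open>t\<close>.\<close>

lemma Psi_pow_eq: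
  fixes F :: "('n::{finite,linorder}) rvec \<Rightarrow> real ^ 'm::finite"
  assumes dif: "F differentiable (at x)"
    and z: "adapted_frame (frechet_derivative F (at x)) z"
    and len: "length (tangent_onb F x) = CARD('n)"
    and e: "\<And>j. tangent_onb F x ! idx j = (z j, frechet_derivative F (at x) (z j))"
  shows "length vs = CARD('n) \<Longrightarrow>
    Psi_pow l F (x, y) vs = poly ((pderiv ^^ l) (det_form (vol_poly (frechet_derivative F (at x)) z) vs)) 0"
proof (induction l arbitrary: vs)
  case 0
  thus ?case by (simp add: Psi_pow_def graph_vol_def poly_det_form poly_det vol_poly_def det_form_def e)
next
  case (Suc l)
  define D where "D = frechet_derivative F (at x)"
  have D: "linear D" unfolding D_def using dif by (rule linear_frechet_derivative)
  have J: "J_op D (z j, D (z j)) = (- adjoint D (D (z j)), D (z j))" for j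
    by (rule J_op_tangent[OF D])
  let ?q = "det_form (vol_poly D z)"
  define A where "A v = (\<Sum>j\<in>UNIV. ((- adjoint D (D (z j)), D (z j)) \<bullet> v) *\<^sub>R (z j, D (z j)))" for v
  have A: "(\<Sum>e\<leftarrow>tangent_onb F x. (J_op (frechet_derivative F (at x)) e \<bullet> v) *\<^sub>R e) = A v" for v
    unfolding sum_list_tangent_onb[OF len] e D_def[symmetric] J A_def ..
  have JJ: "(- adjoint D (D (z i)), D (z i)) \<bullet> (z j, D (z j)) = 0" for i j
    by (simp add: adjoint_clauses[OF D])
  have dA: "vol_poly D z i (A v) = pderiv (vol_poly D z i v)" for i v
  proof -
    have "(z i, D (z i)) \<bullet> A v = (\<Sum>j\<in>UNIV. ((- adjoint D (D (z j)), D (z j)) \<bullet> v) * (if i = j then 1 else 0))"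
    proof -
      have "(z i, D (z i)) \<bullet> (z j, D (z j)) = (if i = j then 1 else 0)" for j
        using z by (simp add: adapted_frame_def D_def)
      thus ?thesis unfolding A_def inner_sum_right inner_scaleR_right by (simp only:)
    qed
    hence 1: "(z i, D (z i)) \<bullet> A v = (- adjoint D (D (z i)), D (z i)) \<bullet> v"
      by (simp add: if_distrib cong: if_cong)
    have 2: "(- adjoint D (D (z i)), D (z i)) \<bullet> A v = 0"
      unfolding A_def inner_sum_right inner_scaleR_right JJ by simp
    show ?thesis unfolding vol_poly_def 1 2 by (simp add: pderiv_pCons)
  qed
  let ?\<xi> = "Psi_pow l F (x, y)"
  have alt: "alternating_form CARD('n) ?\<xi>"
    using alternating_higher_pderiv Suc.IH by (rule alternating_form_cong)
  have "Psi_pow (Suc l) F (x, y) vs = Psi F x ?\<xi> vs" by (simp add: Psi_pow_def)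
  also have "\<dots> = (\<Sum>i<CARD('n). ?\<xi> (vs[i := A (vs ! i)]))"
    unfolding Psi_derivation[OF alt Suc.prems] A ..
  also have "\<dots> = (\<Sum>i<CARD('n). poly ((pderiv ^^ l) (?q (vs[i := A (vs ! i)]))) 0)"
    using Suc by (simp add: D_def)
  also have "\<dots> = poly ((pderiv ^^ l) (pderiv (?q vs))) 0"
    unfolding pderiv_det_form_columns[where A=A and \<beta>="vol_poly D z", OF Suc.prems dA] by (simp add: higher_pderiv_sum poly_sum)
  finally show ?case by (simp add: D_def funpow_swap1)
qed

text \<open>The derivative contributes -l to the coefficient of degree l, next to the 1 of the
  value. This is the origin of the factor l - 1 in \<open>Theta\<close>.\<close>

lemma poly_minus_one_eq_sum_coeff:
  fixes q :: "real poly"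
  shows "poly q (-1) + poly (pderiv q) (-1) = (\<Sum>l\<le>degree q. (-1) ^ l * (1 - real l) * coeff q l)"
proof -
  have "poly q (-1) + poly (pderiv q) (-1) =
      (\<Sum>l\<le>degree q. poly (monom (coeff q l) l) (-1) + poly (pderiv (monom (coeff q l) l)) (-1))"
    by (subst (1 2) poly_as_sum_of_monoms[symmetric]) (simp add: poly_sum pderiv_sum sum.distrib)
  also have "\<dots> = (\<Sum>l\<le>degree q. (-1) ^ l * (1 - real l) * coeff q l)"
  proof (rule sum.cong)
    fix l assume "l \<in> {..degree q}"
    show "poly (monom (coeff q l) l) (-1) + poly (pderiv (monom (coeff q l) l)) (-1) =
        (-1) ^ l * (1 - real l) * coeff q l"
      by (cases l) (simp_all add: poly_monom pderiv_monom algebra_simps)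
  qed simp
  finally show ?thesis .
qed

text \<open>\<open>Psi_pow l\<close> is \<open>fact l\<close> times the coefficient of degree
  \<open>l\<close>, so the factorials cancel and the infinite sum stops at the degree of
  \<open>q\<close>.\<close>

lemma Theta_eq_poly:
  fixes F :: "('n::{finite,linorder}) rvec \<Rightarrow> real ^ 'm::finite"
  assumes dif: "F differentiable (at x)"
    and z: "adapted_frame (frechet_derivative F (at x)) z"
    and len: "length (tangent_onb F x) = CARD('n)"
    and e: "\<And>j. tangent_onb F x ! idx j = (z j, frechet_derivative F (at x) (z j))"
    and vs: "length vs = CARD('n)"
  defines "q \<equiv> det_form (vol_poly (frechet_derivative F (at x)) z) vs"
  shows "Theta F (x, y) vs = poly q (-1) + poly (pderiv q) (-1)"
proof -
  have P: "Psi_pow l F (x, y) vs = fact l * coeff q l" for l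
  proof -
    have "Psi_pow l F (x, y) vs = coeff ((pderiv ^^ l) q) 0"
      unfolding Psi_pow_eq[OF dif z len e vs] q_def by (simp add: poly_0_coeff_0)
    thus ?thesis by (simp add: coeff_higher_pderiv pochhammer_fact)
  qed
  have "(\<Sum>\<^sub>\<infinity>l\<in>{1..}. (-1) ^ l * ((real l - 1) / fact l) * Psi_pow l F (x, y) vs) =
      (\<Sum>\<^sub>\<infinity>l\<in>{1..degree q}. (-1) ^ l * (real l - 1) * coeff q l)"
    unfolding P by (rule infsum_cong_neutral) (auto simp: coeff_eq_0)
  also have "\<dots> = (\<Sum>l\<in>{1..degree q}. (-1) ^ l * (real l - 1) * coeff q l)" by simp
  finally have "Theta F (x, y) vs = coeff q 0 - (\<Sum>l\<in>{1..degree q}. (-1) ^ l * (real l - 1) * coeff q l)"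
    unfolding Theta_def by (simp add: P)
  also have "\<dots> = (\<Sum>l\<le>degree q. (-1) ^ l * (1 - real l) * coeff q l)"
  proof -
    have "{..degree q} = insert 0 {1..degree q}" by auto
    moreover have "(\<Sum>l\<in>{1..degree q}. (-1) ^ l * (1 - real l) * coeff q l) =
        - (\<Sum>l\<in>{1..degree q}. (-1) ^ l * (real l - 1) * coeff q l)"
      unfolding sum_negf[symmetric] by (intro sum.cong) (auto simp: algebra_simps)
    ultimately show ?thesis by simp
  qed
  finally show ?thesis by (simp add: poly_minus_one_eq_sum_coeff)
qed

lemma det_form_const: "det_form (\<lambda>i w. [:\<beta> i w:]) vs = [:det_form \<beta> vs :: real:]"
proof -
  have p: "[:\<Prod>i\<in>S. h i:] = (\<Prod>i\<in>S. [:h i:])" for S and h :: "_ \<Rightarrow> real"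
  proof (induction S rule: infinite_finite_induct)
    case (insert x S)
    show ?case unfolding prod.insert[OF insert(1,2)] insert.IH[symmetric] by simp
  qed (simp_all add: one_pCons)
  have s: "[:sum h S:] = (\<Sum>i\<in>S. [:h i:])" for S and h :: "_ \<Rightarrow> real"
  proof (induction S rule: infinite_finite_induct)
    case (insert x S)
    show ?case unfolding sum.insert[OF insert(1,2)] insert.IH[symmetric] by simp
  qed simp_all
  have c: "[:of_int c * r:] = of_int c * [:r:]" for c and r :: real by (simp add: of_int_poly)
  show ?thesis unfolding det_form_def det_def vec_lambda_beta s c p ..
qed

text \<open>On tangent arguments the slopes of \<open>vol_poly\<close> vanish because
  \<open>J\<close> has normal values. The polynomial is then constant, and its value is the volume
  form.\<close>

lemma Theta_tangent:
  fixes F :: "('n::{finite,linorder}) rvec \<Rightarrow> real ^ 'm::finite"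
  assumes dif: "F differentiable (at x)" and vs: "length vs = CARD('n)" "set vs \<subseteq> tangent_space F x"
  shows "Theta F (x, y) vs = graph_vol F x vs"
proof -
  define D where "D = frechet_derivative F (at x)"
  have D: "linear D" unfolding D_def using dif by (rule linear_frechet_derivative)
  obtain z :: "'n \<Rightarrow> 'n rvec" where z: "adapted_frame (frechet_derivative F (at x)) z"
    "length (tangent_onb F x) = CARD('n)"
    "\<And>j. tangent_onb F x ! idx j = (z j, frechet_derivative F (at x) (z j))"
    by (rule tangent_onb_frame[OF dif]) (rule that)
  have "vol_poly D z i v = [:(z i, D (z i)) \<bullet> v:]" if v: "v \<in> set vs" for i v
  proof -
    obtain u where "v = (u, D u)" using v vs(2) unfolding tangent_space_eq[OF dif] D_def by blast
    thus ?thesis by (simp add: vol_poly_def adjoint_clauses[OF D])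
  qed
  hence "det_form (vol_poly D z) vs = [:det_form (\<lambda>i v. (z i, D (z i)) \<bullet> v) vs:]"
    unfolding det_form_const[symmetric] using vs(1) by (intro det_form_cong)
  moreover have "det_form (\<lambda>i v. (z i, D (z i)) \<bullet> v) vs = graph_vol F x vs"
    by (simp add: graph_vol_def det_form_def z(3) D_def)
  ultimately show ?thesis
    using Theta_eq_poly[OF dif z vs(1)] by (simp add: D_def pderiv_pCons)
qed

section \<open>The Poincare-Cartan form of the area integrand\<close>

definition area :: "(real ^ 'n \<Rightarrow> real ^ 'm) \<Rightarrow> real" where
  "area D = sqrt (det (gmat D))"

text \<open>\<open>area\<close> is the area integrand as a function of the differential, \<open>momentum\<close> its gradient,
  and \<open>\<Theta>(F)\<close> turns out to be the Poincare--Cartan form of this variational problem.\<close>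

definition momentum :: "(real ^ 'n \<Rightarrow> real ^ 'm) \<Rightarrow> 'n \<Rightarrow> real ^ 'm" where
  "momentum D k = area D *\<^sub>R (\<Sum>j\<in>UNIV. (matrix_inv (gmat D) $ k $ j) *\<^sub>R D (axis j 1))"

text \<open>The value at the zero map of the affine function tangent to the area integrand at
  \<open>D\<close>, that is, minus the Hamiltonian of the variational problem.\<close>

definition energy :: "(real ^ 'n \<Rightarrow> real ^ 'm) \<Rightarrow> real" where
  "energy D = area D - (\<Sum>k\<in>UNIV. momentum D k \<bullet> D (axis k 1))"

definition dx :: "'n \<Rightarrow> (real ^ 'n) \<times> (real ^ 'm) \<Rightarrow> real" where
  "dx k w = fst w $ k"

definition cartan_form :: "real \<Rightarrow> ('n \<Rightarrow> real ^ 'm) \<Rightarrow>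
    ((('n::{finite,linorder}) rvec) \<times> (real ^ 'm)) list \<Rightarrow> real" where
  "cartan_form h \<pi> vs = h * det_form dx vs + (\<Sum>k\<in>UNIV. det_form (dx(k := \<lambda>w. \<pi> k \<bullet> snd w)) vs)"

lemma adapted_frame_area:
  fixes z :: "'n::finite \<Rightarrow> real ^ 'n"
  assumes "linear D" "adapted_frame D z"
  shows "0 < det (gmat D)" "\<bar>det (\<chi> k j. z j $ k)\<bar> * area D = 1"
proof -
  let ?d = "det (\<chi> k j. z j $ k)"
  have 1: "?d\<^sup>2 * det (gmat D) = 1" by (rule adapted_frame_inverse(3)[OF assms])
  thus pos: "0 < det (gmat D)" by (metis zero_le_power2 zero_less_mult_pos zero_less_one mult_zero_left order_le_less)
  have "(\<bar>?d\<bar> * area D)\<^sup>2 = 1" using 1 pos by (simp add: area_def power_mult_distrib)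
  moreover have "0 \<le> \<bar>?d\<bar> * area D" using pos by (simp add: area_def)
  ultimately show "\<bar>?d\<bar> * area D = 1" by (metis power2_eq_1_iff abs_of_nonneg abs_minus_cancel abs_one)
qed

text \<open>In the variable s = 1 + t, row i is (G z_i, 0) + s J e_i. The matrix \<open>B\<close> of
  the vectors G z_i factors out of both parts and leaves the rows dx_l + s \<gamma>_l, with the
  constant det B = \<open>area D\<close> in front. Value plus derivative at s = 0 is then computed
  by expanding the \<gamma>_l.\<close>

lemma Theta_eq_cartan_form:
  fixes F :: "('n::{finite,linorder}) rvec \<Rightarrow> real ^ 'm::finite"
  assumes dif: "F differentiable (at x)" and vs: "length vs = CARD('n)"
  defines "D \<equiv> frechet_derivative F (at x)"
  shows "Theta F (x, y) vs = cartan_form (energy D) (momentum D) vs"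
proof -
  have D: "linear D" unfolding D_def using dif by (rule linear_frechet_derivative)
  obtain z :: "'n \<Rightarrow> 'n rvec" where z: "adapted_frame (frechet_derivative F (at x)) z"
    "length (tangent_onb F x) = CARD('n)"
    "\<And>j. tangent_onb F x ! idx j = (z j, frechet_derivative F (at x) (z j))"
    "0 < det (\<chi> k j. z j $ k)"
    by (rule tangent_onb_frame[OF dif]) (rule that)
  note zD = z(1)[folded D_def]
  define C where "C = matrix_inv (gmat D)"
  define P where "P k = (\<Sum>j\<in>UNIV. (C $ k $ j) *\<^sub>R D (axis j 1))" for k
  have P: "P k \<bullet> u = (\<Sum>j\<in>UNIV. z j $ k * (D (z j) \<bullet> u))" for k u
  proof -
    have "P k = (\<Sum>l\<in>UNIV. \<Sum>j\<in>UNIV. (z j $ k * z j $ l) *\<^sub>R D (axis l 1))"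
      unfolding P_def C_def adapted_frame_inverse(1)[OF D zD, symmetric] by (simp add: scaleR_sum_left)
    also have "\<dots> = (\<Sum>j\<in>UNIV. \<Sum>l\<in>UNIV. (z j $ k * z j $ l) *\<^sub>R D (axis l 1))" by (rule sum.swap)
    also have "\<dots> = (\<Sum>j\<in>UNIV. z j $ k *\<^sub>R D (z j))"
      by (subst (2) linear_axis_expansion[OF D]) (simp add: scaleR_sum_right)
    finally show ?thesis by (simp add: inner_sum_left)
  qed
  \<comment> \<open>The contact form dy - D dx paired with \<open>P k\<close>; it vanishes on the
    tangent space.\<close>
  define \<gamma> where "\<gamma> k w = P k \<bullet> (snd w - D (fst w))" for k and w :: "'n rvec \<times> (real ^ 'm)"
  define B where "B = (\<chi> i l. G_op D (z i) $ l)"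
  have detB: "det B = area D"
  proof -
    have "B = transpose (gmat D ** (\<chi> k j. z j $ k))"
      by (simp add: B_def vec_eq_iff transpose_def gmat_mult[OF D, symmetric] matrix_matrix_mult_def matrix_vector_mult_def)
    hence "det B = det (gmat D) * det (\<chi> k j. z j $ k)" by (simp add: det_mul)
    also have "\<dots> = area D * (\<bar>det (\<chi> k j. z j $ k)\<bar> * area D)"
      using adapted_frame_area(1)[OF D zD] z(4) by (simp add: area_def)
    finally show ?thesis using adapted_frame_area(2)[OF D zD] by simp
  qed
  define q where "q = det_form (vol_poly D z) vs"
  define p where "p = det_form (\<lambda>l w. [:dx l w, \<gamma> l w:]) vs"
  \<comment> \<open>In the slope, \<open>B\<close> contracts with the frame expansion of
    \<open>P\<close> to the numbers G z_i . z_j, which are 0 or 1 by the frame condition, so that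
    only the term with \<open>D (z i)\<close> survives.\<close>
  have rows: "[:G_op D (z i) \<bullet> fst w, (- adjoint D (D (z i)), D (z i)) \<bullet> w:] =
      (\<Sum>l\<in>UNIV. (\<chi> i l. [:B $ i $ l:]) $ i $ l * [:dx l w, \<gamma> l w:])" for i and w :: "'n rvec \<times> (real ^ 'm)"
  proof -
    have sum_pCons: "(\<Sum>l\<in>S. [:f l, g l:]) = [:\<Sum>l\<in>S. f l, \<Sum>l\<in>S. g l:]" for S :: "'n set" and f g :: "'n \<Rightarrow> real"
      by (induction S rule: infinite_finite_induct) auto
    have "(\<Sum>l\<in>UNIV. B $ i $ l * \<gamma> l w) = (\<Sum>j\<in>UNIV. (G_op D (z i) \<bullet> z j) * (D (z j) \<bullet> (snd w - D (fst w))))"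
      unfolding \<gamma>_def P sum_distrib_left inner_vec_def[of "G_op D (z i)"] sum_distrib_right
      by (subst sum.swap) (simp add: B_def mult_ac)
    also have "\<dots> = (\<Sum>j\<in>UNIV. if i = j then D (z j) \<bullet> (snd w - D (fst w)) else 0)"
      using zD by (intro sum.cong) (auto simp: inner_G_op[OF D] adapted_frame_def)
    also have "\<dots> = (- adjoint D (D (z i)), D (z i)) \<bullet> w"
      by (cases w) (simp add: inner_diff_right adjoint_clauses[OF D])
    finally show ?thesis
      by (simp add: sum_pCons) (simp add: B_def dx_def inner_vec_def mult.commute)
  qed
  have shift: "poly q (-1) = det_form (\<lambda>i w. G_op D (z i) \<bullet> fst w) vs"
    unfolding q_def poly_det_form
    by (rule arg_cong[where f="\<lambda>\<beta>. det_form \<beta> vs"])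
      (auto simp: fun_eq_iff vol_poly_def G_op_def inner_add_left)
  have shift': "poly (pderiv q) (-1) = (\<Sum>k\<in>UNIV. det_form ((\<lambda>i w. G_op D (z i) \<bullet> fst w)
      (k := \<lambda>w. (- adjoint D (D (z k)), D (z k)) \<bullet> w)) vs)"
    unfolding q_def pderiv_det_form_rows poly_sum poly_det_form
    by (intro sum.cong arg_cong[where f="\<lambda>\<beta>. det_form \<beta> vs"] refl)
      (auto simp: fun_eq_iff vol_poly_def G_op_def inner_add_left pderiv_pCons)
  \<comment> \<open>This is \<open>q\<close> in the shifted variable; only the value and the first
    derivative at the new origin are compared.\<close>
  define q' where "q' = det_form (\<lambda>i w. [:G_op D (z i) \<bullet> fst w, (- adjoint D (D (z i)), D (z i)) \<bullet> w:]) vs"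
  have low: "poly (det_form (\<lambda>i w. [:a i w, b i w:]) vs) 0 = det_form a vs"
    "poly (pderiv (det_form (\<lambda>i w. [:a i w, b i w:]) vs)) 0 = (\<Sum>k\<in>UNIV. det_form (a(k := b k)) vs)"
    for a b :: "'n \<Rightarrow> 'n rvec \<times> (real ^ 'm) \<Rightarrow> real"
    unfolding pderiv_det_form_rows poly_sum poly_det_form
    by (auto intro!: sum.cong arg_cong[where f="\<lambda>\<beta>. det_form \<beta> vs"] simp: fun_eq_iff pderiv_pCons)
  have "q' = det (\<chi> i l. [:B $ i $ l:]) * p"
    unfolding q'_def rows p_def by (rule det_form_rows_mult)
  also have "det (\<chi> i l. [:B $ i $ l:]) = [:det B:]"
  proof -
    obtain us :: "'n list" where "\<And>j::'n. us ! idx j = j" using ex_list_idx[of "\<lambda>j. j"] by blast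
    thus ?thesis using det_form_const[of "\<lambda>i l. B $ i $ l" us] by (simp add: det_form_def)
  qed
  finally have q': "q' = smult (area D) p" by (simp add: detB)
  have "Theta F (x, y) vs = poly q (-1) + poly (pderiv q) (-1)"
    unfolding q_def D_def by (rule Theta_eq_poly[OF dif z(1-3) vs])
  also have "\<dots> = poly q' 0 + poly (pderiv q') 0"
    unfolding q'_def low shift shift' ..
  also have "\<dots> = area D * (poly p 0 + poly (pderiv p) 0)"
    using q' by (simp add: pderiv_smult algebra_simps)
  also have "\<dots> = area D * (det_form dx vs + (\<Sum>k\<in>UNIV. det_form (dx(k := \<gamma> k)) vs))"
    unfolding p_def low by simp
  also have "(\<Sum>k\<in>UNIV. det_form (dx(k := \<gamma> k)) vs) =
      (\<Sum>k\<in>UNIV. det_form (dx(k := \<lambda>w. P k \<bullet> snd w)) vs - (P k \<bullet> D (axis k 1)) * det_form dx vs)"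
  proof (rule sum.cong)
    fix k :: 'n
    \<comment> \<open>Of the horizontal part of \<open>\<gamma> k\<close> only the multiple of
      \<open>dx k\<close> counts in slot \<open>k\<close>, since any other \<open>dx l\<close>
      repeats a row. Its coefficient is what \<open>energy\<close> subtracts from the area.\<close>
    have "\<gamma> k = (\<lambda>w. P k \<bullet> snd w + (\<Sum>l\<in>UNIV. (- (P k \<bullet> D (axis l 1))) * dx l w))"
    proof
      fix w :: "'n rvec \<times> (real ^ 'm)"
      have "P k \<bullet> D (fst w) = (\<Sum>l\<in>UNIV. dx l w * (P k \<bullet> D (axis l 1)))"
        by (subst linear_axis_expansion[OF D]) (simp add: inner_sum_right dx_def)
      thus "\<gamma> k w = P k \<bullet> snd w + (\<Sum>l\<in>UNIV. (- (P k \<bullet> D (axis l 1))) * dx l w)"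
        by (simp add: \<gamma>_def inner_diff_right sum_negf mult.commute)
    qed
    moreover have "(\<Sum>l\<in>UNIV. (- (P k \<bullet> D (axis l 1))) * det_form (dx(k := dx l)) vs) =
        (\<Sum>l\<in>UNIV. if l = k then (- (P k \<bullet> D (axis k 1))) * det_form dx vs else 0)"
    proof (rule sum.cong)
      fix l
      have "det_form (dx(k := dx l)) vs = 0" if "l \<noteq> k"
        using that by (intro det_form_row_eq[of l k]) auto
      thus "(- (P k \<bullet> D (axis l 1))) * det_form (dx(k := dx l)) vs =
          (if l = k then (- (P k \<bullet> D (axis k 1))) * det_form dx vs else 0)"
        by (cases "l = k") (simp_all only: fun_upd_triv if_True if_False mult_zero_right refl simp_thms)
    qed simp
    ultimately show "det_form (dx(k := \<gamma> k)) vs =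
        det_form (dx(k := \<lambda>w. P k \<bullet> snd w)) vs - (P k \<bullet> D (axis k 1)) * det_form dx vs"
      by (simp only: det_form_row_add det_form_row_sum[OF finite]) simp
  qed simp
  also have "area D * (det_form dx vs + \<dots>) = cartan_form (energy D) (momentum D) vs"
  proof -
    have m: "momentum D k = area D *\<^sub>R P k" for k by (simp add: momentum_def P_def C_def)
    have "det_form (dx(k := \<lambda>w. momentum D k \<bullet> snd w)) vs =
        area D * det_form (dx(k := \<lambda>w. P k \<bullet> snd w)) vs" for k
      unfolding m inner_scaleR_left by (rule det_form_row_scale)
    thus ?thesis
      by (simp add: cartan_form_def energy_def m sum_subtractf algebra_simps sum_distrib_left sum_distrib_right)
  qed
  finally show ?thesis .
qed

section \<open>Calculus of smooth maps\<close>

text \<open>\<open>frechet_derivative f (at x)\<close> looks at \<open>f\<close> near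
  \<open>x\<close>; agreement on \<open>U\<close> passes to derivatives because \<open>U\<close> is
  open.\<close>

lemma Ck_on_cong:
  assumes "open U"
  shows "(\<And>x. x \<in> U \<Longrightarrow> f x = g x) \<Longrightarrow> Ck_on k f U \<Longrightarrow> Ck_on k g U"
proof (induction k arbitrary: f g)
  case 0
  thus ?case by (simp cong: continuous_on_cong)
next
  case (Suc k)
  have d: "(g has_derivative frechet_derivative f (at x)) (at x)" if "x \<in> U" for x
  proof -
    have "(f has_derivative frechet_derivative f (at x)) (at x)"
      using Suc.prems(2) that by (simp add: frechet_derivative_works)
    thus ?thesis using Suc.prems(1) that assms by (intro has_derivative_transform_within_open[of f _ x _ U g]) auto
  qed
  have "Ck_on k (\<lambda>x. frechet_derivative g (at x) v) U" for v
  proof (rule Suc.IH)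
    show "Ck_on k (\<lambda>x. frechet_derivative f (at x) v) U" using Suc.prems(2) by simp
    show "frechet_derivative f (at x) v = frechet_derivative g (at x) v" if "x \<in> U" for x
      using frechet_derivative_at[OF d[OF that]] by simp
  qed
  thus ?case using d by (auto simp: differentiable_def)
qed

lemma Ck_on_SucI:
  assumes "open U" "\<And>x. x \<in> U \<Longrightarrow> (f has_derivative f' x) (at x)" "\<And>v. Ck_on k (\<lambda>x. f' x v) U"
  shows "Ck_on (Suc k) f U"
proof -
  have "Ck_on k (\<lambda>x. frechet_derivative f (at x) v) U" for v
    by (rule Ck_on_cong[OF assms(1) _ assms(3)[of v]])
      (simp add: frechet_derivative_at[OF assms(2), symmetric])
  thus ?thesis using assms(2) by (auto simp: differentiable_def)
qed

lemma Ck_on_SucD: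
  assumes "Ck_on (Suc k) f U"
  shows "x \<in> U \<Longrightarrow> (f has_derivative frechet_derivative f (at x)) (at x)"
    and "Ck_on k (\<lambda>x. frechet_derivative f (at x) v) U"
  using assms by (simp_all add: frechet_derivative_works)

lemma Ck_on_Suc_imp: "Ck_on (Suc k) f U \<Longrightarrow> Ck_on k f U"
proof (induction k arbitrary: f)
  case 0
  thus ?case by (auto intro!: continuous_at_imp_continuous_on differentiable_imp_continuous_within)
next
  case (Suc k)
  thus ?case using Suc.prems by (auto simp del: Ck_on.simps(2) simp: Ck_on.simps(2)[of "Suc k"] intro!: Ck_on.simps(2)[of k, THEN iffD2])
qed

lemma Ck_on_const: "Ck_on k (\<lambda>_. c) U"
  by (induction k arbitrary: c) (simp_all add: frechet_derivative_const)

lemma Ck_on_bounded_linear: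
  assumes "open U" "bounded_linear h"
  shows "Ck_on k f U \<Longrightarrow> Ck_on k (\<lambda>x. h (f x)) U"
proof (induction k arbitrary: f)
  case 0
  thus ?case using assms(2) by (simp add: bounded_linear.continuous_on)
next
  case (Suc k)
  show ?case
    by (rule Ck_on_SucI[OF assms(1) bounded_linear.has_derivative[OF assms(2) Ck_on_SucD(1)[OF Suc.prems]]
      Suc.IH[OF Ck_on_SucD(2)[OF Suc.prems]]])
qed

lemma Ck_on_add:
  assumes "open U"
  shows "Ck_on k f U \<Longrightarrow> Ck_on k g U \<Longrightarrow> Ck_on k (\<lambda>x. f x + g x) U"
proof (induction k arbitrary: f g)
  case 0
  thus ?case by (simp add: continuous_on_add)
next
  case (Suc k)
  show ?case
    by (rule Ck_on_SucI[OF assms has_derivative_add[OF Ck_on_SucD(1)[OF Suc.prems(1)] Ck_on_SucD(1)[OF Suc.prems(2)]]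
      Suc.IH[OF Ck_on_SucD(2)[OF Suc.prems(1)] Ck_on_SucD(2)[OF Suc.prems(2)]]])
qed

text \<open>In each term of the product rule one factor stays undifferentiated and is lowered by
  \<open>Ck_on_Suc_imp\<close>; the induction therefore keeps both factors arbitrary. One proof
  covers products, scalings and inner products.\<close>

lemma Ck_on_bilinear:
  assumes "open U" "bounded_bilinear bop"
  shows "Ck_on k f U \<Longrightarrow> Ck_on k g U \<Longrightarrow> Ck_on k (\<lambda>x. bop (f x) (g x)) U"
proof (induction k arbitrary: f g)
  case 0
  thus ?case using assms(2) by (simp add: bounded_bilinear.continuous_on)
next
  case (Suc k)
  show ?case
  proof (rule Ck_on_SucI[OF assms(1)])
    show "((\<lambda>x. bop (f x) (g x)) has_derivative (\<lambda>v. bop (f x) (frechet_derivative g (at x) v) +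
        bop (frechet_derivative f (at x) v) (g x))) (at x)" if "x \<in> U" for x
      by (rule bounded_bilinear.FDERIV[OF assms(2) Ck_on_SucD(1)[OF Suc.prems(1) that] Ck_on_SucD(1)[OF Suc.prems(2) that]])
    show "Ck_on k (\<lambda>x. bop (f x) (frechet_derivative g (at x) v) +
        bop (frechet_derivative f (at x) v) (g x)) U" for v
      by (rule Ck_on_add[OF assms(1) Suc.IH[OF Ck_on_Suc_imp[OF Suc.prems(1)] Ck_on_SucD(2)[OF Suc.prems(2)]]
        Suc.IH[OF Ck_on_SucD(2)[OF Suc.prems(1)] Ck_on_Suc_imp[OF Suc.prems(2)]]])
  qed
qed

lemmas Ck_on_mult = Ck_on_bilinear[OF _ bounded_bilinear_mult]

text \<open>The derivative is a product in which the same reciprocal occurs again, and the induction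
  hypothesis supplies its smoothness one order lower. \<open>Ck_on_sqrt\<close> rests on the same
  bootstrap.\<close>

lemma Ck_on_inverse:
  fixes f :: "'a::euclidean_space \<Rightarrow> real"
  assumes "open U" and nz: "\<And>x. x \<in> U \<Longrightarrow> f x \<noteq> 0"
  shows "Ck_on k f U \<Longrightarrow> Ck_on k (\<lambda>x. inverse (f x)) U"
proof (induction k)
  case 0
  thus ?case using nz by (simp add: continuous_on_inverse)
next
  case (Suc k)
  show ?case
  proof (rule Ck_on_SucI[OF assms(1)])
    show "((\<lambda>x. inverse (f x)) has_derivative
        (\<lambda>v. (-1) * ((inverse (f x) * frechet_derivative f (at x) v) * inverse (f x)))) (at x)" if "x \<in> U" for x
      using Deriv.has_derivative_inverse[OF nz[OF that] Ck_on_SucD(1)[OF Suc.prems that]] by simp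
    show "Ck_on k (\<lambda>x. (-1) * ((inverse (f x) * frechet_derivative f (at x) v) * inverse (f x))) U" for v
      by (intro Ck_on_mult assms(1) Ck_on_const Suc.IH Ck_on_SucD(2)[OF Suc.prems] Ck_on_Suc_imp[OF Suc.prems])
  qed
qed

lemma Ck_on_sqrt:
  fixes f :: "'a::euclidean_space \<Rightarrow> real"
  assumes "open U" and pos: "\<And>x. x \<in> U \<Longrightarrow> 0 < f x"
  shows "Ck_on k f U \<Longrightarrow> Ck_on k (\<lambda>x. sqrt (f x)) U"
proof (induction k)
  case 0
  thus ?case by (simp add: continuous_on_real_sqrt)
next
  case (Suc k)
  show ?case
  proof (rule Ck_on_SucI[OF assms(1)])
    show "((\<lambda>x. sqrt (f x)) has_derivative
        (\<lambda>v. frechet_derivative f (at x) v * (inverse (sqrt (f x)) * (1/2)))) (at x)" if "x \<in> U" for x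
      by (rule has_derivative_eq_rhs[OF has_derivative_real_sqrt[OF pos[OF that] Ck_on_SucD(1)[OF Suc.prems that]]])
        (simp add: fun_eq_iff divide_simps)
    have "sqrt (f x) \<noteq> 0" if "x \<in> U" for x using pos[OF that] by simp
    thus "Ck_on k (\<lambda>x. frechet_derivative f (at x) v * (inverse (sqrt (f x)) * (1/2))) U" for v
      by (intro Ck_on_mult Ck_on_inverse assms(1) Ck_on_const Suc.IH Ck_on_SucD(2)[OF Suc.prems] Ck_on_Suc_imp[OF Suc.prems])
  qed
qed

text \<open>Regularity of the extension by parallel transport along the second factor.\<close>

lemma Ck_on_comp_fst:
  fixes f :: "'a::euclidean_space \<Rightarrow> 'c::euclidean_space"
  assumes "open U"
  shows "Ck_on k f U \<Longrightarrow> Ck_on k (\<lambda>p. f (fst (p :: 'a \<times> 'b::euclidean_space))) (U \<times> UNIV)"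
proof (induction k arbitrary: f)
  case 0
  have "continuous_on (U \<times> (UNIV :: 'b set)) (\<lambda>p. f (fst p))"
    by (rule continuous_on_compose2[of U f]) (use 0 in \<open>auto intro!: continuous_intros\<close>)
  thus ?case by simp
next
  case (Suc k)
  show ?case
  proof (rule Ck_on_SucI)
    show "open (U \<times> (UNIV :: 'b set))" using assms by (simp add: open_Times)
    show "((\<lambda>p. f (fst p)) has_derivative (\<lambda>v. frechet_derivative f (at (fst p)) (fst v))) (at p)"
      if "p \<in> U \<times> UNIV" for p :: "'a \<times> 'b"
    proof -
      have "(f has_derivative frechet_derivative f (at (fst p))) (at (fst p))"
        using Ck_on_SucD(1)[OF Suc.prems] that by auto
      from has_derivative_compose[OF has_derivative_fst[OF has_derivative_ident] this]
      show ?thesis by simp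
    qed
    show "Ck_on k (\<lambda>p :: 'a \<times> 'b. frechet_derivative f (at (fst p)) (fst v)) (U \<times> UNIV)" for v :: "'a \<times> 'b"
      by (rule Suc.IH[OF Ck_on_SucD(2)[OF Suc.prems]])
  qed
qed

lemma smooth_on_differentiable: "smooth_on f U \<Longrightarrow> x \<in> U \<Longrightarrow> f differentiable (at x)"
  unfolding smooth_on_def by (metis Ck_on.simps(2))

lemma smooth_on_has_derivative:
  "smooth_on f U \<Longrightarrow> x \<in> U \<Longrightarrow> (f has_derivative frechet_derivative f (at x)) (at x)"
  using smooth_on_differentiable frechet_derivative_works by blast

lemma smooth_on_frechet_derivative: "smooth_on f U \<Longrightarrow> smooth_on (\<lambda>x. frechet_derivative f (at x) v) U"
  unfolding smooth_on_def by (metis Ck_on.simps(2))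

lemma smooth_on_cong: "open U \<Longrightarrow> (\<And>x. x \<in> U \<Longrightarrow> f x = g x) \<Longrightarrow> smooth_on f U \<Longrightarrow> smooth_on g U"
  unfolding smooth_on_def by (metis Ck_on_cong)

lemma smooth_on_const: "smooth_on (\<lambda>_. c) U"
  by (simp add: smooth_on_def Ck_on_const)

lemma smooth_on_add: "open U \<Longrightarrow> smooth_on f U \<Longrightarrow> smooth_on g U \<Longrightarrow> smooth_on (\<lambda>x. f x + g x) U"
  by (simp add: smooth_on_def Ck_on_add)

lemma smooth_on_bounded_linear:
  "open U \<Longrightarrow> bounded_linear h \<Longrightarrow> smooth_on f U \<Longrightarrow> smooth_on (\<lambda>x. h (f x)) U"
  by (simp add: smooth_on_def Ck_on_bounded_linear)

lemma smooth_on_mult: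
  fixes f g :: "'a::euclidean_space \<Rightarrow> real"
  shows "open U \<Longrightarrow> smooth_on f U \<Longrightarrow> smooth_on g U \<Longrightarrow> smooth_on (\<lambda>x. f x * g x) U"
  by (simp add: smooth_on_def Ck_on_mult)

lemma smooth_on_scaleR:
  "open U \<Longrightarrow> smooth_on f U \<Longrightarrow> smooth_on g U \<Longrightarrow> smooth_on (\<lambda>x. f x *\<^sub>R g x) U"
  by (simp add: smooth_on_def Ck_on_bilinear[OF _ bounded_bilinear_scaleR])

lemma smooth_on_inner:
  "open U \<Longrightarrow> smooth_on f U \<Longrightarrow> smooth_on g U \<Longrightarrow> smooth_on (\<lambda>x. f x \<bullet> g x) U"
  by (simp add: smooth_on_def Ck_on_bilinear[OF _ bounded_bilinear_inner])

lemma smooth_on_diff: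
  fixes f g :: "'a::euclidean_space \<Rightarrow> real"
  assumes "open U" "smooth_on f U" "smooth_on g U"
  shows "smooth_on (\<lambda>x. f x - g x) U"
  using smooth_on_add[OF assms(1,2) smooth_on_mult[OF assms(1) smooth_on_const[of "-1"] assms(3)]] by simp

lemma smooth_on_inverse:
  fixes f :: "'a::euclidean_space \<Rightarrow> real"
  shows "open U \<Longrightarrow> (\<And>x. x \<in> U \<Longrightarrow> f x \<noteq> 0) \<Longrightarrow> smooth_on f U \<Longrightarrow> smooth_on (\<lambda>x. inverse (f x)) U"
  by (simp add: smooth_on_def Ck_on_inverse)

lemma smooth_on_sqrt:
  fixes f :: "'a::euclidean_space \<Rightarrow> real"
  shows "open U \<Longrightarrow> (\<And>x. x \<in> U \<Longrightarrow> 0 < f x) \<Longrightarrow> smooth_on f U \<Longrightarrow> smooth_on (\<lambda>x. sqrt (f x)) U"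
  by (simp add: smooth_on_def Ck_on_sqrt)

lemma smooth_on_comp_fst:
  "open U \<Longrightarrow> smooth_on f U \<Longrightarrow> smooth_on (\<lambda>p. f (fst p)) (U \<times> UNIV)"
  by (simp add: smooth_on_def Ck_on_comp_fst)

lemma smooth_on_sum:
  "open U \<Longrightarrow> (\<And>i. i \<in> I \<Longrightarrow> smooth_on (f i) U) \<Longrightarrow> smooth_on (\<lambda>x. \<Sum>i\<in>I. f i x) U"
  by (induction I rule: infinite_finite_induct) (simp_all add: smooth_on_const smooth_on_add)

lemma smooth_on_prod:
  fixes f :: "'i \<Rightarrow> 'a::euclidean_space \<Rightarrow> real"
  shows "open U \<Longrightarrow> (\<And>i. i \<in> I \<Longrightarrow> smooth_on (f i) U) \<Longrightarrow> smooth_on (\<lambda>x. \<Prod>i\<in>I. f i x) U"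
  by (induction I rule: infinite_finite_induct) (simp_all add: smooth_on_const smooth_on_mult)

lemma smooth_on_det:
  fixes A :: "'a::euclidean_space \<Rightarrow> real ^ 'n ^ 'n"
  assumes "open U" "\<And>i j. smooth_on (\<lambda>x. A x $ i $ j) U"
  shows "smooth_on (\<lambda>x. det (A x)) U"
  unfolding det_def by (intro smooth_on_sum smooth_on_mult smooth_on_const smooth_on_prod assms)

section \<open>Smoothness of the coefficients\<close>

lemma gmat_nth:
  fixes D :: "real ^ 'n \<Rightarrow> real ^ 'm"
  assumes "linear D"
  shows "gmat D $ i $ j = (if i = j then 1 else 0) + D (axis i 1) \<bullet> D (axis j 1)"
proof -
  have "gmat D $ i $ j = G_op D (axis j 1) \<bullet> axis i 1"
    by (simp add: gmat_def matrix_def inner_axis)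
  thus ?thesis using inner_G_op[OF assms, of "axis j 1" "axis i 1"]
    by (simp add: inner_axis_axis inner_commute)
qed

lemma gmat_det_pos:
  fixes D :: "real ^ 'n::finite \<Rightarrow> real ^ 'm"
  assumes "linear D"
  shows "0 < det (gmat D)" "gmat D ** matrix_inv (gmat D) = mat 1"
proof -
  obtain z where z: "adapted_frame D z"
    by (rule adapted_eigenframe[OF assms]) (rule that)
  show "0 < det (gmat D)" "gmat D ** matrix_inv (gmat D) = mat 1"
    using adapted_frame_area(1)[OF assms z] adapted_frame_inverse(2)[OF assms z] .
qed

text \<open>Only determinants and one reciprocal occur on the right, so smoothness of the inverse
  metric follows from that of the metric.\<close>

lemma matrix_inv_cramer:
  fixes A :: "real ^ 'n ^ 'n"
  assumes "A ** matrix_inv A = mat 1" "det A \<noteq> 0"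
  shows "matrix_inv A $ k $ j = det (\<chi> a b. if b = k then axis j 1 $ a else A $ a $ b) * inverse (det A)"
proof -
  have "A *v column j (matrix_inv A) = axis j 1"
    using assms(1) by (metis matrix_vector_mul_assoc matrix_vector_mul_lid matrix_vector_mult_basis)
  hence "column j (matrix_inv A) = (\<chi> k. det (\<chi> a b. if b = k then axis j 1 $ a else A $ a $ b) / det A)"
    by (simp only: cramer[OF assms(2)])
  thus ?thesis by (simp add: vec_eq_iff column_def divide_inverse)
qed

context
  fixes \<Omega> :: "(real ^ 'n::finite) set" and F :: "real ^ 'n::finite \<Rightarrow> real ^ 'm::finite"
  assumes \<Omega>: "open \<Omega>" and F: "smooth_on F \<Omega>"
begin

lemma linear_dF: "x \<in> \<Omega> \<Longrightarrow> linear (frechet_derivative F (at x))"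
  by (rule linear_frechet_derivative[OF smooth_on_differentiable[OF F]])

lemma smooth_on_gmat: "smooth_on (\<lambda>x. gmat (frechet_derivative F (at x)) $ i $ j) \<Omega>"
proof (rule smooth_on_cong[OF \<Omega>])
  show "smooth_on (\<lambda>x. (if i = j then 1 else 0) +
      frechet_derivative F (at x) (axis i 1) \<bullet> frechet_derivative F (at x) (axis j 1)) \<Omega>"
    by (intro smooth_on_add smooth_on_const smooth_on_inner smooth_on_frechet_derivative F \<Omega>)
qed (simp add: gmat_nth linear_dF)

lemma smooth_on_area: "smooth_on (\<lambda>x. area (frechet_derivative F (at x))) \<Omega>"
  unfolding area_def
  by (intro smooth_on_sqrt smooth_on_det smooth_on_gmat \<Omega> gmat_det_pos linear_dF)

lemma smooth_on_ginv: "smooth_on (\<lambda>x. matrix_inv (gmat (frechet_derivative F (at x))) $ k $ j) \<Omega>"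
proof (rule smooth_on_cong[OF \<Omega>])
  let ?G = "\<lambda>x. gmat (frechet_derivative F (at x))"
  have nz: "det (?G x) \<noteq> 0" if "x \<in> \<Omega>" for x using gmat_det_pos(1)[OF linear_dF[OF that]] by simp
  have "smooth_on (\<lambda>x. (\<chi> a b. if b = k then axis j 1 $ a else ?G x $ a $ b) $ a $ b) \<Omega>" for a b
    by (cases "b = k") (simp_all add: smooth_on_const smooth_on_gmat)
  thus "smooth_on (\<lambda>x. det (\<chi> a b. if b = k then axis j 1 $ a else ?G x $ a $ b) * inverse (det (?G x))) \<Omega>"
    by (intro smooth_on_mult smooth_on_det smooth_on_inverse smooth_on_gmat \<Omega> nz)
  show "det (\<chi> a b. if b = k then axis j 1 $ a else ?G x $ a $ b) * inverse (det (?G x)) =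
      matrix_inv (?G x) $ k $ j" if "x \<in> \<Omega>" for x
    using matrix_inv_cramer[OF gmat_det_pos(2)[OF linear_dF[OF that]] nz[OF that]] by simp
qed

lemma smooth_on_momentum: "smooth_on (\<lambda>x. momentum (frechet_derivative F (at x)) k) \<Omega>"
  unfolding momentum_def
  by (intro smooth_on_scaleR smooth_on_area smooth_on_sum smooth_on_ginv smooth_on_frechet_derivative F \<Omega>)

lemma smooth_on_energy: "smooth_on (\<lambda>x. energy (frechet_derivative F (at x))) \<Omega>"
  unfolding energy_def
  by (intro smooth_on_diff smooth_on_area smooth_on_sum smooth_on_inner smooth_on_momentum
    smooth_on_frechet_derivative F \<Omega>)

end

section \<open>Symmetry of second derivatives\<close>

text \<open>The mean value theorem twice: in the direction \<open>u\<close> for the increment of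
  \<open>f\<close> along \<open>h v\<close>, then in the direction \<open>v\<close> for the
  directional derivative. The second difference on the left is symmetric in \<open>u\<close> and
  \<open>v\<close>.\<close>

lemma second_difference:
  fixes f :: "'a::euclidean_space \<Rightarrow> real"
  assumes d1: "\<And>y. y \<in> U \<Longrightarrow> f differentiable (at y)"
    and d2: "\<And>y. y \<in> U \<Longrightarrow> (\<lambda>y. frechet_derivative f (at y) u) differentiable (at y)"
    and h: "0 < h" and U: "\<And>s t. 0 \<le> s \<Longrightarrow> s \<le> h \<Longrightarrow> 0 \<le> t \<Longrightarrow> t \<le> h \<Longrightarrow> x + s *\<^sub>R u + t *\<^sub>R v \<in> U"
  shows "\<exists>s t. 0 \<le> s \<and> s \<le> h \<and> 0 \<le> t \<and> t \<le> h \<and>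
    f (x + h *\<^sub>R u + h *\<^sub>R v) - f (x + h *\<^sub>R u) - f (x + h *\<^sub>R v) + f x =
    h * (h * frechet_derivative (\<lambda>y. frechet_derivative f (at y) u) (at (x + s *\<^sub>R u + t *\<^sub>R v)) v)"
proof -
  let ?d = "\<lambda>y. frechet_derivative f (at y) u"
  have D1: "((\<lambda>s. f (x + s *\<^sub>R u + t *\<^sub>R v)) has_real_derivative ?d (x + s *\<^sub>R u + t *\<^sub>R v)) (at s)"
    if "0 \<le> s" "s \<le> h" "0 \<le> t" "t \<le> h" for s t
  proof -
    let ?y = "x + s *\<^sub>R u + t *\<^sub>R v"
    have f: "(f has_derivative frechet_derivative f (at ?y)) (at ?y)"
      using d1[OF U[OF that]] frechet_derivative_works by blast
    have "((\<lambda>s. x + s *\<^sub>R u + t *\<^sub>R v) has_derivative (\<lambda>r. r *\<^sub>R u)) (at s)"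
      by (auto intro!: derivative_eq_intros)
    from has_derivative_compose[OF this f]
    moreover have "(\<lambda>r. frechet_derivative f (at ?y) (r *\<^sub>R u)) = (*) (?d ?y)"
      by (simp add: fun_eq_iff linear_scale[OF linear_frechet_derivative[OF d1[OF U[OF that]]]])
    ultimately show ?thesis by (simp add: has_field_derivative_def)
  qed
  have D2: "((\<lambda>t. ?d (x + s *\<^sub>R u + t *\<^sub>R v)) has_real_derivative
      frechet_derivative ?d (at (x + s *\<^sub>R u + t *\<^sub>R v)) v) (at t)"
    if "0 \<le> s" "s \<le> h" "0 \<le> t" "t \<le> h" for s t
  proof -
    let ?y = "x + s *\<^sub>R u + t *\<^sub>R v"
    have f: "(?d has_derivative frechet_derivative ?d (at ?y)) (at ?y)"
      using d2[OF U[OF that]] frechet_derivative_works by blast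
    have "((\<lambda>t. x + s *\<^sub>R u + t *\<^sub>R v) has_derivative (\<lambda>r. r *\<^sub>R v)) (at t)"
      by (auto intro!: derivative_eq_intros)
    from has_derivative_compose[OF this f]
    moreover have "(\<lambda>r. frechet_derivative ?d (at ?y) (r *\<^sub>R v)) = (*) (frechet_derivative ?d (at ?y) v)"
      by (simp add: fun_eq_iff linear_scale[OF linear_frechet_derivative[OF d2[OF U[OF that]]]])
    ultimately show ?thesis by (simp add: has_field_derivative_def)
  qed
  let ?g = "\<lambda>s. f (x + s *\<^sub>R u + h *\<^sub>R v) - f (x + s *\<^sub>R u + 0 *\<^sub>R v)"
  have "(?g has_real_derivative ?d (x + s *\<^sub>R u + h *\<^sub>R v) - ?d (x + s *\<^sub>R u + 0 *\<^sub>R v)) (at s)"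
    if "0 \<le> s" "s \<le> h" for s
    using h that by (intro DERIV_diff D1) auto
  from MVT2[OF h this] obtain s where s: "0 < s" "s < h"
    "?g h - ?g 0 = (h - 0) * (?d (x + s *\<^sub>R u + h *\<^sub>R v) - ?d (x + s *\<^sub>R u + 0 *\<^sub>R v))" by auto
  from MVT2[OF h D2[of s]] s(1,2) obtain t where t: "0 < t" "t < h"
    "?d (x + s *\<^sub>R u + h *\<^sub>R v) - ?d (x + s *\<^sub>R u + 0 *\<^sub>R v) =
      (h - 0) * frechet_derivative ?d (at (x + s *\<^sub>R u + t *\<^sub>R v)) v" by auto
  show ?thesis using s t by (intro exI[of _ s] exI[of _ t]) simp
qed

text \<open>Both iterated derivatives, each at some point near \<open>x\<close>, equal the same
  second difference divided by h^2; continuity moves these points to \<open>x\<close>.\<close>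

lemma mixed_derivatives_eq_real:
  fixes f :: "'a::euclidean_space \<Rightarrow> real"
  assumes U: "open U" and x: "x \<in> U" and f: "smooth_on f U"
  shows "frechet_derivative (\<lambda>y. frechet_derivative f (at y) u) (at x) v =
    frechet_derivative (\<lambda>y. frechet_derivative f (at y) v) (at x) u"
proof -
  let ?A = "\<lambda>u v y. frechet_derivative (\<lambda>y. frechet_derivative f (at y) u) (at y) v"
  have cont: "isCont (?A u v) x" for u v
    using smooth_on_differentiable[OF smooth_on_frechet_derivative[OF smooth_on_frechet_derivative[OF f]] x]
    by (rule differentiable_imp_continuous_within)
  have "\<bar>?A u v x - ?A v u x\<bar> < 2 * e" if e: "e > 0" for e
  proof -
    have "\<forall>\<^sub>F y in nhds x. y \<in> U \<and> \<bar>?A u v y - ?A u v x\<bar> < e \<and> \<bar>?A v u y - ?A v u x\<bar> < e"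
    proof (intro eventually_conj)
      show "\<forall>\<^sub>F y in nhds x. y \<in> U" using U x by (rule eventually_nhds_in_open)
      have ev: "\<forall>\<^sub>F y in nhds x. \<bar>?A u v y - ?A u v x\<bar> < e" for u v
      proof -
        have "(?A u v \<longlongrightarrow> ?A u v x) (nhds x)"
          using cont[of u v] unfolding isCont_def
          by (rule tendsto_at_iff_tendsto_nhds[of "?A u v", THEN iffD1])
        from tendstoD[OF this e] show ?thesis by (simp only: dist_real_def)
      qed
      show "\<forall>\<^sub>F y in nhds x. \<bar>?A u v y - ?A u v x\<bar> < e" by (rule ev)
      show "\<forall>\<^sub>F y in nhds x. \<bar>?A v u y - ?A v u x\<bar> < e" by (rule ev)
    qed
    then obtain d where d: "d > 0" "\<And>y. dist y x < d \<Longrightarrow> y \<in> U \<and> \<bar>?A u v y - ?A u v x\<bar> < e \<and> \<bar>?A v u y - ?A v u x\<bar> < e"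
      by (auto simp: eventually_nhds_metric)
    \<comment> \<open>Small enough for the parallelogram spanned by \<open>h u\<close> and
      \<open>h v\<close> at \<open>x\<close> to stay in the ball of radius \<open>d\<close>; the 1
      keeps the denominator positive when both vectors vanish.\<close>
    define h where "h = d / (2 * (norm u + norm v + 1))"
    have n: "norm u + norm v + 1 > 0" by (simp add: add_nonneg_pos)
    have h: "h > 0" using d n by (simp add: h_def)
    have near: "dist (x + s *\<^sub>R a + t *\<^sub>R b) x < d"
      if "0 \<le> s" "s \<le> h" "0 \<le> t" "t \<le> h" "norm a + norm b = norm u + norm v" for s t and a b :: 'a
    proof -
      have "dist (x + s *\<^sub>R a + t *\<^sub>R b) x = norm (s *\<^sub>R a + t *\<^sub>R b)" by (simp add: dist_norm add.assoc)
      also have "\<dots> \<le> s * norm a + t * norm b"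
        using norm_triangle_ineq[of "s *\<^sub>R a" "t *\<^sub>R b"] that by simp
      also have "\<dots> \<le> h * norm a + h * norm b" using that by (intro add_mono mult_right_mono) auto
      also have "\<dots> = h * (norm u + norm v)" using that by (simp flip: distrib_left)
      also have "\<dots> \<le> h * (norm u + norm v + 1)" using h by simp
      also have "\<dots> = d / 2"
      proof -
        define N where "N = norm u + norm v + 1"
        have "N \<noteq> 0" using n by (simp add: N_def)
        thus ?thesis unfolding h_def N_def[symmetric] by simp
      qed
      finally show ?thesis using d by simp
    qed
    have d1: "f differentiable (at y)" if "y \<in> U" for y using smooth_on_differentiable[OF f that] .
    have d2: "(\<lambda>y. frechet_derivative f (at y) w) differentiable (at y)" if "y \<in> U" for y w
      using smooth_on_differentiable[OF smooth_on_frechet_derivative[OF f] that] .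
    obtain s t where 1: "0 \<le> s" "s \<le> h" "0 \<le> t" "t \<le> h"
      "f (x + h *\<^sub>R u + h *\<^sub>R v) - f (x + h *\<^sub>R u) - f (x + h *\<^sub>R v) + f x = h * (h * ?A u v (x + s *\<^sub>R u + t *\<^sub>R v))"
      using second_difference[OF d1 d2 h, of U x u v] near d(2) by blast
    obtain s' t' where 2: "0 \<le> s'" "s' \<le> h" "0 \<le> t'" "t' \<le> h"
      "f (x + h *\<^sub>R v + h *\<^sub>R u) - f (x + h *\<^sub>R v) - f (x + h *\<^sub>R u) + f x = h * (h * ?A v u (x + s' *\<^sub>R v + t' *\<^sub>R u))"
      using second_difference[OF d1 d2 h, of U x v u] near d(2) by (metis add.commute)
    have "h * (h * ?A u v (x + s *\<^sub>R u + t *\<^sub>R v)) = h * (h * ?A v u (x + s' *\<^sub>R v + t' *\<^sub>R u))"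
    proof -
      have eq: "x + h *\<^sub>R v + h *\<^sub>R u = x + h *\<^sub>R u + h *\<^sub>R v" by simp
      show ?thesis unfolding 1(5)[symmetric] 2(5)[symmetric] eq by simp
    qed
    hence "?A u v (x + s *\<^sub>R u + t *\<^sub>R v) = ?A v u (x + s' *\<^sub>R v + t' *\<^sub>R u)" using h by simp
    moreover have "\<bar>?A u v (x + s *\<^sub>R u + t *\<^sub>R v) - ?A u v x\<bar> < e"
      using d(2) near[OF 1(1-4)] by blast
    moreover have "\<bar>?A v u (x + s' *\<^sub>R v + t' *\<^sub>R u) - ?A v u x\<bar> < e"
      using d(2) near[OF 2(1-4), of v u] by (simp add: add.commute)
    ultimately show ?thesis by linarith
  qed
  from this[of "\<bar>?A u v x - ?A v u x\<bar> / 2"] show ?thesis by (cases "?A u v x = ?A v u x") auto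
qed

lemma mixed_derivatives_eq:
  fixes f :: "'a::euclidean_space \<Rightarrow> 'b::euclidean_space"
  assumes U: "open U" and x: "x \<in> U" and f: "smooth_on f U"
  shows "frechet_derivative (\<lambda>y. frechet_derivative f (at y) u) (at x) v =
    frechet_derivative (\<lambda>y. frechet_derivative f (at y) v) (at x) u"
proof (rule euclidean_eqI)
  fix b :: 'b
  have bl: "bounded_linear (\<lambda>w. w \<bullet> b)" by (rule bounded_linear_inner_left)
  have g: "smooth_on (\<lambda>y. f y \<bullet> b) U" using smooth_on_bounded_linear[OF U bl f] .
  have d: "frechet_derivative (\<lambda>y. f y \<bullet> b) (at y) w = frechet_derivative f (at y) w \<bullet> b" if "y \<in> U" for y w
    using fun_cong[OF frechet_derivative_at[OF bounded_linear.has_derivative[OF bl smooth_on_has_derivative[OF f that]]], of w]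
    by simp
  have "frechet_derivative (\<lambda>y. frechet_derivative (\<lambda>y. f y \<bullet> b) (at y) w) (at x) w' =
      frechet_derivative (\<lambda>y. frechet_derivative f (at y) w) (at x) w' \<bullet> b" for w w'
  proof -
    have "((\<lambda>y. frechet_derivative f (at y) w \<bullet> b) has_derivative
        (\<lambda>w'. frechet_derivative (\<lambda>y. frechet_derivative f (at y) w) (at x) w' \<bullet> b)) (at x)"
      by (rule bounded_linear.has_derivative[OF bl smooth_on_has_derivative[OF smooth_on_frechet_derivative[OF f] x]])
    hence "((\<lambda>y. frechet_derivative (\<lambda>y. f y \<bullet> b) (at y) w) has_derivative
        (\<lambda>w'. frechet_derivative (\<lambda>y. frechet_derivative f (at y) w) (at x) w' \<bullet> b)) (at x)"
      by (rule has_derivative_transform_within_open[OF _ U x]) (simp add: d)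
    from fun_cong[OF frechet_derivative_at[OF this], of w'] show ?thesis by simp
  qed
  thus "frechet_derivative (\<lambda>y. frechet_derivative f (at y) u) (at x) v \<bullet> b =
      frechet_derivative (\<lambda>y. frechet_derivative f (at y) v) (at x) u \<bullet> b"
    using mixed_derivatives_eq_real[OF U x g, of u v] by simp
qed

section \<open>Perturbing singular matrices\<close>

lemma tendsto_det:
  fixes A :: "'b \<Rightarrow> real ^ 'n ^ 'n"
  assumes "\<And>i j. ((\<lambda>t. A t $ i $ j) \<longlongrightarrow> B $ i $ j) F"
  shows "((\<lambda>t. det (A t)) \<longlongrightarrow> det B) F"
  unfolding det_def by (intro tendsto_sum tendsto_mult tendsto_const tendsto_prod assms)

text \<open>The determinant is a polynomial in \<open>t\<close>. It is not the zero polynomial,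
  since \<open>A + t\<close> is injective once \<open>t\<close> exceeds a bound for the norm of
  \<open>A\<close>; having finitely many roots, it is nonzero in a punctured neighbourhood of
  0.\<close>

lemma eventually_det_nonzero:
  fixes A :: "real ^ 'n ^ 'n"
  shows "\<forall>\<^sub>F t in at 0. det (A + t *\<^sub>R mat 1) \<noteq> 0"
proof -
  define q where "q = det (\<chi> i j. [:A $ i $ j, if i = j then 1 else 0:])"
  have q: "poly q t = det (A + t *\<^sub>R mat 1)" for t
    unfolding q_def poly_det by (intro arg_cong[where f=det]) (auto simp: vec_eq_iff mat_def)
  obtain b where b: "\<And>v. norm (A *v v) \<le> norm v * b"
    using bounded_linear.bounded[OF matrix_vector_mul_bounded_linear[of A]] by blast
  define t where "t = \<bar>b\<bar> + 1"
  have "v = 0" if "(A + t *\<^sub>R mat 1) *v v = 0" for v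
  proof (rule ccontr)
    assume "v \<noteq> 0"
    have "t *\<^sub>R v = - (A *v v)"
      using that by (simp add: matrix_vector_mult_add_rdistrib scaleR_matrix_vector_assoc[symmetric] eq_neg_iff_add_eq_0 add.commute)
    hence "\<bar>t\<bar> * norm v = norm (A *v v)" by (metis norm_minus_cancel norm_scaleR)
    hence "\<bar>t\<bar> * norm v \<le> norm v * b" using b by simp
    hence "\<bar>t\<bar> \<le> b" using \<open>v \<noteq> 0\<close> by (simp add: mult.commute)
    thus False by (simp add: t_def)
  qed
  hence "invertible (A + t *\<^sub>R mat 1)"
    using matrix_left_invertible_ker invertible_left_inverse by blast
  hence "poly q t \<noteq> 0" by (simp add: q invertible_det_nz)
  hence "q \<noteq> 0" by auto
  hence fin: "finite {t. poly q t = 0}" by (rule poly_roots_finite)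
  have "open (- ({t. poly q t = 0} - {0}))" using fin by (intro open_Compl finite_imp_closed) auto
  hence "\<forall>\<^sub>F t in at 0. t \<in> - ({t. poly q t = 0} - {0})"
    by (rule eventually_at_in_open'[THEN eventually_mono]) auto
  moreover have "\<forall>\<^sub>F t in at (0::real). t \<noteq> 0" by (simp add: eventually_at_filter)
  ultimately show ?thesis
    by eventually_elim (auto simp: q)
qed

section \<open>The comass inequality\<close>

text \<open>With N = A^2 + a^2, N times the right side minus the left side is N (a t + A s + t s)^2
  + (1 - N) (a t - A s)^2, and N <= 1 makes the second weight nonnegative. The left side is again a
  factor, with parameters sqrt N and (A t + a s) / sqrt N.\<close>

lemma quadratic_merge:
  fixes A a t s :: real
  assumes le: "A\<^sup>2 + a\<^sup>2 \<le> 1" and N: "A\<^sup>2 + a\<^sup>2 > 0"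
  shows "1 + 2 * (A * t + a * s) + (A * t + a * s)\<^sup>2 / (A\<^sup>2 + a\<^sup>2)
    \<le> (1 + 2 * (A * t) + t\<^sup>2) * (1 + 2 * (a * s) + s\<^sup>2)"
proof -
  define N where "N = A\<^sup>2 + a\<^sup>2"
  have "0 \<le> N * (a * t + A * s + t * s)\<^sup>2 + (1 - N) * (a * t - A * s)\<^sup>2"
    using le N by (simp add: N_def)
  also have "\<dots> = N * ((1 + 2 * (A * t) + t\<^sup>2) * (1 + 2 * (a * s) + s\<^sup>2) - 1 - 2 * (A * t + a * s)) - (A * t + a * s)\<^sup>2"
    unfolding N_def by (simp add: power2_eq_square) algebra
  finally have "(A * t + a * s)\<^sup>2 \<le> ((1 + 2 * (A * t) + t\<^sup>2) * (1 + 2 * (a * s) + s\<^sup>2) - 1 - 2 * (A * t + a * s)) * N"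
    by (simp add: mult.commute)
  hence "(A * t + a * s)\<^sup>2 / N \<le> (1 + 2 * (A * t) + t\<^sup>2) * (1 + 2 * (a * s) + s\<^sup>2) - 1 - 2 * (A * t + a * s)"
    using N by (simp add: divide_le_eq N_def)
  thus ?thesis by (simp add: N_def)
qed

text \<open>With \<open>b = a + s\<close> a factor is \<open>1 + 2 a s + s\<^sup>2\<close>. Merging adds the \<open>a\<^sup>2\<close> and the \<open>a s\<close>.\<close>

lemma prod_ge_merged:
  fixes a b :: "'i \<Rightarrow> real"
  assumes "finite S" "(\<Sum>j\<in>S. (a j)\<^sup>2) \<le> 1"
  shows "\<exists>A t. A\<^sup>2 = (\<Sum>j\<in>S. (a j)\<^sup>2) \<and> A * t = (\<Sum>j\<in>S. a j * (b j - a j)) \<and>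
    1 + 2 * (A * t) + t\<^sup>2 \<le> (\<Prod>j\<in>S. 1 - (a j)\<^sup>2 + (b j)\<^sup>2)"
  using assms
proof (induction S rule: finite_induct)
  case empty
  show ?case by (intro exI[of _ 0]) simp
next
  case (insert i S)
  define s where "s = b i - a i"
  have "(a i)\<^sup>2 + (\<Sum>j\<in>S. (a j)\<^sup>2) \<le> 1" using insert by simp
  hence "(\<Sum>j\<in>S. (a j)\<^sup>2) \<le> 1" using zero_le_power2[of "a i"] by linarith
  then obtain A t where IH: "A\<^sup>2 = (\<Sum>j\<in>S. (a j)\<^sup>2)" "A * t = (\<Sum>j\<in>S. a j * (b j - a j))"
    "1 + 2 * (A * t) + t\<^sup>2 \<le> (\<Prod>j\<in>S. 1 - (a j)\<^sup>2 + (b j)\<^sup>2)"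
    using insert.IH by blast
  define N where "N = A\<^sup>2 + (a i)\<^sup>2"
  have N: "N \<le> 1" "N = (\<Sum>j\<in>insert i S. (a j)\<^sup>2)" using insert IH by (simp_all add: N_def)
  have f: "1 - (a i)\<^sup>2 + (b i)\<^sup>2 = 1 + 2 * (a i * s) + s\<^sup>2"
    by (simp add: s_def power2_eq_square algebra_simps)
  \<comment> \<open>Nonnegativity of a factor, which permits multiplying the inequality for
    \<open>S\<close> by the new factor.\<close>
  have sq: "0 \<le> 1 + 2 * (x * y) + y\<^sup>2" if "x\<^sup>2 \<le> 1" for x y :: real
  proof -
    have "1 + 2 * (x * y) + y\<^sup>2 = (1 - x\<^sup>2) + (x + y)\<^sup>2"
      by (simp add: power2_eq_square algebra_simps)
    thus ?thesis using that zero_le_power2[of "x + y"] by linarith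
  qed
  have "0 \<le> 1 + 2 * (a i * s) + s\<^sup>2"
    using N(1) zero_le_power2[of A] unfolding N_def by (intro sq) linarith
  hence "(1 + 2 * (A * t) + t\<^sup>2) * (1 + 2 * (a i * s) + s\<^sup>2)
      \<le> (\<Prod>j\<in>S. 1 - (a j)\<^sup>2 + (b j)\<^sup>2) * (1 - (a i)\<^sup>2 + (b i)\<^sup>2)"
    unfolding f using IH(3) by (intro mult_right_mono)
  hence P: "(1 + 2 * (A * t) + t\<^sup>2) * (1 + 2 * (a i * s) + s\<^sup>2) \<le> (\<Prod>j\<in>insert i S. 1 - (a j)\<^sup>2 + (b j)\<^sup>2)"
    unfolding prod.insert[OF insert(1,2)] by (simp only: mult.commute)
  have U: "A * t + a i * s = (\<Sum>j\<in>insert i S. a j * (b j - a j))"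
    using insert IH(2) by (simp add: s_def)
  show ?case
  proof (cases "N = 0")
    \<comment> \<open>No quotient by \<open>N\<close> is available here, but then the two factors
      are 1 + t^2 and 1 + s^2, and the merged factor can be taken with both parameters 0.\<close>
    case True
    hence z: "A = 0" "a i = 0" by (simp_all add: N_def sum_power2_eq_zero_iff)
    have "1 * 1 \<le> (1 + t\<^sup>2) * (1 + s\<^sup>2)" by (intro mult_mono) auto
    hence "1 \<le> (\<Prod>j\<in>insert i S. 1 - (a j)\<^sup>2 + (b j)\<^sup>2)" using P z by simp
    moreover have "(\<Sum>j\<in>insert i S. a j * (b j - a j)) = 0" using U z by simp
    ultimately show ?thesis using N(2) True
      by (intro exI[of _ 0]) (simp only: mult_zero_left power_zero_numeral add_0_right mult_zero_right simp_thms)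
  next
    case False
    hence pos: "N > 0" using sum_power2_ge_zero[of A "a i"] unfolding N_def by linarith
    have "1 + 2 * (A * t + a i * s) + (A * t + a i * s)\<^sup>2 / N \<le> (\<Prod>j\<in>insert i S. 1 - (a j)\<^sup>2 + (b j)\<^sup>2)"
      using quadratic_merge[of A "a i" t s] P N(1) pos by (simp add: N_def)
    moreover have "sqrt N * ((A * t + a i * s) / sqrt N) = A * t + a i * s"
      "((A * t + a i * s) / sqrt N)\<^sup>2 = (A * t + a i * s)\<^sup>2 / N" "(sqrt N)\<^sup>2 = N"
      using pos by (simp_all add: power_divide)
    ultimately show ?thesis using N(2) U
      by (intro exI[of _ "sqrt N"] exI[of _ "(A * t + a i * s) / sqrt N"]) (simp only: simp_thms)
  qed
qed

text \<open>After merging, a single factor 1 + 2 A t + t^2 remains, and A^2 <= 1 makes it at least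
  (1 + A t)^2.\<close>

lemma prod_ge_square:
  fixes a b :: "'i \<Rightarrow> real"
  assumes "finite S" "(\<Sum>j\<in>S. (a j)\<^sup>2) \<le> 1"
  shows "(1 - (\<Sum>j\<in>S. (a j)\<^sup>2) + (\<Sum>j\<in>S. a j * b j))\<^sup>2 \<le> (\<Prod>j\<in>S. 1 - (a j)\<^sup>2 + (b j)\<^sup>2)"
proof -
  obtain A t where A: "A\<^sup>2 = (\<Sum>j\<in>S. (a j)\<^sup>2)" "A * t = (\<Sum>j\<in>S. a j * (b j - a j))"
    "1 + 2 * (A * t) + t\<^sup>2 \<le> (\<Prod>j\<in>S. 1 - (a j)\<^sup>2 + (b j)\<^sup>2)"
    using prod_ge_merged[OF assms] by blast
  have "(\<Sum>j\<in>S. a j * (b j - a j)) = (\<Sum>j\<in>S. a j * b j) - (\<Sum>j\<in>S. (a j)\<^sup>2)"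
    by (simp add: right_diff_distrib sum_subtractf power2_eq_square)
  hence eq: "1 - (\<Sum>j\<in>S. (a j)\<^sup>2) + (\<Sum>j\<in>S. a j * b j) = 1 + A * t" using A(2) by simp
  have "(1 + A * t)\<^sup>2 \<le> 1 + 2 * (A * t) + t\<^sup>2"
  proof -
    have "A\<^sup>2 * t\<^sup>2 \<le> 1 * t\<^sup>2" using A(1) assms(2) by (intro mult_right_mono) auto
    thus ?thesis by (simp add: power2_eq_square algebra_simps)
  qed
  thus ?thesis unfolding eq using A(3) by linarith
qed

text \<open>In the basis \<open>z0\<close> the graph metric of \<open>D\<close> is the identity and
  that of \<open>P\<close> is a symmetric matrix \<open>M\<close>. An orthogonal change of basis to
  eigenvectors of \<open>M\<close> preserves the first and diagonalises the second.\<close>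

lemma adapted_frame_diagonalize:
  fixes D P :: "real ^ 'n \<Rightarrow> real ^ 'm"
  assumes D: "linear D" and P: "linear P" and z0: "adapted_frame D z0"
  obtains z :: "'n \<Rightarrow> real ^ 'n" where "adapted_frame D z"
    "\<And>i j. i \<noteq> j \<Longrightarrow> z i \<bullet> z j + P (z i) \<bullet> P (z j) = 0"
proof -
  define M where "M = (\<chi> i j. z0 i \<bullet> G_op P (z0 j))"
  have sym: "z0 i \<bullet> G_op P (z0 j) = z0 j \<bullet> G_op P (z0 i)" for i j
    using inner_G_op[OF P, of "z0 j" "z0 i"] inner_G_op[OF P, of "z0 i" "z0 j"] by (simp add: inner_commute)
  have "transpose M = M" by (simp add: M_def vec_eq_iff transpose_def sym)
  hence sa: "(M *v x) \<bullet> y = x \<bullet> (M *v y)" for x y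
    using dot_lmul_matrix[of x M y] by (simp add: vector_matrix_mul_rid matrix_vector_mul_assoc inner_commute flip: transpose_matrix_vector)
  obtain f :: "'n \<Rightarrow> real ^ 'n" and \<kappa> where f: "\<And>i j. f i \<bullet> f j = (if i = j then 1 else 0)"
    "\<And>i. M *v f i = \<kappa> i *\<^sub>R f i" "span (range f) = UNIV"
    by (rule selfadjoint_eigenframe[of "(*v) M", OF matrix_vector_mul_linear sa]) (rule that)
  define z where "z i = (\<Sum>a\<in>UNIV. f i $ a *\<^sub>R z0 a)" for i
  have bil: "z i \<bullet> z j + E (z i) \<bullet> E (z j) = f i \<bullet> ((\<chi> a b. z0 a \<bullet> G_op E (z0 b)) *v f j)"
    if E: "linear E" for E :: "real ^ 'n \<Rightarrow> real ^ 'm" and i j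
  proof -
    have "z i \<bullet> z j + E (z i) \<bullet> E (z j) = z i \<bullet> G_op E (z j)"
      using inner_G_op[OF E, of "z j" "z i"] by (simp add: inner_commute)
    also have "\<dots> = (\<Sum>a\<in>UNIV. \<Sum>b\<in>UNIV. f i $ a * (f j $ b * (z0 a \<bullet> G_op E (z0 b))))"
      unfolding z_def linear_sum[OF linear_G_op[OF E]] linear_scale[OF linear_G_op[OF E]]
      by (simp add: inner_sum_left inner_sum_right sum_distrib_left)
        (subst sum.swap, simp add: mult.left_commute)
    finally show ?thesis
      by (simp add: inner_vec_def[of "f i"] matrix_vector_mult_def sum_distrib_left mult_ac)
  qed
  have "(\<chi> a b. z0 a \<bullet> G_op D (z0 b)) = mat 1"
    using z0 inner_G_op[OF D] by (auto simp: vec_eq_iff mat_def adapted_frame_def inner_commute)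
  hence "adapted_frame D z" unfolding adapted_frame_def bil[OF D] by (simp add: f(1))
  moreover have "z i \<bullet> z j + P (z i) \<bullet> P (z j) = 0" if "i \<noteq> j" for i j
    unfolding bil[OF P] M_def[symmetric] using that by (simp add: f(1,2))
  ultimately show thesis by (rule that)
qed

lemma momentum_adapted_frame:
  assumes D: "linear D" and z: "adapted_frame D z"
  shows "momentum D k = area D *\<^sub>R (\<Sum>j\<in>UNIV. z j $ k *\<^sub>R D (z j))"
proof -
  have "(\<Sum>l\<in>UNIV. matrix_inv (gmat D) $ k $ l *\<^sub>R D (axis l 1)) =
      (\<Sum>l\<in>UNIV. \<Sum>j\<in>UNIV. (z j $ k * z j $ l) *\<^sub>R D (axis l 1))"
    by (simp add: adapted_frame_inverse(1)[OF assms, symmetric] scaleR_sum_left)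
  also have "\<dots> = (\<Sum>j\<in>UNIV. \<Sum>l\<in>UNIV. (z j $ k * z j $ l) *\<^sub>R D (axis l 1))" by (rule sum.swap)
  also have "\<dots> = (\<Sum>j\<in>UNIV. z j $ k *\<^sub>R D (z j))"
    by (subst (2) linear_axis_expansion[OF D]) (simp add: scaleR_sum_right)
  finally show ?thesis by (simp add: momentum_def)
qed

text \<open>The first variation of area at \<open>D\<close> in the direction \<open>E\<close>; the
  coordinate trace passes to an adapted frame because Z Z^T is the inverse metric.\<close>

lemma momentum_trace:
  fixes D E :: "real ^ 'n \<Rightarrow> real ^ 'm"
  assumes D: "linear D" and z: "adapted_frame D z" and E: "linear E"
  shows "(\<Sum>k\<in>UNIV. momentum D k \<bullet> E (axis k 1)) = area D * (\<Sum>j\<in>UNIV. D (z j) \<bullet> E (z j))"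
proof -
  have "(\<Sum>k\<in>UNIV. (\<Sum>j\<in>UNIV. z j $ k *\<^sub>R D (z j)) \<bullet> E (axis k 1)) =
      (\<Sum>j\<in>UNIV. \<Sum>k\<in>UNIV. z j $ k * (D (z j) \<bullet> E (axis k 1)))"
    by (subst sum.swap) (simp add: inner_sum_left)
  also have "\<dots> = (\<Sum>j\<in>UNIV. D (z j) \<bullet> E (z j))"
  proof (rule sum.cong)
    fix j show "(\<Sum>k\<in>UNIV. z j $ k * (D (z j) \<bullet> E (axis k 1))) = D (z j) \<bullet> E (z j)"
      using linear_axis_expansion[OF E, of "z j"] by (simp add: inner_sum_right)
  qed simp
  finally show ?thesis
    by (simp add: momentum_adapted_frame[OF D z] flip: sum_distrib_left)
qed

text \<open>The area integrand \<open>sqrt (det (gmat P))\<close> dominates the absolute value of its first order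
  Taylor polynomial at \<open>D\<close>: this is the comass inequality on planes that are graphs.\<close>

lemma area_tangent_plane:
  fixes D P :: "real ^ 'n::finite \<Rightarrow> real ^ 'm"
  assumes D: "linear D" and P: "linear P"
    and le: "\<And>z. adapted_frame D z \<Longrightarrow> (\<Sum>j\<in>UNIV. D (z j) \<bullet> D (z j)) \<le> 1"
  shows "(energy D + (\<Sum>k\<in>UNIV. momentum D k \<bullet> P (axis k 1)))\<^sup>2 \<le> det (gmat P)"
proof -
  obtain z0 where z0: "adapted_frame D z0"
    by (rule adapted_eigenframe[OF D]) (rule that)
  obtain z where z: "adapted_frame D z"
    and off: "\<And>i j. i \<noteq> j \<Longrightarrow> z i \<bullet> z j + P (z i) \<bullet> P (z j) = 0"
    by (rule adapted_frame_diagonalize[OF D P z0]) (rule that)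
  define q where "q j = norm (D (z j))" for j
  define k where "k j = norm (P (z j))" for j
  define m where "m j = z j \<bullet> z j + P (z j) \<bullet> P (z j)" for j
  have m: "m j = 1 - (q j)\<^sup>2 + (k j)\<^sup>2" for j
  proof -
    have "z j \<bullet> z j + D (z j) \<bullet> D (z j) = 1" using z by (simp add: adapted_frame_def)
    thus ?thesis by (simp add: m_def q_def k_def power2_norm_eq_inner)
  qed
  let ?Z = "(\<chi> k j. z j $ k)"
  have "transpose ?Z ** (gmat P ** ?Z) = (\<chi> i j. if i = j then m i else 0)"
    unfolding transpose_frame_mult gmat_mult[OF P]
    using off inner_G_op[OF P] by (auto simp: vec_eq_iff m_def inner_commute)
  hence "det (transpose ?Z ** (gmat P ** ?Z)) = (\<Prod>j\<in>UNIV. m j)"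
    by (simp add: det_diagonal)
  hence 1: "(det ?Z)\<^sup>2 * det (gmat P) = (\<Prod>j\<in>UNIV. m j)"
    by (simp add: det_mul power2_eq_square mult_ac)
  have 2: "(det ?Z)\<^sup>2 * (area D)\<^sup>2 = 1"
    using adapted_frame_area(2)[OF D z] by (metis power2_abs power_mult_distrib power_one)
  have q: "(\<Sum>j\<in>UNIV. (q j)\<^sup>2) \<le> 1" using le[OF z] by (simp add: q_def power2_norm_eq_inner)
  \<comment> \<open>Since 1 minus the sum of the \<open>(q j)\<^sup>2\<close> is nonnegative,
    Cauchy-Schwarz bounds the expression from both sides, as squaring requires.\<close>
  have "\<bar>1 - (\<Sum>j\<in>UNIV. (q j)\<^sup>2) + (\<Sum>j\<in>UNIV. D (z j) \<bullet> P (z j))\<bar> \<le>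
      1 - (\<Sum>j\<in>UNIV. (q j)\<^sup>2) + (\<Sum>j\<in>UNIV. q j * k j)"
  proof -
    have "\<bar>\<Sum>j\<in>UNIV. D (z j) \<bullet> P (z j)\<bar> \<le> (\<Sum>j\<in>UNIV. q j * k j)"
      unfolding q_def k_def by (rule order_trans[OF sum_abs]) (intro sum_mono Cauchy_Schwarz_ineq2)
    thus ?thesis using q by linarith
  qed
  hence "(1 - (\<Sum>j\<in>UNIV. (q j)\<^sup>2) + (\<Sum>j\<in>UNIV. D (z j) \<bullet> P (z j)))\<^sup>2 \<le>
      (1 - (\<Sum>j\<in>UNIV. (q j)\<^sup>2) + (\<Sum>j\<in>UNIV. q j * k j))\<^sup>2"
    by (rule abs_le_square_iff[THEN iffD1, OF order_trans]) simp
  also have "\<dots> \<le> (\<Prod>j\<in>UNIV. m j)" unfolding m by (rule prod_ge_square[OF finite q])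
  finally have 3: "(1 - (\<Sum>j\<in>UNIV. (q j)\<^sup>2) + (\<Sum>j\<in>UNIV. D (z j) \<bullet> P (z j)))\<^sup>2 \<le> (\<Prod>j\<in>UNIV. m j)" .
  have "energy D + (\<Sum>k\<in>UNIV. momentum D k \<bullet> P (axis k 1)) =
      area D * (1 - (\<Sum>j\<in>UNIV. (q j)\<^sup>2) + (\<Sum>j\<in>UNIV. D (z j) \<bullet> P (z j)))"
    unfolding energy_def momentum_trace[OF D z D] momentum_trace[OF D z P]
    by (simp add: q_def power2_norm_eq_inner algebra_simps)
  hence "(energy D + (\<Sum>k\<in>UNIV. momentum D k \<bullet> P (axis k 1)))\<^sup>2 \<le> (area D)\<^sup>2 * (\<Prod>j\<in>UNIV. m j)"
    using 3 by (simp add: power_mult_distrib mult_left_mono)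
  also have "\<dots> = ((det ?Z)\<^sup>2 * (area D)\<^sup>2) * det (gmat P)" using 1 by (simp add: mult_ac)
  also have "\<dots> = det (gmat P)" using 2 by simp
  finally show ?thesis .
qed

section \<open>The comass on planes that need not be graphs\<close>

lemma det_row_combination:
  fixes X :: "real ^ 'n ^ 'n"
  shows "det (\<chi> i j. if i = k then \<Sum>l\<in>UNIV. c l * X $ l $ j else X $ i $ j) = c k * det X"
proof -
  have "(\<chi> i j. if i = k then \<Sum>l\<in>UNIV. c l * X $ l $ j else X $ i $ j) =
      (\<chi> i. if i = k then \<Sum>l\<in>UNIV. c l *s X $ l else X $ i)"
    by (auto simp: vec_eq_iff)
  also have "det \<dots> = (\<Sum>l\<in>UNIV. det (\<chi> i. if i = k then c l *s X $ l else X $ i))"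
    by (rule det_linear_row_sum) simp
  also have "\<dots> = (\<Sum>l\<in>UNIV. c l * det (\<chi> i. if i = k then X $ l else X $ i))"
    by (simp only: det_row_mul)
  also have "\<dots> = (\<Sum>l\<in>UNIV. if l = k then c k * det X else 0)"
  proof (rule sum.cong)
    fix l
    have "det (\<chi> i. if i = k then X $ l else X $ i) = 0" if "l \<noteq> k"
      using that by (intro det_identical_rows[of l k]) (auto simp: row_def)
    moreover have "(\<chi> i. if i = k then X $ k else X $ i) = X" by (auto simp: vec_eq_iff)
    ultimately show "c l * det (\<chi> i. if i = k then X $ l else X $ i) = (if l = k then c k * det X else 0)"
      by auto
  qed simp
  finally show ?thesis by simp
qed

text \<open>The pairs of column j of \<open>X\<close> with \<open>Y j\<close> span the plane. If
  \<open>X\<close> is invertible, the plane is the graph of P = Y X^{-1}, both sides acquire the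
  factor (det X)^2, and \<open>area_tangent_plane\<close> applies. Both sides are continuous in
  \<open>X\<close>, so a singular \<open>X\<close> is reached by letting t tend to 0 in X + t with
  \<open>Y\<close> fixed.\<close>

lemma cartan_gram_bound:
  fixes D :: "real ^ 'n::finite \<Rightarrow> real ^ 'm" and X :: "real ^ 'n ^ 'n" and Y :: "'n \<Rightarrow> real ^ 'm"
  assumes D: "linear D"
    and le: "\<And>z. adapted_frame D z \<Longrightarrow> (\<Sum>j\<in>UNIV. D (z j) \<bullet> D (z j)) \<le> 1"
  defines "K \<equiv> \<lambda>X. energy D * det X + (\<Sum>k\<in>UNIV. det (\<chi> i j. if i = k then momentum D k \<bullet> Y j else X $ i $ j))"
  shows "(K X)\<^sup>2 \<le> det (\<chi> i j. (\<Sum>k\<in>UNIV. X $ k $ i * X $ k $ j) + Y i \<bullet> Y j)" (is "_ \<le> ?\<Gamma> X")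
proof -
  have inv: "(K X)\<^sup>2 \<le> ?\<Gamma> X" if "det X \<noteq> 0" for X
  proof -
    have "invertible X" using that by (simp add: invertible_det_nz)
    then obtain B where B: "B ** X = mat 1" by (auto simp: invertible_left_inverse)
    define P where "P v = (\<Sum>j\<in>UNIV. (B *v v) $ j *\<^sub>R Y j)" for v
    have P: "linear P" unfolding P_def
      by (intro linearI) (simp_all add: matrix_vector_right_distrib scaleR_add_left sum.distrib
        matrix_vector_mult_scaleR scaleR_sum_right)
    have PX: "P (column j X) = Y j" for j
    proof -
      have "B *v column j X = axis j 1"
        using B by (metis matrix_vector_mul_assoc matrix_vector_mul_lid matrix_vector_mult_basis)
      thus ?thesis by (simp add: P_def axis_def if_distrib[where f="\<lambda>c. c *\<^sub>R _"] cong: if_cong)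
    qed
    \<comment> \<open>Row \<open>k\<close> becomes a combination of the rows of \<open>X\<close>,
      and its determinant keeps only the coefficient of row \<open>k\<close> itself. The sum over
      \<open>k\<close> thus turns into a trace.\<close>
    have mom: "momentum D k \<bullet> Y j = (\<Sum>l\<in>UNIV. (momentum D k \<bullet> P (axis l 1)) * X $ l $ j)" for k j
      by (subst PX[symmetric], subst linear_axis_expansion[OF P]) (simp add: inner_sum_right column_def mult.commute)
    have "K X = energy D * det X + (\<Sum>k\<in>UNIV. (momentum D k \<bullet> P (axis k 1)) * det X)"
      unfolding K_def mom det_row_combination ..
    hence "K X = det X * (energy D + (\<Sum>k\<in>UNIV. momentum D k \<bullet> P (axis k 1)))"
      by (simp add: distrib_left sum_distrib_left mult.commute)
    hence "(K X)\<^sup>2 \<le> (det X)\<^sup>2 * det (gmat P)"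
      using area_tangent_plane[OF D P le] by (simp add: power_mult_distrib mult_left_mono)
    also have "\<dots> = det (transpose X ** (gmat P ** X))"
      by (simp add: det_mul power2_eq_square mult_ac)
    also have "transpose X ** (gmat P ** X) = (\<chi> i j. (\<Sum>k\<in>UNIV. X $ k $ i * X $ k $ j) + Y i \<bullet> Y j)"
    proof -
      have "X = (\<chi> k j. column j X $ k)" by (simp add: vec_eq_iff column_def)
      hence "transpose X ** (gmat P ** X) = (\<chi> i j. column i X \<bullet> (gmat P *v column j X))"
        using transpose_frame_mult[of "\<lambda>j. column j X" "gmat P"] by simp
      moreover have "column i X \<bullet> (gmat P *v column j X) = (\<Sum>k\<in>UNIV. X $ k $ i * X $ k $ j) + Y i \<bullet> Y j" for i j
      proof -
        have "column i X \<bullet> (gmat P *v column j X) = column i X \<bullet> column j X + Y i \<bullet> Y j"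
          using inner_G_op[OF P, of "column j X" "column i X"] unfolding gmat_mult[OF P] PX
          by (metis inner_commute)
        thus ?thesis by (simp add: inner_vec_def[of "column i X"]) (simp add: column_def)
      qed
      ultimately show ?thesis by simp
    qed
    finally show ?thesis .
  qed
  have ev: "\<forall>\<^sub>F t in at 0. (K (X + t *\<^sub>R mat 1))\<^sup>2 \<le> ?\<Gamma> (X + t *\<^sub>R mat 1)"
    using eventually_det_nonzero[of X] by eventually_elim (rule inv)
  have ent: "((\<lambda>t. (X + t *\<^sub>R mat 1) $ i $ j) \<longlongrightarrow> X $ i $ j) (at 0)" for i j
    by (auto intro!: tendsto_eq_intros)
  have 1: "((\<lambda>t. ?\<Gamma> (X + t *\<^sub>R mat 1)) \<longlongrightarrow> ?\<Gamma> X) (at 0)"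
    unfolding vec_lambda_beta
    by (intro tendsto_det, unfold vec_lambda_beta) (intro tendsto_add tendsto_sum tendsto_mult tendsto_const ent)
  have 2: "((\<lambda>t. (K (X + t *\<^sub>R mat 1))\<^sup>2) \<longlongrightarrow> (K X)\<^sup>2) (at 0)"
  proof -
    have "((\<lambda>t. if i = k then c else (X + t *\<^sub>R mat 1) $ i $ j) \<longlongrightarrow> (if i = k then c else X $ i $ j)) (at 0)" for i j k c
      using ent[of i j] by (cases "i = k") auto
    thus ?thesis unfolding K_def
      by (intro tendsto_power tendsto_add tendsto_mult tendsto_const tendsto_sum tendsto_det ent, unfold vec_lambda_beta)
  qed
  show ?thesis by (rule tendsto_le[OF at_neq_bot 1 2 ev])
qed

lemma comass_cartan_form:
  fixes D :: "('n::{finite,linorder}) rvec \<Rightarrow> real ^ 'm"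
  assumes D: "linear D"
    and le: "\<And>z. adapted_frame D z \<Longrightarrow> (\<Sum>j\<in>UNIV. D (z j) \<bullet> D (z j)) \<le> 1"
    and vs: "length vs = CARD('n)" "orthonormal_list vs"
  shows "cartan_form (energy D) (momentum D) vs \<le> 1"
proof -
  define X where "X = (\<chi> (i::'n) j. fst (vs ! idx (j::'n)) $ i)"
  define Y where "Y j = snd (vs ! idx (j::'n))" for j
  have "(\<chi> i j. (\<Sum>k\<in>UNIV. X $ k $ i * X $ k $ j) + Y i \<bullet> Y j) = mat 1"
  proof -
    have "(\<Sum>k\<in>UNIV. X $ k $ i * X $ k $ j) + Y i \<bullet> Y j = vs ! idx i \<bullet> vs ! idx j" for i j
      by (simp add: X_def Y_def inner_prod_def inner_vec_def[of "fst _"])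
    thus ?thesis using vs by (simp add: vec_eq_iff mat_def orthonormal_list_def idx_less idx_inject)
  qed
  moreover have "cartan_form (energy D) (momentum D) vs =
      energy D * det X + (\<Sum>k\<in>UNIV. det (\<chi> i j. if i = k then momentum D k \<bullet> Y j else X $ i $ j))"
    unfolding cartan_form_def det_form_def X_def Y_def
    by (intro arg_cong2[where f="(+)"] arg_cong2[where f="(*)"] refl sum.cong arg_cong[where f=det])
      (auto simp: vec_eq_iff dx_def)
  ultimately have "(cartan_form (energy D) (momentum D) vs)\<^sup>2 \<le> 1"
    using cartan_gram_bound[OF D le, where X=X and Y=Y] by simp
  thus ?thesis by (simp add: power2_le_iff_abs_le abs_le_square_iff[of _ 1, simplified] abs_le_D1)
qed

section \<open>The minimal surface system\<close>

lemma normal_part_diff: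
  fixes T :: "'v::euclidean_space set"
  assumes T: "subspace T"
  shows "v - normal_part T v \<in> T"
proof -
  obtain y z where y: "y \<in> span T" "\<And>w. w \<in> span T \<Longrightarrow> orthogonal z w" "v = y + z"
    using orthogonal_subspace_decomp_exists[of T v] by blast
  have ex: "z \<in> orthogonal_comp T \<and> v - z \<in> T"
    using y T span_base[of _ T] by (auto simp: orthogonal_comp_def orthogonal_commute span_eq_iff[THEN iffD2])
  have "w = z" if "w \<in> orthogonal_comp T \<and> v - w \<in> T" for w
  proof -
    have "(v - z) - (v - w) \<in> T" using subspace_diff[OF T, of "v - z" "v - w"] that ex by blast
    hence "w - z \<in> T" by simp
    moreover have "w - z \<in> orthogonal_comp T"
      using that ex by (auto simp: orthogonal_comp_def orthogonal_def inner_diff_right)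
    ultimately have "orthogonal (w - z) (w - z)" by (simp add: orthogonal_comp_def)
    thus ?thesis by (simp add: orthogonal_def)
  qed
  hence "normal_part T v = z" unfolding normal_part_def using ex by blast
  thus ?thesis using ex by simp
qed

text \<open>The harmonicity of the coordinate functions, sum_k d_k (W g^{kj}) = 0, divided by the
  area density W. Here \<open>c\<close> is the inverse metric and \<open>g a b k\<close> is d_k d_a
  F . d_b F. Of the two halves of the derivative of the metric one is killed by \<open>min\<close>;
  the other cancels the derivative of W by the symmetry of second derivatives.\<close>

lemma divergence_bracket_zero:
  fixes c :: "'n::finite \<Rightarrow> 'n \<Rightarrow> real" and g :: "'n \<Rightarrow> 'n \<Rightarrow> 'n \<Rightarrow> real"
  assumes c: "\<And>a b. c a b = c b a" and g: "\<And>a b k. g b a k = g k a b"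
    and min: "\<And>b. (\<Sum>k\<in>UNIV. \<Sum>a\<in>UNIV. c k a * g a b k) = 0"
  shows "(\<Sum>k\<in>UNIV. - (\<Sum>a\<in>UNIV. \<Sum>b\<in>UNIV. c k a * (g a b k + g b a k) * c b j) +
    (1/2 * (\<Sum>i\<in>UNIV. \<Sum>a\<in>UNIV. (g i a k + g a i k) * c a i)) * c k j) = 0"
proof -
  have half: "1/2 * (\<Sum>i\<in>UNIV. \<Sum>a\<in>UNIV. (g i a k + g a i k) * c a i) = (\<Sum>a\<in>UNIV. \<Sum>b\<in>UNIV. c a b * g a b k)" for k
  proof -
    have "(\<Sum>i\<in>UNIV. \<Sum>a\<in>UNIV. (g i a k + g a i k) * c a i) =
        (\<Sum>i\<in>UNIV. \<Sum>a\<in>UNIV. g i a k * c a i) + (\<Sum>i\<in>UNIV. \<Sum>a\<in>UNIV. g a i k * c a i)"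
      by (simp only: distrib_right sum.distrib)
    also have "(\<Sum>i\<in>UNIV. \<Sum>a\<in>UNIV. g i a k * c a i) = (\<Sum>i\<in>UNIV. \<Sum>a\<in>UNIV. c i a * g i a k)"
      by (intro sum.cong refl) (metis c mult.commute)
    also have "(\<Sum>i\<in>UNIV. \<Sum>a\<in>UNIV. g a i k * c a i) = (\<Sum>i\<in>UNIV. \<Sum>a\<in>UNIV. c a i * g a i k)"
      by (simp only: mult.commute)
    also have "(\<Sum>i\<in>UNIV. \<Sum>a\<in>UNIV. c a i * g a i k) = (\<Sum>i\<in>UNIV. \<Sum>a\<in>UNIV. c i a * g i a k)"
      by (rule sum.swap)
    finally show ?thesis by simp
  qed
  have 1: "(\<Sum>k\<in>UNIV. \<Sum>a\<in>UNIV. \<Sum>b\<in>UNIV. c k a * g a b k * c b j) = 0"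
  proof -
    have "(\<Sum>k\<in>UNIV. \<Sum>a\<in>UNIV. \<Sum>b\<in>UNIV. c k a * g a b k * c b j) =
        (\<Sum>k\<in>UNIV. \<Sum>b\<in>UNIV. \<Sum>a\<in>UNIV. c k a * g a b k * c b j)"
      by (intro sum.cong refl sum.swap)
    also have "\<dots> = (\<Sum>b\<in>UNIV. \<Sum>k\<in>UNIV. \<Sum>a\<in>UNIV. c k a * g a b k * c b j)" by (rule sum.swap)
    also have "\<dots> = (\<Sum>b\<in>UNIV. (\<Sum>k\<in>UNIV. \<Sum>a\<in>UNIV. c k a * g a b k) * c b j)"
      by (simp add: sum_distrib_right)
    finally show ?thesis by (simp add: min)
  qed
  have 2: "(\<Sum>k\<in>UNIV. \<Sum>a\<in>UNIV. \<Sum>b\<in>UNIV. c k a * g b a k * c b j) =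
      (\<Sum>k\<in>UNIV. \<Sum>a\<in>UNIV. \<Sum>b\<in>UNIV. c a b * g a b k * c k j)"
  proof -
    have "(\<Sum>k\<in>UNIV. \<Sum>a\<in>UNIV. \<Sum>b\<in>UNIV. c a b * g a b k * c k j) =
        (\<Sum>a\<in>UNIV. \<Sum>k\<in>UNIV. \<Sum>b\<in>UNIV. c a b * g a b k * c k j)" by (rule sum.swap)
    also have "\<dots> = (\<Sum>a\<in>UNIV. \<Sum>b\<in>UNIV. \<Sum>k\<in>UNIV. c a b * g a b k * c k j)"
      by (intro sum.cong refl sum.swap)
    also have "\<dots> = (\<Sum>k\<in>UNIV. \<Sum>a\<in>UNIV. \<Sum>b\<in>UNIV. c k a * g b a k * c b j)"
      by (intro sum.cong refl) (simp add: g[symmetric])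
    finally show ?thesis ..
  qed
  show ?thesis unfolding half
    using 1 2 by (simp add: sum_negf sum.distrib distrib_left distrib_right sum_distrib_right sum_subtractf)
qed

text \<open>Differentiating the entries of G C = 1 gives G C' + G' C = 0, and multiplication by C
  from the left isolates C'.\<close>

lemma inverse_matrix_derivative:
  fixes G C :: "'a::euclidean_space \<Rightarrow> real ^ 'n ^ 'n"
  assumes U: "open U" "x \<in> U" and GC: "\<And>y. y \<in> U \<Longrightarrow> G y ** C y = mat 1"
    and G': "\<And>i j. ((\<lambda>y. G y $ i $ j) has_derivative G' i j) (at x)"
    and C': "\<And>i j. ((\<lambda>y. C y $ i $ j) has_derivative C' i j) (at x)"
  shows "C' k j v = - (\<Sum>a\<in>UNIV. \<Sum>b\<in>UNIV. C x $ k $ a * G' a b v * C x $ b $ j)"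
proof -
  have z: "(\<Sum>b\<in>UNIV. G x $ a $ b * C' b j v + G' a b v * C x $ b $ j) = 0" for a
  proof -
    have "((\<lambda>y. \<Sum>b\<in>UNIV. G y $ a $ b * C y $ b $ j) has_derivative
        (\<lambda>v. \<Sum>b\<in>UNIV. G x $ a $ b * C' b j v + G' a b v * C x $ b $ j)) (at x)"
      by (intro has_derivative_sum has_derivative_mult G' C')
    moreover have "((\<lambda>y. \<Sum>b\<in>UNIV. G y $ a $ b * C y $ b $ j) has_derivative (\<lambda>v. 0)) (at x)"
    proof (rule has_derivative_transform_within_open[OF has_derivative_const U])
      fix y assume "y \<in> U"
      from GC[OF this] show "(if a = j then 1 else 0) = (\<Sum>b\<in>UNIV. G y $ a $ b * C y $ b $ j)"
        by (simp add: vec_eq_iff matrix_matrix_mult_def mat_def)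
    qed
    ultimately have "(\<lambda>v. \<Sum>b\<in>UNIV. G x $ a $ b * C' b j v + G' a b v * C x $ b $ j) = (\<lambda>v. 0)"
      by (rule has_derivative_unique)
    thus ?thesis by (rule fun_cong)
  qed
  have CG: "(\<Sum>a\<in>UNIV. C x $ k $ a * G x $ a $ b) = (if k = b then 1 else 0)" for b
  proof -
    have "C x ** G x = mat 1" using GC[OF U(2)] matrix_left_right_inverse by blast
    thus ?thesis by (simp add: vec_eq_iff matrix_matrix_mult_def mat_def)
  qed
  have "0 = (\<Sum>a\<in>UNIV. C x $ k $ a * (\<Sum>b\<in>UNIV. G x $ a $ b * C' b j v + G' a b v * C x $ b $ j))"
    by (simp add: z)
  also have "\<dots> = (\<Sum>a\<in>UNIV. \<Sum>b\<in>UNIV. C x $ k $ a * G x $ a $ b * C' b j v) +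
      (\<Sum>a\<in>UNIV. \<Sum>b\<in>UNIV. C x $ k $ a * G' a b v * C x $ b $ j)"
    by (simp add: sum_distrib_left sum.distrib distrib_left mult.assoc)
  also have "(\<Sum>a\<in>UNIV. \<Sum>b\<in>UNIV. C x $ k $ a * G x $ a $ b * C' b j v) =
      (\<Sum>b\<in>UNIV. (\<Sum>a\<in>UNIV. C x $ k $ a * G x $ a $ b) * C' b j v)"
    by (subst sum.swap) (simp add: sum_distrib_right)
  also have "\<dots> = (\<Sum>b\<in>UNIV. if k = b then C' b j v else 0)"
    unfolding CG by (intro sum.cong) auto
  also have "\<dots> = C' k j v" by simp
  finally show ?thesis by simp
qed

lemma has_derivative_det:
  fixes G :: "'a::real_normed_vector \<Rightarrow> real ^ 'n ^ 'n"
  assumes G': "\<And>i j. ((\<lambda>y. G y $ i $ j) has_derivative G' i j) (at x)"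
  shows "((\<lambda>y. det (G y)) has_derivative
    (\<lambda>v. \<Sum>k\<in>UNIV. det (\<chi> i j. if i = k then G' i j v else G x $ i $ j))) (at x)"
proof -
  have "((\<lambda>y. det (G y)) has_derivative (\<lambda>v. \<Sum>p | p permutes (UNIV :: 'n set).
      of_int (sign p) * (\<Sum>k\<in>UNIV. G' k (p k) v * (\<Prod>i\<in>UNIV - {k}. G x $ i $ p i)))) (at x)"
    unfolding det_def
    by (intro has_derivative_sum has_derivative_mult_right has_derivative_prod G')
  moreover have "(\<Sum>p | p permutes (UNIV :: 'n set).
      of_int (sign p) * (\<Sum>k\<in>UNIV. G' k (p k) v * (\<Prod>i\<in>UNIV - {k}. G x $ i $ p i))) =
      (\<Sum>k\<in>UNIV. det (\<chi> i j. if i = k then G' i j v else G x $ i $ j))" for v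
  proof -
    have "G' k (p k) v * (\<Prod>i\<in>UNIV - {k}. G x $ i $ p i) =
        (\<Prod>i\<in>UNIV. if i = k then G' i (p i) v else G x $ i $ p i)" for p k
      by (subst prod.remove[of UNIV k]) (auto intro!: prod.cong)
    hence "(\<Sum>p | p permutes (UNIV :: 'n set).
        of_int (sign p) * (\<Sum>k\<in>UNIV. G' k (p k) v * (\<Prod>i\<in>UNIV - {k}. G x $ i $ p i))) =
        (\<Sum>p | p permutes (UNIV :: 'n set). \<Sum>k\<in>UNIV. of_int (sign p) *
          (\<Prod>i\<in>UNIV. if i = k then G' i (p i) v else G x $ i $ p i))"
      by (simp add: sum_distrib_left)
    thus ?thesis by (subst (asm) sum.swap) (simp add: det_def)
  qed
  ultimately show ?thesis by simp
qed

text \<open>Jacobi's formula. Row \<open>k\<close> of the derivative is a combination of the rows of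
  \<open>G x\<close> with coefficients from the product G' C, and only the coefficient of row
  \<open>k\<close> survives in the determinant.\<close>

lemma has_derivative_det_trace:
  fixes G :: "'a::real_normed_vector \<Rightarrow> real ^ 'n ^ 'n"
  assumes G': "\<And>i j. ((\<lambda>y. G y $ i $ j) has_derivative G' i j) (at x)"
    and C: "C ** G x = mat 1"
  shows "((\<lambda>y. det (G y)) has_derivative
    (\<lambda>v. (\<Sum>i\<in>UNIV. \<Sum>a\<in>UNIV. G' i a v * C $ a $ i) * det (G x))) (at x)"
proof -
  have "det (\<chi> i j. if i = k then G' i j v else G x $ i $ j) = (\<Sum>a\<in>UNIV. G' k a v * C $ a $ k) * det (G x)" for k v
  proof -
    have E: "G' k j v = (\<Sum>l\<in>UNIV. (\<Sum>a\<in>UNIV. G' k a v * C $ a $ l) * G x $ l $ j)" for j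
    proof -
      have "(\<Sum>l\<in>UNIV. C $ a $ l * G x $ l $ j) = (if a = j then 1 else 0)" for a
        using C by (simp add: vec_eq_iff matrix_matrix_mult_def mat_def)
      hence "(\<Sum>a\<in>UNIV. G' k a v * (\<Sum>l\<in>UNIV. C $ a $ l * G x $ l $ j)) = (\<Sum>a\<in>UNIV. if a = j then G' k j v else 0)"
        by (intro sum.cong refl) simp
      hence "(\<Sum>a\<in>UNIV. G' k a v * (\<Sum>l\<in>UNIV. C $ a $ l * G x $ l $ j)) = G' k j v" by simp
      moreover have "(\<Sum>a\<in>UNIV. G' k a v * (\<Sum>l\<in>UNIV. C $ a $ l * G x $ l $ j)) =
          (\<Sum>l\<in>UNIV. (\<Sum>a\<in>UNIV. G' k a v * C $ a $ l) * G x $ l $ j)"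
        by (simp add: sum_distrib_left sum_distrib_right mult.assoc) (rule sum.swap)
      ultimately show ?thesis by simp
    qed
    have "(\<chi> i j. if i = k then G' i j v else G x $ i $ j) =
        (\<chi> i j. if i = k then \<Sum>l\<in>UNIV. (\<Sum>a\<in>UNIV. G' k a v * C $ a $ l) * G x $ l $ j else G x $ i $ j)"
      unfolding E[symmetric] by (simp add: vec_eq_iff)
    thus ?thesis by (simp only: det_row_combination)
  qed
  thus ?thesis using has_derivative_det[OF G'] by (simp add: sum_distrib_right)
qed

section \<open>Second derivatives of a minimal graph\<close>

context
  fixes \<Omega> :: "('n::{finite,linorder}) rvec set" and F :: "'n rvec \<Rightarrow> real ^ 'm::finite"
  assumes \<Omega>: "open \<Omega>" and F: "smooth_on F \<Omega>"
begin

abbreviation (input) dF where "dF x \<equiv> frechet_derivative F (at x)"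

abbreviation (input) d2F where
  "d2F k l x \<equiv> frechet_derivative (\<lambda>y. frechet_derivative F (at y) (axis k 1)) (at x) (axis l 1)"

lemma has_derivative_dF:
  "x \<in> \<Omega> \<Longrightarrow> ((\<lambda>y. dF y v) has_derivative frechet_derivative (\<lambda>y. dF y v) (at x)) (at x)"
  using smooth_on_has_derivative[OF smooth_on_frechet_derivative[OF F]] .

lemma second_derivative_expansion:
  assumes x: "x \<in> \<Omega>"
  shows "frechet_derivative (\<lambda>y. dF y v) (at x) u = (\<Sum>k\<in>UNIV. \<Sum>l\<in>UNIV. (v $ k * u $ l) *\<^sub>R d2F k l x)"
proof -
  have "((\<lambda>y. \<Sum>k\<in>UNIV. v $ k *\<^sub>R dF y (axis k 1)) has_derivative
      (\<lambda>u. \<Sum>k\<in>UNIV. v $ k *\<^sub>R frechet_derivative (\<lambda>y. dF y (axis k 1)) (at x) u)) (at x)"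
    by (intro has_derivative_sum has_derivative_scaleR_right has_derivative_dF x)
  hence "((\<lambda>y. dF y v) has_derivative
      (\<lambda>u. \<Sum>k\<in>UNIV. v $ k *\<^sub>R frechet_derivative (\<lambda>y. dF y (axis k 1)) (at x) u)) (at x)"
    by (rule has_derivative_transform_within_open[OF _ \<Omega> x])
      (rule linear_axis_expansion[OF linear_dF[OF \<Omega> F], symmetric])
  from fun_cong[OF frechet_derivative_at[OF this], of u]
  have "frechet_derivative (\<lambda>y. dF y v) (at x) u =
      (\<Sum>k\<in>UNIV. v $ k *\<^sub>R frechet_derivative (\<lambda>y. dF y (axis k 1)) (at x) u)" by simp
  also have "\<dots> = (\<Sum>k\<in>UNIV. v $ k *\<^sub>R (\<Sum>l\<in>UNIV. u $ l *\<^sub>R d2F k l x))"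
    by (intro sum.cong refl arg_cong2[where f=scaleR] linear_axis_expansion
      has_derivative_linear[OF has_derivative_dF[OF x]])
  finally show ?thesis by (simp add: scaleR_sum_right)
qed

text \<open>The trace of the second derivatives of the graph map over an adapted frame is vertical,
  of the form (0, q). Vanishing mean curvature places it in the tangent space, whose only vertical
  vector is 0.\<close>

lemma minimal_surface_system:
  assumes x: "x \<in> \<Omega>" and min: "mean_curvature F x = 0"
  shows "(\<Sum>k\<in>UNIV. \<Sum>l\<in>UNIV. matrix_inv (gmat (dF x)) $ k $ l *\<^sub>R d2F k l x) = 0"
proof -
  have dif: "F differentiable (at y)" if "y \<in> \<Omega>" for y using smooth_on_differentiable[OF F that] .
  have D: "linear (dF x)" by (rule linear_dF[OF \<Omega> F x])
  obtain z :: "'n \<Rightarrow> 'n rvec" where z: "adapted_frame (dF x) z"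
    "length (tangent_onb F x) = CARD('n)"
    "\<And>j. tangent_onb F x ! idx j = (z j, dF x (z j))"
    "0 < det (\<chi> k j. z j $ k)"
    by (rule tangent_onb_frame[OF dif[OF x]]) (rule that)
  let ?T = "tangent_space F x"
  define q where "q j = (\<Sum>k\<in>UNIV. \<Sum>l\<in>UNIV. (z j $ k * z j $ l) *\<^sub>R d2F k l x)" for j
  have qj: "frechet_derivative (\<lambda>y. dF y (z j)) (at x) (z j) = q j" for j
    unfolding q_def by (rule second_derivative_expansion[OF x])
  have II: "second_fundamental_form (graph_map F) x (z j) (z j) = normal_part ?T (0, q j)" for j
  proof -
    have "((\<lambda>y. (z j, dF y (z j))) has_derivative
        (\<lambda>u. (0, frechet_derivative (\<lambda>y. dF y (z j)) (at x) u))) (at x)"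
      by (intro has_derivative_Pair has_derivative_const has_derivative_dF x)
    hence "((\<lambda>y. frechet_derivative (graph_map F) (at y) (z j)) has_derivative
        (\<lambda>u. (0, frechet_derivative (\<lambda>y. dF y (z j)) (at x) u))) (at x)"
    proof (rule has_derivative_transform_within_open[OF _ \<Omega> x])
      fix y assume "y \<in> \<Omega>"
      show "(z j, dF y (z j)) = frechet_derivative (graph_map F) (at y) (z j)"
        unfolding frechet_derivative_graph_map[OF dif[OF \<open>y \<in> \<Omega>\<close>]] ..
    qed
    from fun_cong[OF frechet_derivative_at[OF this], of "z j"]
    have "frechet_derivative (\<lambda>y. frechet_derivative (graph_map F) (at y) (z j)) (at x) (z j) = (0, q j)"
      unfolding qj by (rule sym)
    thus ?thesis unfolding second_fundamental_form_def tangent_space_def by (simp only:)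
  qed
  have T: "subspace ?T"
    unfolding tangent_space_eq[OF dif[OF x]]
    by (intro linear_subspace_image subspace_UNIV linearI) (simp_all add: linear_add[OF D] linear_scale[OF D])
  have "(\<Sum>j\<in>UNIV. normal_part ?T (0, q j)) = 0"
    using min unfolding mean_curvature_def sum_list_tangent_onb[OF z(2)] z(3) fst_conv II .
  hence "(\<Sum>j\<in>UNIV. (0, q j)) = (\<Sum>j\<in>UNIV. (0, q j) - normal_part ?T (0, q j))"
    by (simp add: sum_subtractf)
  also have "\<dots> \<in> ?T" by (intro subspace_sum T normal_part_diff)
  finally have "(\<Sum>j\<in>UNIV. (0 :: 'n rvec, q j)) \<in> ?T" .
  moreover have "(\<Sum>j\<in>UNIV. (0 :: 'n rvec, q j)) = (0, \<Sum>j\<in>UNIV. q j)" by (simp add: sum_prod)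
  ultimately have "(\<Sum>j\<in>UNIV. q j) = 0"
    unfolding tangent_space_eq[OF dif[OF x]] using linear_0[OF D] by auto
  moreover have "(\<Sum>j\<in>UNIV. q j) = (\<Sum>k\<in>UNIV. \<Sum>l\<in>UNIV. (\<Sum>j\<in>UNIV. z j $ k * z j $ l) *\<^sub>R d2F k l x)"
  proof -
    have "(\<Sum>j\<in>UNIV. q j) = (\<Sum>k\<in>UNIV. \<Sum>j\<in>UNIV. \<Sum>l\<in>UNIV. (z j $ k * z j $ l) *\<^sub>R d2F k l x)"
      unfolding q_def by (rule sum.swap)
    also have "\<dots> = (\<Sum>k\<in>UNIV. \<Sum>l\<in>UNIV. \<Sum>j\<in>UNIV. (z j $ k * z j $ l) *\<^sub>R d2F k l x)"
      by (intro sum.cong refl sum.swap)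
    finally show ?thesis by (simp add: scaleR_sum_left)
  qed
  ultimately show ?thesis by (simp add: adapted_frame_inverse(1)[OF D z(1)])
qed

text \<open>By the product rule the divergence is the sum of W g^{kj} d_k d_j F and of d_k (W
  g^{kj}) d_j F. The first is the minimal surface system; in the second the coefficient of each d_j
  F vanishes by \<open>divergence_bracket_zero\<close>.\<close>

lemma momentum_divergence_free:
  assumes x: "x \<in> \<Omega>" and min: "mean_curvature F x = 0"
  shows "(\<Sum>k\<in>UNIV. frechet_derivative (\<lambda>y. momentum (dF y) k) (at x) (axis k 1)) = 0"
proof -
  have D: "linear (dF y)" if "y \<in> \<Omega>" for y by (rule linear_dF[OF \<Omega> F that])
  define G where "G y = gmat (dF y)" for y
  define C where "C y = matrix_inv (G y)" for y
  define W where "W y = area (dF y)" for y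
  define f where "f k = dF x (axis k 1)" for k
  define f' where "f' k = frechet_derivative (\<lambda>y. dF y (axis k 1)) (at x)" for k
  define G' where "G' i j v = f' i v \<bullet> f j + f i \<bullet> f' j v" for i j v
  define C' where "C' i j = frechet_derivative (\<lambda>y. C y $ i $ j) (at x)" for i j
  define W' where "W' v = W x * (1/2 * (\<Sum>i\<in>UNIV. \<Sum>a\<in>UNIV. G' i a v * C x $ a $ i))" for v
  have df: "((\<lambda>y. dF y (axis k 1)) has_derivative f' k) (at x)" for k
    unfolding f'_def by (rule has_derivative_dF[OF x])
  have dG: "((\<lambda>y. G y $ i $ j) has_derivative G' i j) (at x)" for i j
  proof (rule has_derivative_transform_within_open[OF _ \<Omega> x])
    show "((\<lambda>y. (if i = j then 1 else 0) + dF y (axis i 1) \<bullet> dF y (axis j 1)) has_derivative G' i j) (at x)"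
      unfolding G'_def f_def
      by (rule has_derivative_eq_rhs[OF has_derivative_add[OF has_derivative_const has_derivative_inner[OF df df]]])
        (simp add: fun_eq_iff add.commute)
  qed (simp add: G_def gmat_nth[OF D])
  have dC: "((\<lambda>y. C y $ i $ j) has_derivative C' i j) (at x)" for i j
    unfolding C'_def C_def G_def by (rule smooth_on_has_derivative[OF smooth_on_ginv[OF \<Omega> F] x])
  have GC: "G y ** C y = mat 1" if "y \<in> \<Omega>" for y
    unfolding C_def G_def by (rule gmat_det_pos(2)[OF D[OF that]])
  have CG: "C x ** G x = mat 1" using GC[OF x] matrix_left_right_inverse by blast
  have pos: "0 < det (G x)" unfolding G_def by (rule gmat_det_pos(1)[OF D[OF x]])
  have dW: "(W has_derivative W') (at x)"
  proof -
    have W: "W = (\<lambda>y. sqrt (det (G y)))" by (simp add: W_def area_def G_def fun_eq_iff)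
    have "W x * W x = det (G x)" using pos by (simp add: W)
    moreover have "W x \<noteq> 0" using pos by (simp add: W)
    ultimately have "det (G x) * inverse (W x) = W x" by (metis mult.assoc right_inverse mult.right_neutral)
    hence "S * det (G x) * (inverse (W x) / 2) = W x * (1/2 * S)" for S :: real
      by (metis (no_types, lifting) mult.assoc mult.commute times_divide_eq_left times_divide_eq_right mult.left_neutral)
    hence S: "S * det (G x) * (inverse (sqrt (det (G x))) / 2) = W x * (1/2 * S)" for S :: real
      by (simp only: W)
    have "((\<lambda>y. sqrt (det (G y))) has_derivative W') (at x)"
      unfolding W'_def
      by (rule has_derivative_eq_rhs[OF has_derivative_real_sqrt[OF pos has_derivative_det_trace[OF dG CG]]])
        (simp only: S[symmetric] fun_eq_iff mult_ac simp_thms)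
    thus ?thesis by (simp only: W)
  qed
  have sym: "C x $ a $ b = C x $ b $ a" for a b
  proof -
    obtain z where "adapted_frame (dF x) z" by (rule adapted_eigenframe[OF D[OF x]]) (rule that)
    from adapted_frame_inverse(1)[OF D[OF x] this] show ?thesis
      unfolding C_def G_def by (metis (no_types, lifting) mult.commute sum.cong)
  qed
  have mixed: "f' k (axis l 1) = f' l (axis k 1)" for k l
    unfolding f'_def by (rule mixed_derivatives_eq[OF \<Omega> x F])
  have mss: "(\<Sum>k\<in>UNIV. \<Sum>l\<in>UNIV. C x $ k $ l *\<^sub>R f' l (axis k 1)) = 0"
    using minimal_surface_system[OF assms] unfolding mixed[of _ _] f'_def[symmetric] C_def G_def
    by (simp add: mixed)
  have C'_eq: "C' k j v = - (\<Sum>a\<in>UNIV. \<Sum>b\<in>UNIV. C x $ k $ a * G' a b v * C x $ b $ j)" for k j v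
    by (rule inverse_matrix_derivative[OF \<Omega> x GC dG dC])
  define g where "g a b k = f' a (axis k 1) \<bullet> f b" for a b k
  have bracket: "(\<Sum>k\<in>UNIV. W x * C' k j (axis k 1) + W' (axis k 1) * C x $ k $ j) = 0" for j
  proof -
    have "(\<Sum>k\<in>UNIV. \<Sum>a\<in>UNIV. C x $ k $ a * g a b k) = (\<Sum>k\<in>UNIV. \<Sum>l\<in>UNIV. C x $ k $ l *\<^sub>R f' l (axis k 1)) \<bullet> f b" for b
      by (simp add: g_def inner_sum_left)
    hence m: "(\<Sum>k\<in>UNIV. \<Sum>a\<in>UNIV. C x $ k $ a * g a b k) = 0" for b by (simp add: mss)
    have s: "g b a k = g k a b" for a b k by (simp add: g_def mixed)
    have G'g: "G' a b (axis k 1) = g a b k + g b a k" for a b k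
      by (simp add: G'_def g_def inner_commute)
    have "(\<Sum>k\<in>UNIV. W x * C' k j (axis k 1) + W' (axis k 1) * C x $ k $ j) =
        W x * (\<Sum>k\<in>UNIV. - (\<Sum>a\<in>UNIV. \<Sum>b\<in>UNIV. C x $ k $ a * (g a b k + g b a k) * C x $ b $ j) +
          (1/2 * (\<Sum>i\<in>UNIV. \<Sum>a\<in>UNIV. (g i a k + g a i k) * C x $ a $ i)) * C x $ k $ j)"
    proof -
      have alg: "w * p + (w * q) * r = w * (p + q * r)" for w p q r :: real
        by (simp add: algebra_simps)
      show ?thesis
        unfolding C'_eq W'_def G'g alg sum_distrib_left[symmetric] ..
    qed
    thus ?thesis
      using divergence_bracket_zero[of "\<lambda>a b. C x $ a $ b" g j, OF sym s m] by simp
  qed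
  have dM: "frechet_derivative (\<lambda>y. momentum (dF y) k) (at x) v =
      (\<Sum>j\<in>UNIV. (W x * C x $ k $ j) *\<^sub>R f' j v) + (\<Sum>j\<in>UNIV. (W x * C' k j v + W' v * C x $ k $ j) *\<^sub>R f j)" for k v
  proof -
    have m: "(\<lambda>y. momentum (dF y) k) = (\<lambda>y. W y *\<^sub>R (\<Sum>j\<in>UNIV. C y $ k $ j *\<^sub>R dF y (axis j 1)))"
      by (simp add: momentum_def W_def C_def G_def)
    have "((\<lambda>y. momentum (dF y) k) has_derivative (\<lambda>v. W x *\<^sub>R (\<Sum>j\<in>UNIV. C x $ k $ j *\<^sub>R f' j v + C' k j v *\<^sub>R f j) +
        W' v *\<^sub>R (\<Sum>j\<in>UNIV. C x $ k $ j *\<^sub>R f j))) (at x)"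
      unfolding m f_def by (intro has_derivative_scaleR has_derivative_sum dW dC df)
    from fun_cong[OF frechet_derivative_at[OF this], of v] show ?thesis
      by (simp add: scaleR_sum_right scaleR_add_right scaleR_add_left sum.distrib add.assoc)
  qed
  have "(\<Sum>k\<in>UNIV. frechet_derivative (\<lambda>y. momentum (dF y) k) (at x) (axis k 1)) =
      (\<Sum>k\<in>UNIV. \<Sum>j\<in>UNIV. (W x * C x $ k $ j) *\<^sub>R f' j (axis k 1)) +
      (\<Sum>k\<in>UNIV. \<Sum>j\<in>UNIV. (W x * C' k j (axis k 1) + W' (axis k 1) * C x $ k $ j) *\<^sub>R f j)"
    unfolding dM sum.distrib ..
  also have "(\<Sum>k\<in>UNIV. \<Sum>j\<in>UNIV. (W x * C x $ k $ j) *\<^sub>R f' j (axis k 1)) =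
      W x *\<^sub>R (\<Sum>k\<in>UNIV. \<Sum>l\<in>UNIV. C x $ k $ l *\<^sub>R f' l (axis k 1))"
    by (simp add: scaleR_sum_right)
  also have "\<dots> = 0" by (simp add: mss)
  also have "(\<Sum>k\<in>UNIV. \<Sum>j\<in>UNIV. (W x * C' k j (axis k 1) + W' (axis k 1) * C x $ k $ j) *\<^sub>R f j) =
      (\<Sum>j\<in>UNIV. (\<Sum>k\<in>UNIV. W x * C' k j (axis k 1) + W' (axis k 1) * C x $ k $ j) *\<^sub>R f j)"
    by (subst sum.swap) (simp add: scaleR_sum_left)
  also have "\<dots> = 0" by (simp add: bracket)
  finally show ?thesis by simp
qed

end

section \<open>Closedness\<close>

text \<open>Cramer's rule with the denominator cleared. Both sides are polynomial in
  \<open>A\<close>, so the invertible case passes to the limit along A + t.\<close>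

lemma cramer_singular:
  fixes A :: "real ^ 'n ^ 'n"
  shows "(\<Sum>k\<in>UNIV. A $ l $ k * det (\<chi> i j. if j = k then b $ i else A $ i $ j)) = det A * b $ l"
proof -
  let ?f = "\<lambda>A :: real ^ 'n ^ 'n. (\<Sum>k\<in>UNIV. A $ l $ k * det (\<chi> i j. if j = k then b $ i else A $ i $ j)) - det A * b $ l"
  have nz: "?f A = 0" if "det A \<noteq> 0" for A
  proof -
    define x where "x = (\<chi> k. det (\<chi> i j. if j = k then b $ i else A $ i $ j) / det A)"
    have "A *v x = b" using cramer[OF that, of x b] by (simp add: x_def)
    hence "(\<Sum>k\<in>UNIV. A $ l $ k * x $ k) = b $ l" by (auto simp: matrix_vector_mult_def)
    hence "det A * b $ l = (\<Sum>k\<in>UNIV. A $ l $ k * (det A * x $ k))"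
      by (simp add: sum_distrib_left mult.left_commute flip: \<open>_ = b $ l\<close>)
    also have "\<dots> = (\<Sum>k\<in>UNIV. A $ l $ k * det (\<chi> i j. if j = k then b $ i else A $ i $ j))"
      using that by (simp add: x_def)
    finally show ?thesis by simp
  qed
  have ev: "\<forall>\<^sub>F t in at 0. ?f (A + t *\<^sub>R mat 1) = 0"
    using eventually_det_nonzero[of A] by eventually_elim (rule nz)
  have ent: "((\<lambda>t. (A + t *\<^sub>R mat 1) $ i $ j) \<longlongrightarrow> A $ i $ j) (at 0)" for i j
    by (auto intro!: tendsto_eq_intros)
  have "((\<lambda>t. if j = k then b $ i else (A + t *\<^sub>R mat 1) $ i $ j) \<longlongrightarrow> (if j = k then b $ i else A $ i $ j)) (at 0)" for i j k
    using ent[of i j] by (cases "j = k") auto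
  hence "((\<lambda>t. ?f (A + t *\<^sub>R mat 1)) \<longlongrightarrow> ?f A) (at 0)"
    by (intro tendsto_diff tendsto_sum tendsto_mult tendsto_const tendsto_det ent, unfold vec_lambda_beta)
  moreover have "((\<lambda>t. ?f (A + t *\<^sub>R mat 1)) \<longlongrightarrow> 0) (at 0)"
    using ev by (rule tendsto_eventually)
  ultimately have "?f A = 0" by (rule tendsto_unique[OF at_neq_bot])
  thus ?thesis by simp
qed

text \<open>The covector \<open>\<beta> l\<close> occurs twice in the wedge. Concretely, the n + 1
  arguments become vectors of R^n: the first is the right-hand side \<open>b\<close> of
  \<open>cramer_singular\<close>, the others are the columns of \<open>A\<close>, and entry
  \<open>l\<close> of that identity is the vanishing of the alternating sum.\<close>

lemma covector_wedge_row:
  fixes \<beta> :: "'n::{finite,linorder} \<Rightarrow> 'v \<Rightarrow> real"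
  assumes len: "length vs = Suc CARD('n)"
  shows "covector_wedge (\<beta> l) (det_form \<beta>) vs = 0"
proof -
  define u where "u v = (\<chi> i. \<beta> i v)" for v
  let ?E = "det_form (\<lambda>(i::'n) w. w $ i)"
  have E: "det_form \<beta> ws = ?E (map u ws)" if "length ws = CARD('n)" for ws
    using that by (simp add: det_form_def u_def idx_less)
  have altE: "alternating_form CARD('n) ?E"
    by (rule alternating_det_form) (simp add: linearI)
  obtain v ws where vs: "vs = v # ws" "length ws = CARD('n)" using len by (cases vs) auto
  define w where "w = map u ws"
  have w: "length w = CARD('n)" using vs by (simp add: w_def)
  have "covector_wedge (\<beta> l) (det_form \<beta>) vs =
      \<beta> l v * det_form \<beta> ws + (\<Sum>i<CARD('n). (-1) ^ Suc i * \<beta> l (ws ! i) * det_form \<beta> (v # delete_nth i ws))"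
    unfolding covector_wedge_def len sum.lessThan_Suc_shift by (simp add: vs delete_nth_def)
  also have "(\<Sum>i<CARD('n). (-1) ^ Suc i * \<beta> l (ws ! i) * det_form \<beta> (v # delete_nth i ws)) =
      - (\<Sum>i<CARD('n). (w ! i $ l) * ?E (w[i := u v]))"
    unfolding sum_negf[symmetric]
  proof (rule sum.cong)
    fix i assume i: "i \<in> {..<CARD('n)}"
    have "det_form \<beta> (v # delete_nth i ws) = ?E (u v # delete_nth i w)"
      using i vs by (subst E) (auto simp: delete_nth_def w_def take_map drop_map)
    also have "\<dots> = (-1) ^ i * ?E (w[i := u v])"
      using i by (intro alternating_form_delete_nth[OF altE w]) auto
    finally have eq: "det_form \<beta> (v # delete_nth i ws) = (-1) ^ i * ?E (w[i := u v])" .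
    have "\<beta> l (ws ! i) = w ! i $ l" using i vs by (simp add: w_def u_def)
    moreover have "(-1) ^ Suc i * b * ((-1) ^ i * c) = - (b * c)" for b c :: real
      by (simp flip: power_add mult_2 mult.assoc)
    ultimately show "(-1) ^ Suc i * \<beta> l (ws ! i) * det_form \<beta> (v # delete_nth i ws) = - ((w ! i $ l) * ?E (w[i := u v]))"
      unfolding eq by simp
  qed simp
  also have "(\<Sum>i<CARD('n). (w ! i $ l) * ?E (w[i := u v])) = (\<Sum>k::'n\<in>UNIV. (w ! idx k $ l) * ?E (w[idx k := u v]))"
    using sum_idx[where 'n='n and g="\<lambda>i. (w ! i $ l) * ?E (w[i := u v])"] by simp
  also have "\<dots> = (\<Sum>k\<in>UNIV. (\<chi> i j. w ! idx j $ i) $ l $ k *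
      det (\<chi> i j. if j = k then u v $ i else (\<chi> i j. w ! idx j $ i) $ i $ j))"
  proof (rule sum.cong)
    fix k :: 'n
    have "?E (w[idx k := u v]) = det (transpose (\<chi> i j. if j = k then u v $ i else (\<chi> i j. w ! idx j $ i) $ i $ j))"
      unfolding det_form_update[OF w] by (intro arg_cong[where f=det]) (auto simp: vec_eq_iff transpose_def)
    thus "(w ! idx k $ l) * ?E (w[idx k := u v]) = (\<chi> i j. w ! idx j $ i) $ l $ k *
      det (\<chi> i j. if j = k then u v $ i else (\<chi> i j. w ! idx j $ i) $ i $ j)" by simp
  qed simp
  also have "\<dots> = det (\<chi> i j. w ! idx j $ i) * u v $ l" by (rule cramer_singular)
  also have "\<dots> = \<beta> l v * det_form \<beta> ws"
    using E[OF vs(2)] by (simp add: det_form_def w_def u_def)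
  finally show ?thesis by simp
qed

text \<open>Moving a covector from the front into row \<open>k\<close> is a transposition of rows; it follows by
  polarization from the vanishing for equal rows.\<close>

lemma covector_wedge_swap:
  fixes \<beta> :: "'n::{finite,linorder} \<Rightarrow> 'v \<Rightarrow> real"
  assumes len: "length vs = Suc CARD('n)"
  shows "covector_wedge (\<beta> k) (det_form (\<beta>(k := b))) vs = - covector_wedge b (det_form \<beta>) vs"
proof -
  let ?s = "\<lambda>w. \<beta> k w + b w"
  have "0 = covector_wedge ?s (det_form (\<beta>(k := ?s))) vs"
    using covector_wedge_row[OF len, of "\<beta>(k := ?s)" k] by simp
  also have "det_form (\<beta>(k := ?s)) = (\<lambda>ws. det_form \<beta> ws + det_form (\<beta>(k := b)) ws)"
    by (rule ext) (simp only: det_form_row_add fun_upd_triv)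
  also have "covector_wedge ?s \<dots> vs = covector_wedge (\<beta> k) (det_form \<beta>) vs + covector_wedge b (det_form \<beta>) vs +
      (covector_wedge (\<beta> k) (det_form (\<beta>(k := b))) vs + covector_wedge b (det_form (\<beta>(k := b))) vs)"
    unfolding covector_wedge_def by (simp add: algebra_simps sum.distrib)
  also have "covector_wedge (\<beta> k) (det_form \<beta>) vs = 0" by (rule covector_wedge_row[OF len])
  also have "covector_wedge b (det_form (\<beta>(k := b))) vs = 0"
    using covector_wedge_row[OF len, of "\<beta>(k := b)" k] by simp
  finally show ?thesis by linarith
qed

text \<open>Linearity in the coefficient lets smoothness and derivatives of the form be read off
  from those of the momentum.\<close>

lemma linear_cartan_row:
  "linear (\<lambda>a :: real ^ 'm. det_form (dx(k := \<lambda>w. a \<bullet> snd w)) vs)"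
  by (intro linearI) (simp_all only: inner_add_left inner_scaleR_left det_form_row_add det_form_row_scale real_scaleR_def)

lemma alternating_cartan_form:
  fixes \<pi> :: "'n::{finite,linorder} \<Rightarrow> real ^ 'm"
  shows "alternating_form CARD('n) (cartan_form h \<pi>)"
proof -
  have dx: "linear (dx i)" for i by (simp add: dx_def linearI)
  have 1: "alternating_form CARD('n) (det_form (dx :: 'n \<Rightarrow> 'n rvec \<times> (real ^ 'm) \<Rightarrow> real))"
    by (rule alternating_det_form[OF dx])
  have 2: "alternating_form CARD('n) (det_form (dx(k := \<lambda>w. \<pi> k \<bullet> snd w)))" for k
  proof (rule alternating_det_form)
    fix i show "linear ((dx(k := \<lambda>w. \<pi> k \<bullet> snd w)) i)"
      using dx[of i] by (cases "i = k") (simp_all add: linearI inner_add_right)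
  qed
  show ?thesis unfolding alternating_form_def
  proof (intro allI impI conjI)
    fix vs :: "('n rvec \<times> (real ^ 'm)) list" and i assume vs: "length vs = CARD('n)" "i < CARD('n)"
    show "linear (\<lambda>v. cartan_form h \<pi> (vs[i := v]))"
      unfolding cartan_form_def
      by (intro linear_compose_add linear_compose_sum ballI allI impI alternating_form_linear[OF 2 vs]
        linear_compose_scale_right[where 'b=real, unfolded real_scaleR_def] alternating_form_linear[OF 1 vs])
  next
    fix vs :: "('n rvec \<times> (real ^ 'm)) list" and i j
    assume "length vs = CARD('n)" "i < CARD('n)" "j < CARD('n)" "i \<noteq> j" "vs ! i = vs ! j"
    thus "cartan_form h \<pi> vs = 0"
      by (simp add: cartan_form_def alternating_form_eq[OF 1] alternating_form_eq[OF 2])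
  qed
qed

section \<open>Smoothness and exterior derivative of \<open>Theta F\<close>\<close>

context
  fixes \<Omega> :: "('n::{finite,linorder}) rvec set" and F :: "'n rvec \<Rightarrow> real ^ 'm::finite"
  assumes \<Omega>: "open \<Omega>" and F: "smooth_on F \<Omega>"
begin

lemma Theta_cartan:
  assumes "p \<in> \<Omega> \<times> UNIV" "length vs = CARD('n)"
  shows "Theta F p vs = cartan_form (energy (frechet_derivative F (at (fst p))))
    (momentum (frechet_derivative F (at (fst p)))) vs"
  using Theta_eq_cartan_form[OF smooth_on_differentiable[OF F], of "fst p" vs "snd p"] assms by auto

lemma smooth_form_Theta: "smooth_form_on CARD('n) (\<Omega> \<times> UNIV) (Theta F)"
  unfolding smooth_form_on_def
proof (intro conjI ballI allI impI)
  fix p assume "p \<in> \<Omega> \<times> (UNIV :: 'm rvec set)"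
  thus "alternating_form CARD('n) (Theta F p)"
    by (intro alternating_form_cong[OF alternating_cartan_form]) (rule Theta_cartan)
next
  fix vs :: "('n, 'm) ambient list" assume vs: "length vs = CARD('n)"
  have op: "open (\<Omega> \<times> (UNIV :: 'm rvec set))" using \<Omega> by (simp add: open_Times)
  have "smooth_on (\<lambda>p. cartan_form (energy (frechet_derivative F (at (fst p))))
    (momentum (frechet_derivative F (at (fst p)))) vs) (\<Omega> \<times> (UNIV :: 'm rvec set))"
    unfolding cartan_form_def
    by (intro smooth_on_add smooth_on_sum smooth_on_mult smooth_on_const op
      smooth_on_bounded_linear[OF op linear_conv_bounded_linear[THEN iffD1, OF linear_cartan_row]]
      smooth_on_comp_fst[OF \<Omega>] smooth_on_energy[OF \<Omega> F] smooth_on_momentum[OF \<Omega> F])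
  thus "smooth_on (\<lambda>p. Theta F p vs) (\<Omega> \<times> UNIV)"
    by (rule smooth_on_cong[OF op, rotated]) (simp add: Theta_cartan vs)
qed

text \<open>The coefficients depend on x alone, so differentiation brings in only covectors dx_l. A
  term whose determinant still contains the same dx_l vanishes. What remains is l = k in the
  momentum part, where slot k has lost its dx_k; swapping it back in, the sum over k is minus (div
  pi . dy) wedge dx_1 ... dx_n.\<close>

lemma exterior_derivative_Theta:
  assumes x: "x \<in> \<Omega>" and min: "mean_curvature F x = 0" and vs: "length vs = Suc CARD('n)"
  shows "exterior_derivative (Theta F) (x, y) vs = 0"
proof -
  define h where "h x = energy (frechet_derivative F (at x))" for x
  define \<pi> where "\<pi> k x = momentum (frechet_derivative F (at x)) k" for k x
  define h' where "h' = frechet_derivative h (at x)"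
  define \<pi>' where "\<pi>' k = frechet_derivative (\<pi> k) (at x)" for k
  have dh: "(h has_derivative h') (at x)"
    unfolding h'_def h_def by (rule smooth_on_has_derivative[OF smooth_on_energy[OF \<Omega> F] x])
  have d\<pi>: "(\<pi> k has_derivative \<pi>' k) (at x)" for k
    unfolding \<pi>'_def \<pi>_def by (rule smooth_on_has_derivative[OF smooth_on_momentum[OF \<Omega> F] x])
  let ?p = "(x, y)"
  \<comment> \<open>The covector that pairs the partial derivative d_l pi_k with dy.\<close>
  define b where "b k l w = \<pi>' k (axis l 1) \<bullet> snd w" for k l and w :: "('n, 'm) ambient"
  have d: "frechet_derivative (\<lambda>q. Theta F q ws) (at ?p) w =
      (\<Sum>l\<in>UNIV. h' (axis l 1) * (dx l w * det_form dx ws)) +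
      (\<Sum>k\<in>UNIV. \<Sum>l\<in>UNIV. dx l w * det_form (dx(k := b k l)) ws)"
    if ws: "length ws = CARD('n)" for ws w
  proof -
    have op: "open (\<Omega> \<times> (UNIV :: 'm rvec set))" using \<Omega> by (simp add: open_Times)
    have fst: "(fst has_derivative fst) (at ?p)"
      by (rule bounded_linear_imp_has_derivative[OF bounded_linear_fst])
    have dh': "((\<lambda>q. h (fst q)) has_derivative (\<lambda>w. h' (fst w))) (at ?p)"
      using has_derivative_compose[OF fst, of h h'] dh by simp
    have d\<pi>': "((\<lambda>q. \<pi> k (fst q)) has_derivative (\<lambda>w. \<pi>' k (fst w))) (at ?p)" for k
      using has_derivative_compose[OF fst, of "\<pi> k" "\<pi>' k"] d\<pi> by simp
    have "((\<lambda>q. cartan_form (h (fst q)) (\<lambda>k. \<pi> k (fst q)) ws) has_derivative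
        (\<lambda>w. h' (fst w) * det_form dx ws + (\<Sum>k\<in>UNIV. det_form (dx(k := \<lambda>u. \<pi>' k (fst w) \<bullet> snd u)) ws))) (at ?p)"
      unfolding cartan_form_def
      by (intro has_derivative_add has_derivative_mult_left has_derivative_sum dh'
        bounded_linear.has_derivative[OF linear_conv_bounded_linear[THEN iffD1, OF linear_cartan_row] d\<pi>'])
    hence "((\<lambda>q. Theta F q ws) has_derivative
        (\<lambda>w. h' (fst w) * det_form dx ws + (\<Sum>k\<in>UNIV. det_form (dx(k := \<lambda>u. \<pi>' k (fst w) \<bullet> snd u)) ws))) (at ?p)"
      by (rule has_derivative_transform_within_open[OF _ op]) (use x ws in \<open>auto simp: Theta_cartan h_def \<pi>_def\<close>)
    from fun_cong[OF frechet_derivative_at[OF this], of w]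
    have "frechet_derivative (\<lambda>q. Theta F q ws) (at ?p) w =
        h' (fst w) * det_form dx ws + (\<Sum>k\<in>UNIV. det_form (dx(k := \<lambda>u. \<pi>' k (fst w) \<bullet> snd u)) ws)" by simp
    also have "h' (fst w) = (\<Sum>l\<in>UNIV. dx l w * h' (axis l 1))"
      by (subst linear_axis_expansion[OF has_derivative_linear[OF dh]]) (simp add: dx_def)
    also have "(\<Sum>k\<in>UNIV. det_form (dx(k := \<lambda>u. \<pi>' k (fst w) \<bullet> snd u)) ws) =
        (\<Sum>k\<in>UNIV. \<Sum>l\<in>UNIV. dx l w * det_form (dx(k := b k l)) ws)"
    proof (rule sum.cong)
      fix k :: 'n
      have "(\<lambda>u. \<pi>' k (fst w) \<bullet> snd u) = (\<lambda>u :: ('n, 'm) ambient. \<Sum>l\<in>UNIV. dx l w * b k l u)"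
        by (subst linear_axis_expansion[OF has_derivative_linear[OF d\<pi>]]) (simp add: dx_def b_def inner_sum_left)
      thus "det_form (dx(k := \<lambda>u. \<pi>' k (fst w) \<bullet> snd u)) ws = (\<Sum>l\<in>UNIV. dx l w * det_form (dx(k := b k l)) ws)"
        by (simp only: det_form_row_sum[OF finite])
    qed simp
    also have "(\<Sum>l\<in>UNIV. dx l w * h' (axis l 1)) * det_form dx ws =
        (\<Sum>l\<in>UNIV. h' (axis l 1) * (dx l w * det_form dx ws))"
      unfolding sum_distrib_right by (intro sum.cong refl) (simp only: mult_ac)
    finally show ?thesis .
  qed
  have "exterior_derivative (Theta F) ?p vs = (\<Sum>i<Suc CARD('n). (-1) ^ i *
      ((\<Sum>l\<in>UNIV. h' (axis l 1) * (dx l (vs ! i) * det_form dx (delete_nth i vs))) +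
      (\<Sum>k\<in>UNIV. \<Sum>l\<in>UNIV. dx l (vs ! i) * det_form (dx(k := b k l)) (delete_nth i vs))))"
    unfolding exterior_derivative_def vs
    by (intro sum.cong refl arg_cong2[where f="(*)"] d) (auto simp: delete_nth_def vs)
  also have "\<dots> = (\<Sum>l\<in>UNIV. h' (axis l 1) * covector_wedge (dx l) (det_form dx) vs) +
      (\<Sum>k\<in>UNIV. \<Sum>l\<in>UNIV. covector_wedge (dx l) (det_form (dx(k := b k l))) vs)"
  proof -
    have "(\<Sum>i<Suc CARD('n). (-1) ^ i * (\<Sum>l\<in>UNIV. h' (axis l 1) * (dx l (vs ! i) * det_form dx (delete_nth i vs)))) =
        (\<Sum>l\<in>UNIV. h' (axis l 1) * covector_wedge (dx l) (det_form dx) vs)"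
      unfolding covector_wedge_def vs sum_distrib_left
      by (subst sum.swap) (intro sum.cong refl, simp add: mult_ac)
    moreover have "(\<Sum>i<Suc CARD('n). (-1) ^ i * (\<Sum>k\<in>UNIV. \<Sum>l\<in>UNIV. dx l (vs ! i) * det_form (dx(k := b k l)) (delete_nth i vs))) =
        (\<Sum>k\<in>UNIV. \<Sum>l\<in>UNIV. covector_wedge (dx l) (det_form (dx(k := b k l))) vs)"
    proof -
      have "(\<Sum>i<Suc CARD('n). (-1) ^ i * (\<Sum>k\<in>UNIV. \<Sum>l\<in>UNIV. dx l (vs ! i) * det_form (dx(k := b k l)) (delete_nth i vs))) =
        (\<Sum>i<Suc CARD('n). \<Sum>k\<in>UNIV. \<Sum>l\<in>UNIV. (-1) ^ i * dx l (vs ! i) * det_form (dx(k := b k l)) (delete_nth i vs))"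
        by (simp only: sum_distrib_left mult.assoc)
      also have "\<dots> = (\<Sum>k\<in>UNIV. \<Sum>i<Suc CARD('n). \<Sum>l\<in>UNIV. (-1) ^ i * dx l (vs ! i) * det_form (dx(k := b k l)) (delete_nth i vs))"
        by (rule sum.swap)
      also have "\<dots> = (\<Sum>k\<in>UNIV. \<Sum>l\<in>UNIV. \<Sum>i<Suc CARD('n). (-1) ^ i * dx l (vs ! i) * det_form (dx(k := b k l)) (delete_nth i vs))"
        by (rule sum.cong[OF refl], rule sum.swap)
      finally show ?thesis by (simp only: covector_wedge_def vs)
    qed
    ultimately show ?thesis by (simp only: distrib_left sum.distrib)
  qed
  also have "(\<Sum>l\<in>UNIV. h' (axis l 1) * covector_wedge (dx l) (det_form dx) vs) = 0"
    by (simp add: covector_wedge_row[OF vs])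
  also have "(\<Sum>k\<in>UNIV. \<Sum>l\<in>UNIV. covector_wedge (dx l) (det_form (dx(k := b k l))) vs) =
      (\<Sum>k\<in>UNIV. - covector_wedge (b k k) (det_form dx) vs)"
  proof (rule sum.cong)
    fix k :: 'n
    have "covector_wedge (dx l) (det_form (dx(k := b k l))) vs = (if l = k then - covector_wedge (b k k) (det_form dx) vs else 0)" for l
    proof (cases "l = k")
      case True
      thus ?thesis using covector_wedge_swap[OF vs, of dx k "b k k"] by simp
    next
      case False
      thus ?thesis using covector_wedge_row[OF vs, of "dx(k := b k l)" l] by simp
    qed
    thus "(\<Sum>l\<in>UNIV. covector_wedge (dx l) (det_form (dx(k := b k l))) vs) = - covector_wedge (b k k) (det_form dx) vs"
      by simp
  qed simp
  also have "\<dots> = - (\<Sum>i<Suc CARD('n). (-1) ^ i * (\<Sum>k\<in>UNIV. b k k (vs ! i)) * det_form dx (delete_nth i vs))"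
    unfolding sum_negf covector_wedge_def vs sum_distrib_left sum_distrib_right by (subst sum.swap) (rule refl)
  also have "\<dots> = 0"
  proof -
    have "(\<Sum>k\<in>UNIV. b k k w) = (\<Sum>k\<in>UNIV. \<pi>' k (axis k 1)) \<bullet> snd w" for w
      by (simp add: b_def inner_sum_left)
    moreover have "(\<Sum>k\<in>UNIV. \<pi>' k (axis k 1)) = 0"
      unfolding \<pi>'_def \<pi>_def by (rule momentum_divergence_free[OF \<Omega> F x min])
    ultimately show ?thesis by simp
  qed
  finally show ?thesis by simp
qed

end

section \<open>The calibration theorem\<close>

lemma comass_le:
  fixes \<xi> :: "'v::euclidean_space form"
  assumes k: "k \<le> DIM('v)" and le: "\<And>es. length es = k \<Longrightarrow> orthonormal_list es \<Longrightarrow> \<xi> es \<le> c"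
  shows "comass k \<xi> \<le> c"
  unfolding comass_def
proof (rule cSup_least)
  \<comment> \<open>Some orthonormal list of length \<open>k\<close> must be exhibited, as the
    \<open>Sup\<close> over an empty set would obey no bound; \<open>k\<close> vectors of the
    standard basis provide one.\<close>
  obtain bs where bs: "set bs = (Basis :: 'v set)" "distinct bs"
    using finite_distinct_list[OF finite_Basis] by blast
  have "length (take k bs) = k" using k bs distinct_card[of bs] by simp
  moreover have "orthonormal_list (take k bs)"
    using bs by (auto simp: orthonormal_list_def inner_Basis nth_eq_iff_index_eq nth_mem[of _ bs, unfolded bs(1)])
  ultimately show "{\<xi> es |es. length es = k \<and> orthonormal_list es} \<noteq> {}" by blast
qed (use le in blast)

theorem theorem1p5:
  fixes \<Omega> :: "(real ^ 'n::{finite,linorder}) set"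
    and F :: "real ^ 'n::{finite,linorder} \<Rightarrow> real ^ 'm::finite"
    and r :: nat
  assumes "open \<Omega>" and "connected \<Omega>" and "\<Omega> \<noteq> {}"
    and "smooth_on F \<Omega>"
    and "minimal_graph \<Omega> F"
    and "r = (SUP x\<in>\<Omega>. rank (matrix (frechet_derivative F (at x))))"
    and "2 \<le> r"
    and "\<forall>x\<in>\<Omega>. \<forall>j k. 1 \<le> j \<and> j < k \<and> k \<le> r \<longrightarrow>
           singular_value (frechet_derivative F (at x)) j *
           singular_value (frechet_derivative F (at x)) k \<le> 1 / (real r - 1)\<^sup>2"
  shows "calibration CARD('n) (\<Omega> \<times> UNIV) (Theta F) \<and> calibrates_graph (Theta F) \<Omega> F"
proof -
  \<comment> \<open>The supremum \<open>r\<close> is taken in the natural numbers and dominates the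
    ranks because they are bounded. The same bound gives \<open>r \<le> CARD('n)\<close>, so the
    list of singular values has entries up to \<open>r\<close>.\<close>
  have rank: "rank (matrix (frechet_derivative F (at x))) \<le> CARD('n)" for x
    using rank_bound[of "matrix (frechet_derivative F (at x))"] by simp
  have "rank (matrix (frechet_derivative F (at x))) \<le> r" if "x \<in> \<Omega>" for x
    unfolding assms(6) using that rank by (intro cSUP_upper bdd_aboveI2)
  moreover have "r \<le> CARD('n)" unfolding assms(6) using assms(3) rank by (rule cSUP_least)
  moreover have lin: "linear (frechet_derivative F (at x))" if "x \<in> \<Omega>" for x
    by (rule linear_dF[OF assms(1,4) that])
  ultimately have energy: "(\<Sum>j\<in>UNIV. frechet_derivative F (at x) (z j) \<bullet> frechet_derivative F (at x) (z j)) \<le> 1"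
    if "x \<in> \<Omega>" "adapted_frame (frechet_derivative F (at x)) z" for x and z :: "'n \<Rightarrow> 'n rvec"
    using that assms(7,8) by (intro adapted_frame_energy_le_one[of _ z r]) auto
  have "closed_form_on CARD('n) (\<Omega> \<times> UNIV) (Theta F)"
    unfolding closed_form_on_def
    using smooth_form_Theta[OF assms(1,4)] exterior_derivative_Theta[OF assms(1,4)] assms(5)
    by (auto simp: minimal_graph_def)
  moreover have "comass CARD('n) (Theta F p) \<le> 1" if p: "p \<in> \<Omega> \<times> UNIV" for p
  proof (rule comass_le)
    fix es :: "('n, 'm) ambient list" assume es: "length es = CARD('n)" "orthonormal_list es"
    have x: "fst p \<in> \<Omega>" using p by auto
    show "Theta F p es \<le> 1"
      unfolding Theta_cartan[OF assms(1,4) p es(1)]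
      by (rule comass_cartan_form[OF lin[OF x] energy[OF x] es])
  qed simp
  moreover have "Theta F (graph_map F x) vs = graph_vol F x vs"
    if "x \<in> \<Omega>" "length vs = CARD('n)" "set vs \<subseteq> tangent_space F x" for x vs
    unfolding graph_map_def using that smooth_on_differentiable[OF assms(4)] by (intro Theta_tangent) auto
  ultimately show ?thesis by (auto simp: calibration_def calibrates_graph_def)
qed

end
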